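(* Let $X_1,X_2,\dots$ be independent real-valued random variables with the same distribution density $\phi$, where $\phi$ is of Schwartz class. For $p,q\in\mathbb N$ let $S_p=X_1+\cdots+X_p$ and $T_{p+q}=\max(0,S_1,\dots,S_p,S_{p+1},\dots,S_{p+q})$. Then for $|a|,|b|<1$ (and real $\alpha,\beta$) $$\begin{aligned}\sum_{p,q=1}^\infty a^pb^q\,\mathbb E\big\{e^{i\alpha S_p+i\beta T_{p+q}}\big\}=\sum_{j,k=1}^\infty\frac1{j!}\frac1{k!}&\int_{-\infty}^\infty\!\!\cdots\!\int_{-\infty}^\infty e^{i\alpha(y_1+\cdots+y_j)+i\beta\,\Omega_{j,k}(y_1,\dots,y_j,z_1,\dots,z_k)}\\&\times\mathcal F^{-1}_{\substack{\eta_1\to y_1,\dots,\eta_j\to y_j\\ \zeta_1\to z_1,\dots,\zeta_k\to z_k}}\bigg[\Phi_j\Big[\frac{as}{1-as}\Big]\big(\hat\phi(\eta_1),\dots,\hat\phi(\eta_j)\big)\\&\qquad\times\Phi_k\Big[\frac{bt}{1-bt}\Big]\big(\hat\phi(\zeta_1),\dots,\hat\phi(\zeta_k)\big)\bigg]dy_1\cdots dy_j\,dz_1\cdots dz_k.\end{aligned}$$ Here $\Phi_j$ and $\Phi_k$ act on the functions $s\mapsto\frac{as}{1-as}$ and $t\mapsto\frac{bt}{1-bt}$ respectively, and the results are evaluated at the indicated values of $\hat\phi$.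
   Context: For real $x$: $(x)_+=\max(0,x)$ and $-(x)_-=\min(0,x)$. For $j,k\in\mathbb N$ and real $y_1,\dots,y_j,z_1,\dots,z_k$, $$\Omega_{j,k}(y_1,\dots,y_j,z_1,\dots,z_k)=(y_1)_++\cdots+(y_j)_++\big(-(y_1)_--\cdots-(y_j)_-+(z_1)_++\cdots+(z_k)_+\big)_+.$$ $\Phi_j$, $j\in\mathbb N$, is the linear map (extended termwise to convergent power series without constant term) sending monomials to functions of $j$ variables by $$\Phi_j[z^m](x_1,\dots,x_j)=\sum_{l_1,\dots,l_j\ge1,\ l_1+\cdots+l_j=m}\frac{x_1^{l_1}}{l_1}\cdots\frac{x_j^{l_j}}{l_j}\quad(m\ge j),\qquad\Phi_j[z^m]=0\quad(1\le m<j).$$ Fourier transforms: $\hat\phi(\eta)=\int_{-\infty}^\infty e^{-i\eta y}\phi(y)\,dy$, and $\mathcal F^{-1}_{\eta\to y}[f(\eta)]=(2\pi)^{-1}\int_{-\infty}^\infty e^{iy\eta}f(\eta)\,d\eta$, applied in each of the variables listed. *)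

theory Defs
  imports "HOL-Probability.Probability" "HOL-Complex_Analysis.Complex_Analysis"
begin

text \<open>Variables \<open>y\<^sub>1, \<dots>, y\<^sub>j\<close> are rendered as functions on \<^typ>\<open>nat\<close> of which only the values
  on \<open>{1..j}\<close> matter.\<close>

definition pos_part :: "real \<Rightarrow> real" where
  "pos_part x = max 0 x"

text \<open>Nonnegative, as in \<open>-(x)\<^sub>- = min(0,x)\<close>.\<close>

definition neg_part :: "real \<Rightarrow> real" where
  "neg_part x = - min 0 x"

definition Omega :: "nat \<Rightarrow> nat \<Rightarrow> (nat \<Rightarrow> real) \<Rightarrow> (nat \<Rightarrow> real) \<Rightarrow> real" where
  "Omega j k y z =
     (\<Sum>i=1..j. pos_part (y i)) +
     pos_part (- (\<Sum>i=1..j. neg_part (y i)) + (\<Sum>i=1..k. pos_part (z i)))"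

text \<open>\<open>\<Phi>\<^sub>j[z\<^sup>m]\<close>. The index set is finite, and it is empty for \<open>m < j\<close>.\<close>

definition Phi_monom :: "nat \<Rightarrow> nat \<Rightarrow> (nat \<Rightarrow> complex) \<Rightarrow> complex" where
  "Phi_monom j m x =
     (\<Sum>l \<in> {l \<in> {1..j} \<rightarrow>\<^sub>E {1..}. (\<Sum>i=1..j. l i) = m}.
        \<Prod>i=1..j. x i ^ l i / of_nat (l i))"

lemma finite_Phi_monom_index:
  "finite {l \<in> {1..(j::nat)} \<rightarrow>\<^sub>E {1..}. (\<Sum>i=1..j. l i) = (m::nat)}"
proof (rule finite_subset)
  show "{l \<in> {1..j} \<rightarrow>\<^sub>E {1..}. (\<Sum>i=1..j. l i) = m} \<subseteq> {1..j} \<rightarrow>\<^sub>E {1..m}"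
  proof clarify
    fix l :: "nat \<Rightarrow> nat"
    assume l: "l \<in> {1..j} \<rightarrow>\<^sub>E {1..}"
    have "l i \<le> (\<Sum>i=1..j. l i)" if "i \<in> {1..j}" for i
      by (rule member_le_sum) (use that in auto)
    with l show "l \<in> {1..j} \<rightarrow>\<^sub>E {1..\<Sum>i=1..j. l i}"
      unfolding PiE_iff by simp
  qed
qed (intro finite_PiE finite_atLeastAtMost)

lemma Phi_monom_eq_0:
  assumes "m < j"
  shows "Phi_monom j m x = 0"
proof -
  have "(\<Sum>i=1..j. l i) \<noteq> m" if "l \<in> {1..j} \<rightarrow>\<^sub>E {1..}" for l :: "nat \<Rightarrow> nat"
  proof -
    have "(\<Sum>i=1..j. 1) \<le> (\<Sum>i=1..j. l i)"
      using that by (intro sum_mono) auto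
    with assms show ?thesis by simp
  qed
  hence "{l \<in> {1..j} \<rightarrow>\<^sub>E {1..}. (\<Sum>i=1..j. l i) = m} = {}"
    by blast
  thus ?thesis
    unfolding Phi_monom_def by (simp only: sum.empty)
qed

text \<open>Termwise application of \<open>\<Phi>\<^sub>j\<close> to the power series at 0 of a function analytic near 0 and
  vanishing there; the summation index is shifted because there is no constant term.\<close>

definition Phi :: "nat \<Rightarrow> (complex \<Rightarrow> complex) \<Rightarrow> (nat \<Rightarrow> complex) \<Rightarrow> complex" where
  "Phi j f x = (\<Sum>m. fps_nth (fps_expansion f 0) (Suc m) * Phi_monom j (Suc m) x)"

definition fourier :: "(real \<Rightarrow> complex) \<Rightarrow> real \<Rightarrow> complex" where
  "fourier f \<eta> = (LINT y|lborel. exp (- \<i> * of_real (\<eta> * y)) * f y)"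

definition inv_fourier :: "(real \<Rightarrow> complex) \<Rightarrow> real \<Rightarrow> complex" where
  "inv_fourier f y = (LINT \<eta>|lborel. exp (\<i> * of_real (y * \<eta>)) * f \<eta>) / of_real (2 * pi)"

text \<open>Inverse transform in the \<open>i\<close>-th variable, the others being held fixed.\<close>

definition inv_fourier_at ::
    "nat \<Rightarrow> ((nat \<Rightarrow> real) \<Rightarrow> complex) \<Rightarrow> (nat \<Rightarrow> real) \<Rightarrow> complex" where
  "inv_fourier_at i F y = inv_fourier (\<lambda>\<eta>. F (y(i := \<eta>))) (y i)"

definition inv_fourier_vars ::
    "nat \<Rightarrow> ((nat \<Rightarrow> real) \<Rightarrow> complex) \<Rightarrow> (nat \<Rightarrow> real) \<Rightarrow> complex" where
  "inv_fourier_vars n F = fold inv_fourier_at [1..<Suc n] F"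

definition schwartz :: "(real \<Rightarrow> real) \<Rightarrow> bool" where
  "schwartz f \<longleftrightarrow>
     (\<forall>n x. (deriv ^^ n) f field_differentiable at x) \<and>
     (\<forall>m n. bounded (range (\<lambda>x. x ^ m * (deriv ^^ n) f x)))"

definition partial_sum :: "(nat \<Rightarrow> 'a \<Rightarrow> real) \<Rightarrow> nat \<Rightarrow> 'a \<Rightarrow> real" where
  "partial_sum X n \<omega> = (\<Sum>i=1..n. X i \<omega>)"

definition running_max :: "(nat \<Rightarrow> 'a \<Rightarrow> real) \<Rightarrow> nat \<Rightarrow> 'a \<Rightarrow> real" where
  "running_max X n \<omega> = Max (insert 0 ((\<lambda>i. partial_sum X i \<omega>) ` {1..n}))"

end

theory Submission
  imports Defs
begin

text \<open>Write \<open>S\<close> for the partial sums and \<open>T\<close> for the running maxima. Splitting the path at time \<open>p\<close> gives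
  \<open>T\<^sub>p\<^sub>+\<^sub>q = T\<^sub>p + (S\<^sub>p - T\<^sub>p + T')\<^sub>+\<close>, where \<open>T'\<close> is the running maximum of the walk made of the steps
  \<open>p + 1, \<dots>, p + q\<close>. The pair \<open>(S\<^sub>p, T\<^sub>p)\<close> and \<open>T'\<close> are independent, so the coefficient of \<open>a\<^sup>p b\<^sup>q\<close> on the
  left is the integral of a fixed bounded function (\<open>phase\<close>) against the laws of \<open>(S\<^sub>p, T\<^sub>p)\<close> and
  \<open>(S\<^sub>q, T\<^sub>q)\<close>. The function \<open>\<Omega>\<close> is built in the same way from \<open>(\<Sum>y\<^sub>i, \<Sum>(y\<^sub>i)\<^sub>+)\<close> and
  \<open>\<Sum>(z\<^sub>i)\<^sub>+\<close>. Hence everything rests on Spitzer's identity in the strong form of an equality of joint laws: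
  for bounded Borel \<open>f\<close>,

  \<open>E f(S\<^sub>p, T\<^sub>p) = \<Sum>\<^sub>j 1/j! \<Sum> (1/(l\<^sub>1 \<cdots> l\<^sub>j)) E f(\<Sum>Y\<^sub>i, \<Sum>(Y\<^sub>i)\<^sub>+)\<close>,

  the inner sum being over \<open>l\<^sub>1 + \<dots> + l\<^sub>j = p\<close> with \<open>l\<^sub>i \<ge> 1\<close>, and \<open>Y\<^sub>1, \<dots>, Y\<^sub>j\<close> being independent with
  \<open>Y\<^sub>i\<close> distributed as \<open>S\<close> at time \<open>l\<^sub>i\<close> (\<open>walk_law_expansion\<close>). General test functions are
  used because the phase couples \<open>S\<^sub>p\<close>, \<open>T\<^sub>p\<close> and \<open>T'\<close> in a nonlinear way.

  The identity is proved algebraically. Let \<open>P\<close> be the push-forward of laws on the plane under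
  \<open>(s, t) \<mapsto> (s, t\<^sub>+)\<close>. It satisfies the Rota-Baxter relation with respect to convolution
  (\<open>rota_baxter\<close>), and the law \<open>R\<^sub>n\<close> of \<open>(S\<^sub>n, T\<^sub>n)\<close> satisfies \<open>R\<^sub>n\<^sub>+\<^sub>1 = P(\<mu> * R\<^sub>n)\<close>, where \<open>\<mu>\<close> is the law
  of \<open>(X, X)\<close>. These two facts and a telescoping sum give
  \<open>n R\<^sub>n = \<Sum> P(\<mu>\<^sup>l) * R\<^sub>n\<^sub>-\<^sub>l\<close>, summed over \<open>1 \<le> l \<le> n\<close> (\<open>walk_law_recursion\<close>). The right-hand side
  of the identity obeys the same recursion, because it is symmetric in the \<open>l\<^sub>i\<close>
  (\<open>expansion_recursion\<close>).

  On the analytic side, \<open>\<Phi>\<^sub>j[as/(1 - as)](x) = \<Prod>(\<Sum>\<^sub>l a\<^sup>l x\<^sub>i\<^sup>l / l)\<close> is a product of functions of one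
  variable (\<open>Phi_geometric\<close>), so the inverse Fourier transform may be taken factor by factor, and the
  inverse transform of the \<open>l\<close>-th power of the transform of \<open>\<phi>\<close> is the density of \<open>S\<^sub>l\<close>
  (\<open>sum_law_density\<close>). The latter is an inversion theorem, obtained from Levy's formula; it needs
  the transform of \<open>\<phi>\<close> to be integrable, and this is where smoothness and decay of \<open>\<phi>\<close> enter.

  Both sides are then sums of the same family \<open>double_term\<close>, grouped by \<open>(p, q)\<close> on the left and by
  \<open>(j, k)\<close> on the right. Taking \<open>f = 1\<close> in the identity shows that for each \<open>p\<close> the weights
  \<open>1/(j! l\<^sub>1 \<cdots> l\<^sub>j)\<close> add up to 1, so the family is dominated by \<open>\<Sum> |a|\<^sup>p |b|\<^sup>q\<close> and may be regrouped at will.\<close>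

section \<open>Probability laws tested on bounded Borel functions\<close>

definition borel_prob :: "'a::topological_space measure \<Rightarrow> bool" where
  "borel_prob \<mu> \<longleftrightarrow> prob_space \<mu> \<and> sets \<mu> = sets borel"

text \<open>Finite linear combinations of laws are only ever compared through their integrals against such
  functions, which avoids signed measures.\<close>

definition bounded_borel :: "('a::topological_space \<Rightarrow> complex) \<Rightarrow> bool" where
  "bounded_borel f \<longleftrightarrow> f \<in> borel_measurable borel \<and> bounded (range f)"

lemma borel_probD:
  assumes "borel_prob \<mu>"
  shows "prob_space \<mu>" "finite_measure \<mu>" "sigma_finite_measure \<mu>" "sets \<mu> = sets borel" "space \<mu> = UNIV"
proof -
  show "prob_space \<mu>" "sets \<mu> = sets borel" using assms by (auto simp: borel_prob_def)
  then interpret prob_space \<mu> by simp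
  show "finite_measure \<mu>" "sigma_finite_measure \<mu>" by unfold_locales
  show "space \<mu> = UNIV" using \<open>sets \<mu> = sets borel\<close> sets_eq_imp_space_eq by fastforce
qed

lemma borel_prob_distr:
  assumes "prob_space \<mu>" "f \<in> borel_measurable \<mu>"
  shows "borel_prob (distr \<mu> borel f)"
  using assms by (simp add: borel_prob_def prob_space.prob_space_distr)

lemma borel_prob_return: "borel_prob (return borel x)"
  by (simp add: borel_prob_def prob_space_return)

lemma integrable_bounded_borel:
  assumes "prob_space \<mu>" "bounded_borel f" "h \<in> borel_measurable \<mu>"
  shows "integrable \<mu> (\<lambda>x. f (h x))"
proof -
  interpret prob_space \<mu> by fact
  from assms(2) obtain B where B: "\<And>x. norm (f x) \<le> B"
    by (auto simp: bounded_borel_def bounded_iff)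
  have [measurable]: "f \<in> borel_measurable borel" using assms(2) by (simp add: bounded_borel_def)
  show ?thesis
    by (rule integrable_const_bound[where B=B]) (use B assms(3) in auto)
qed

lemma bounded_borel_compose:
  assumes "bounded_borel f" "h \<in> borel_measurable borel"
  shows "bounded_borel (\<lambda>x. f (h x))"
  using assms by (auto simp: bounded_borel_def bounded_iff)

lemma bounded_borel_average:
  fixes f :: "'a::ordered_euclidean_space \<Rightarrow> complex"
  assumes "bounded_borel f" "borel_prob \<nu>"
  shows "bounded_borel (\<lambda>x. \<integral>y. f (x + y) \<partial>\<nu>)"
proof -
  interpret prob_space \<nu> using borel_probD[OF assms(2)] by simp
  note [measurable_cong] = borel_probD(4)[OF assms(2)]
  from assms(1) obtain B where B: "\<And>x. norm (f x) \<le> B"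
    by (auto simp: bounded_borel_def bounded_iff)
  have [measurable]: "f \<in> borel_measurable borel" using assms(1) by (simp add: bounded_borel_def)
  have "norm (\<integral>y. f (x + y) \<partial>\<nu>) \<le> B" for x
  proof -
    have "norm (\<integral>y. f (x + y) \<partial>\<nu>) \<le> (\<integral>y. norm (f (x + y)) \<partial>\<nu>)"
      by (rule integral_norm_bound)
    also have "\<dots> \<le> (\<integral>y. B \<partial>\<nu>)"
      using integrable_bounded_borel[OF prob_space_axioms assms(1), of "\<lambda>y. x + y"]
      by (intro integral_mono integrable_norm) (auto intro: B)
    finally show ?thesis by (simp add: prob_space)
  qed
  then show ?thesis
    unfolding bounded_borel_def bounded_iff by (auto intro!: borel_measurable_lebesgue_integral)
qed

lemma borel_prob_convolution:
  assumes "borel_prob \<mu>" "borel_prob \<nu>"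
  shows "borel_prob (\<mu> \<star> \<nu>)"
proof -
  note [measurable_cong] = borel_probD(4)[OF assms(1)] borel_probD(4)[OF assms(2)]
  interpret pair_prob_space \<mu> \<nu>
    unfolding pair_prob_space_def pair_sigma_finite_def
    using assms by (simp add: borel_probD)
  show ?thesis unfolding convolution_def by (rule borel_prob_distr) (unfold_locales, measurable)
qed

lemma integral_convolution_distr:
  fixes f :: "'a::ordered_euclidean_space \<Rightarrow> complex"
  assumes "borel_prob \<mu>" "borel_prob \<nu>" "bounded_borel f"
    and [measurable]: "a \<in> borel_measurable borel" "b \<in> borel_measurable borel"
  shows "(\<integral>x. f x \<partial>(distr \<mu> borel a \<star> distr \<nu> borel b)) = (\<integral>(x,y). f (a x + b y) \<partial>(\<mu> \<Otimes>\<^sub>M \<nu>))"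
proof -
  note [measurable_cong] = borel_probD(4)[OF assms(1)] borel_probD(4)[OF assms(2)]
  have [measurable]: "f \<in> borel_measurable borel" using assms(3) by (simp add: bounded_borel_def)
  interpret N: prob_space \<nu> using assms(2) borel_probD by auto
  interpret N': prob_space "distr \<nu> borel b" by (rule N.prob_space_distr) simp
  have "distr \<mu> borel a \<Otimes>\<^sub>M distr \<nu> borel b = distr (\<mu> \<Otimes>\<^sub>M \<nu>) (borel \<Otimes>\<^sub>M borel) (\<lambda>(x, y). (a x, b y))"
    by (rule pair_measure_distr) (simp_all add: N'.sigma_finite_measure)
  then show ?thesis
    unfolding convolution_def by (simp add: integral_distr split_beta' distr_distr comp_def)
qed

lemma integral_convolution_pair:
  fixes f :: "'a::ordered_euclidean_space \<Rightarrow> complex"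
  assumes "borel_prob \<mu>" "borel_prob \<nu>" "bounded_borel f"
  shows "(\<integral>x. f x \<partial>(\<mu> \<star> \<nu>)) = (\<integral>(x,y). f (x + y) \<partial>(\<mu> \<Otimes>\<^sub>M \<nu>))"
proof -
  note [measurable_cong] = borel_probD(4)[OF assms(1)] borel_probD(4)[OF assms(2)]
  have [measurable]: "f \<in> borel_measurable borel" using assms(3) by (simp add: bounded_borel_def)
  show ?thesis
    unfolding convolution_def by (simp add: integral_distr split_beta')
qed

lemma integral_convolution:
  fixes f :: "'a::ordered_euclidean_space \<Rightarrow> complex"
  assumes "borel_prob \<mu>" "borel_prob \<nu>" "bounded_borel f"
  shows "(\<integral>x. f x \<partial>(\<mu> \<star> \<nu>)) = (\<integral>x. \<integral>y. f (x + y) \<partial>\<nu> \<partial>\<mu>)"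
proof -
  note [measurable_cong] = borel_probD(4)[OF assms(1)] borel_probD(4)[OF assms(2)]
  interpret pair_prob_space \<mu> \<nu>
    unfolding pair_prob_space_def pair_sigma_finite_def
    using assms by (simp add: borel_probD)
  have "integrable (\<mu> \<Otimes>\<^sub>M \<nu>) (\<lambda>z. f (fst z + snd z))"
    by (rule integrable_bounded_borel[OF _ assms(3)]) (unfold_locales, measurable)
  then have "(\<integral>x. \<integral>y. f (x + y) \<partial>\<nu> \<partial>\<mu>) = (\<integral>z. f (fst z + snd z) \<partial>(\<mu> \<Otimes>\<^sub>M \<nu>))"
    using integral_fst'[of "\<lambda>z. f (fst z + snd z)"] by (simp add: split_beta')
  then show ?thesis using assms by (simp add: integral_convolution_pair split_beta')
qed

lemma borel_prob_eqI:
  assumes "borel_prob \<mu>" "borel_prob \<nu>"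
    and "\<And>f. bounded_borel f \<Longrightarrow> (\<integral>x. f x \<partial>\<mu>) = (\<integral>x. f x \<partial>\<nu>)"
  shows "\<mu> = \<nu>"
proof (rule measure_eqI)
  interpret m: prob_space \<mu> using assms borel_probD by auto
  interpret n: prob_space \<nu> using assms borel_probD by auto
  show "sets \<mu> = sets \<nu>" using assms borel_probD by metis
  fix A assume A: "A \<in> sets \<mu>"
  then have [measurable]: "A \<in> sets borel" "A \<in> sets \<mu>" "A \<in> sets \<nu>"
     using assms borel_probD(4) by metis+
  have "bounded_borel (\<lambda>x. complex_of_real (indicator A x))"
    by (auto simp: bounded_borel_def bounded_iff indicator_def intro!: exI[of _ 1])
  then have "(\<integral>x. complex_of_real (indicator A x) \<partial>\<mu>) = (\<integral>x. complex_of_real (indicator A x) \<partial>\<nu>)"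
    by (rule assms)
  then have "complex_of_real (measure \<mu> A) = complex_of_real (measure \<nu> A)"
    by (simp add: borel_probD(5)[OF assms(1)] borel_probD(5)[OF assms(2)])
  then show "emeasure \<mu> A = emeasure \<nu> A"
    by (simp add: m.emeasure_eq_measure n.emeasure_eq_measure)
qed

section \<open>Clipping as a Rota-Baxter operator\<close>

text \<open>The first coordinate carries the position of the walk and is never changed; only the second
  coordinate, which carries the maximum, is clipped at 0.\<close>

definition clip :: "real \<times> real \<Rightarrow> real \<times> real" where
  "clip = (\<lambda>(s, t). (s, max 0 t))"

lemma measurable_clip [measurable]: "clip \<in> borel_measurable borel"
  unfolding clip_def by (simp add: borel_prod[symmetric] split_beta')

abbreviation clip_law :: "(real \<times> real) measure \<Rightarrow> (real \<times> real) measure" where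
  "clip_law \<mu> \<equiv> distr \<mu> borel clip"

lemma clip_law_prob: "borel_prob \<mu> \<Longrightarrow> borel_prob (clip_law \<mu>)"
  by (rule borel_prob_distr) (auto simp: borel_probD cong: measurable_cong_sets)

text \<open>The pointwise source of the Rota-Baxter relation: according to the signs of the second
  coordinates, each value on the left equals one of the values on the right.\<close>

lemma clip_exchange:
  "{# clip x + clip y, clip (x + y) #} = {# clip (x + clip y), clip (clip x + y) #}"
  by (cases x; cases y) (auto simp: clip_def max_def)

text \<open>All four laws are push-forwards of the product law of \<open>u\<close> and \<open>v\<close>, so integrating the pointwise
  exchange of values under any test function gives the relation.\<close>

lemma rota_baxter:
  assumes u: "borel_prob u" and v: "borel_prob v" and f: "bounded_borel f"
  shows "(\<integral>x. f x \<partial>(clip_law u \<star> clip_law v)) + (\<integral>x. f x \<partial>clip_law (u \<star> v)) =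
    (\<integral>x. f x \<partial>clip_law (u \<star> clip_law v)) + (\<integral>x. f x \<partial>clip_law (clip_law u \<star> v))"
proof -
  note [measurable_cong] = borel_probD(4)[OF u] borel_probD(4)[OF v]
  interpret pair_prob_space u v
    unfolding pair_prob_space_def pair_sigma_finite_def
    using assms by (simp add: borel_probD)
  have [measurable]: "f \<in> borel_measurable borel" using f by (simp add: bounded_borel_def)
  note fc = bounded_borel_compose[OF f measurable_clip]
  have i: "integrable (u \<Otimes>\<^sub>M v) (\<lambda>z. f (h z))" if "h \<in> borel_measurable (u \<Otimes>\<^sub>M v)" for h
    by (rule integrable_bounded_borel[OF _ f that]) unfold_locales
  have id: "distr u borel (\<lambda>x. x) = u" "distr v borel (\<lambda>x. x) = v"
    by (auto intro!: distr_id2 simp: borel_probD u v)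
  have 1: "(\<integral>x. f x \<partial>(clip_law u \<star> clip_law v)) = (\<integral>z. f (clip (fst z) + clip (snd z)) \<partial>(u \<Otimes>\<^sub>M v))"
    by (subst integral_convolution_distr[OF u v f]) (auto simp: split_beta')
  have cl: "(\<integral>x. f x \<partial>clip_law \<mu>) = (\<integral>x. f (clip x) \<partial>\<mu>)" if "borel_prob \<mu>" for \<mu>
    by (subst integral_distr) (auto simp: borel_probD that cong: measurable_cong_sets)
  have 2: "(\<integral>x. f x \<partial>clip_law (u \<star> v)) = (\<integral>z. f (clip (fst z + snd z)) \<partial>(u \<Otimes>\<^sub>M v))"
    by (subst cl) (simp_all add: borel_prob_convolution u v integral_convolution_pair fc split_beta')
  have idm: "(\<lambda>x::real \<times> real. x) \<in> borel_measurable borel" by simp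
  have 3: "(\<integral>x. f x \<partial>clip_law (u \<star> clip_law v)) = (\<integral>z. f (clip (fst z + clip (snd z))) \<partial>(u \<Otimes>\<^sub>M v))"
    using cl[OF borel_prob_convolution[OF u clip_law_prob[OF v]]]
      integral_convolution_distr[OF u v fc idm measurable_clip, unfolded id]
    by (simp only: split_beta')
  have 4: "(\<integral>x. f x \<partial>clip_law (clip_law u \<star> v)) = (\<integral>z. f (clip (clip (fst z) + snd z)) \<partial>(u \<Otimes>\<^sub>M v))"
    using cl[OF borel_prob_convolution[OF clip_law_prob[OF u] v]]
      integral_convolution_distr[OF u v fc measurable_clip idm, unfolded id]
    by (simp only: split_beta')
  have "f (clip x + clip y) + f (clip (x + y)) = f (clip (x + clip y)) + f (clip (clip x + y))" for x y
    using arg_cong[OF clip_exchange[of x y], of "\<lambda>A. \<Sum>w\<in>#A. f w"] by simp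
  then show ?thesis unfolding 1 2 3 4
    by (subst (1 2) Bochner_Integration.integral_add[symmetric]) (auto intro!: i)
qed

lemma integral_clip_law:
  assumes "borel_prob \<mu>" "bounded_borel f"
  shows "(\<integral>x. f x \<partial>clip_law \<mu>) = (\<integral>x. f (clip x) \<partial>\<mu>)"
  using assms by (subst integral_distr) (auto simp: borel_probD bounded_borel_def cong: measurable_cong_sets)

section \<open>The joint law of a random walk and its running maximum\<close>

primrec sum_law :: "real measure \<Rightarrow> nat \<Rightarrow> real measure" where
  "sum_law N 0 = return borel 0"
| "sum_law N (Suc n) = (N \<star> sum_law N n)"

definition diag_law :: "real measure \<Rightarrow> (real \<times> real) measure" where
  "diag_law \<nu> = distr \<nu> borel (\<lambda>x. (x, x))"

text \<open>The joint law of the position and the running maximum after \<open>n\<close> steps. Prepending a step \<open>x\<close> to a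
  path shifts both coordinates by \<open>x\<close>, after which the maximum is clipped because it includes the
  starting point 0.\<close>

primrec walk_law :: "real measure \<Rightarrow> nat \<Rightarrow> (real \<times> real) measure" where
  "walk_law N 0 = return borel 0"
| "walk_law N (Suc n) = clip_law (diag_law N \<star> walk_law N n)"

lemma sum_law_prob: "borel_prob N \<Longrightarrow> borel_prob (sum_law N n)"
  by (induction n) (simp_all add: borel_prob_return borel_prob_convolution)

lemma measurable_diag: "(\<lambda>x::real. (x, x)) \<in> borel_measurable borel"
  unfolding borel_prod[symmetric] by simp

lemma diag_law_prob: "borel_prob \<nu> \<Longrightarrow> borel_prob (diag_law \<nu>)"
  unfolding diag_law_def
  by (rule borel_prob_distr) (use measurable_diag in \<open>auto simp: borel_probD cong: measurable_cong_sets\<close>)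

lemma walk_law_prob: "borel_prob N \<Longrightarrow> borel_prob (walk_law N n)"
  by (induction n) (simp_all add: borel_prob_return borel_prob_convolution clip_law_prob diag_law_prob)

lemma integral_diag_law:
  assumes "borel_prob \<nu>" "bounded_borel f"
  shows "(\<integral>x. f x \<partial>diag_law \<nu>) = (\<integral>x. f (x, x) \<partial>\<nu>)"
  unfolding diag_law_def
  using assms measurable_diag
  by (subst integral_distr) (auto simp: borel_probD bounded_borel_def cong: measurable_cong_sets)

text \<open>The diagonal embedding of the line into the plane is additive.\<close>

lemma diag_law_convolution:
  assumes \<mu>: "borel_prob \<mu>" and \<nu>: "borel_prob \<nu>"
  shows "diag_law (\<mu> \<star> \<nu>) = (diag_law \<mu> \<star> diag_law \<nu>)"
proof (rule borel_prob_eqI)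
  fix f :: "real \<times> real \<Rightarrow> complex" assume f: "bounded_borel f"
  show "(\<integral>x. f x \<partial>diag_law (\<mu> \<star> \<nu>)) = (\<integral>x. f x \<partial>(diag_law \<mu> \<star> diag_law \<nu>))"
    using integral_convolution_distr[OF \<mu> \<nu> f measurable_diag measurable_diag]
      integral_convolution_pair[OF \<mu> \<nu> bounded_borel_compose[OF f measurable_diag]]
    by (simp add: integral_diag_law borel_prob_convolution \<mu> \<nu> f) (simp add: diag_law_def)
qed (simp_all add: assms borel_prob_convolution diag_law_prob)

lemma convolution_zero:
  fixes \<mu> :: "'a::ordered_euclidean_space measure"
  assumes "borel_prob \<mu>"
  shows "(\<mu> \<star> return borel 0) = \<mu>"
proof (rule borel_prob_eqI)
  fix f :: "'a \<Rightarrow> complex" assume f: "bounded_borel f"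
  then have [measurable]: "f \<in> borel_measurable borel" by (simp add: bounded_borel_def)
  show "(\<integral>x. f x \<partial>(\<mu> \<star> return borel 0)) = (\<integral>x. f x \<partial>\<mu>)"
    by (simp add: integral_convolution assms borel_prob_return f integral_return)
qed (simp_all add: assms borel_prob_return borel_prob_convolution)

lemma convolution_commute:
  "borel_prob \<mu> \<Longrightarrow> borel_prob \<nu> \<Longrightarrow> (\<mu> \<star> \<nu>) = (\<nu> \<star> \<mu>)"
  by (rule convolution_commutative) (simp_all add: borel_probD)

lemma convolution_assoc:
  "borel_prob \<mu> \<Longrightarrow> borel_prob \<nu> \<Longrightarrow> borel_prob \<rho> \<Longrightarrow> (\<mu> \<star> (\<nu> \<star> \<rho>)) = ((\<mu> \<star> \<nu>) \<star> \<rho>)"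
  by (rule convolution_associative) (simp_all add: borel_probD)

text \<open>Write \<open>\<mu>\<close> for the law of \<open>(X, X)\<close>, \<open>R\<^sub>n\<close> for the walk law, \<open>C\<^sub>l = \<mu>\<^sup>l\<close> and \<open>P\<close> for clipping. For
  \<open>l \<le> n\<close> the Rota-Baxter relation applied to \<open>P(C\<^sub>l) * R\<^sub>n\<^sub>+\<^sub>1\<^sub>-\<^sub>l = P(C\<^sub>l) * P(\<mu> * R\<^sub>n\<^sub>-\<^sub>l)\<close> yields
  \<open>P(C\<^sub>l * R\<^sub>n\<^sub>+\<^sub>1\<^sub>-\<^sub>l) - P(C\<^sub>l\<^sub>+\<^sub>1 * R\<^sub>n\<^sub>-\<^sub>l) + P(\<mu> * (P(C\<^sub>l) * R\<^sub>n\<^sub>-\<^sub>l))\<close>. Together with the summand for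
  \<open>l = n + 1\<close>, the first two terms telescope in \<open>l\<close> to one copy of \<open>R\<^sub>n\<^sub>+\<^sub>1\<close>, and by induction the third terms sum to \<open>P(\<mu> * n R\<^sub>n) = n R\<^sub>n\<^sub>+\<^sub>1\<close>.\<close>

theorem walk_law_recursion:
  assumes N: "borel_prob N" and "bounded_borel f"
  shows "of_nat n * (\<integral>x. f x \<partial>walk_law N n) =
    (\<Sum>l=1..n. \<integral>x. f x \<partial>(clip_law (diag_law (sum_law N l)) \<star> walk_law N (n - l)))"
  using assms(2)
proof (induction n arbitrary: f)
  case 0
  then show ?case by simp
next
  case (Suc n)
  note f = Suc.prems
  let ?\<mu> = "diag_law N" and ?R = "walk_law N"
  define C where "C l = diag_law (sum_law N l)" for l
  note bp [simp] = borel_prob_convolution clip_law_prob walk_law_prob[OF N] diag_law_prob[OF N]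
  have [simp]: "borel_prob (C l)" for l by (simp add: C_def diag_law_prob sum_law_prob N)
  have C_Suc: "C (Suc l) = (C l \<star> ?\<mu>)" for l
    by (simp add: C_def diag_law_convolution sum_law_prob N convolution_commute diag_law_prob)
  have C1: "C 1 = ?\<mu>"
    by (simp add: C_def convolution_zero N)
  note fc = bounded_borel_compose[OF f measurable_clip]
  \<comment> \<open>The telescoping term and the term handled by the induction hypothesis.\<close>
  define a where "a l = (\<integral>x. f x \<partial>clip_law (C l \<star> ?R (Suc n - l)))" for l
  define d where "d l = (\<integral>x. f x \<partial>clip_law (clip_law (C l) \<star> (?\<mu> \<star> ?R (n - l))))" for l
  have step: "(\<integral>x. f x \<partial>(clip_law (C l) \<star> ?R (Suc n - l))) = a l - a (Suc l) + d l"
    if "l \<in> {1..n}" for l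
  proof -
    have R: "?R (Suc n - l) = clip_law (?\<mu> \<star> ?R (n - l))"
      using that by (simp add: Suc_diff_le)
    have "(C l \<star> (?\<mu> \<star> ?R (n - l))) = (C (Suc l) \<star> ?R (n - l))"
      by (simp add: convolution_assoc C_Suc)
    then show ?thesis
      using rota_baxter[of "C l" "?\<mu> \<star> ?R (n - l)" f] that f
      by (simp add: a_def d_def R algebra_simps)
  qed
  have telescope: "(\<Sum>l=1..n. a l - a (Suc l)) = a 1 - a (Suc n)"
    by (induction n) auto
  have a1: "a 1 = (\<integral>x. f x \<partial>?R (Suc n))"
    unfolding a_def C1 by simp
  have last: "(\<integral>x. f x \<partial>(clip_law (C (Suc n)) \<star> ?R 0)) = a (Suc n)"
    unfolding a_def by (simp add: convolution_zero)
  have d: "d l = (\<integral>x. \<integral>y. f (clip (x + y)) \<partial>(clip_law (C l) \<star> ?R (n - l)) \<partial>?\<mu>)" for l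
  proof -
    have "(clip_law (C l) \<star> (?\<mu> \<star> ?R (n - l))) = ((clip_law (C l) \<star> ?\<mu>) \<star> ?R (n - l))"
      by (simp add: convolution_assoc)
    also have "(clip_law (C l) \<star> ?\<mu>) = (?\<mu> \<star> clip_law (C l))"
      by (simp add: convolution_commute)
    finally have eq: "(clip_law (C l) \<star> (?\<mu> \<star> ?R (n - l))) = (?\<mu> \<star> (clip_law (C l) \<star> ?R (n - l)))"
      by (simp add: convolution_assoc)
    show ?thesis
      unfolding d_def eq by (simp add: integral_clip_law f integral_convolution fc)
  qed
  have shift: "bounded_borel (\<lambda>y. f (clip (x + y)))" for x
    by (rule bounded_borel_compose[OF f]) measurable
  have int: "integrable ?\<mu> (\<lambda>x. \<integral>y. f (clip (x + y)) \<partial>\<nu>)" if "borel_prob \<nu>" for \<nu>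
    using integrable_bounded_borel[OF _ bounded_borel_average[OF fc that], of ?\<mu> "\<lambda>x. x"]
    by (simp add: borel_probD diag_law_prob[OF N] cong: measurable_cong_sets)
  have "(\<Sum>l=1..n. d l) = (\<integral>x. (\<Sum>l=1..n. \<integral>y. f (clip (x + y)) \<partial>(clip_law (C l) \<star> ?R (n - l))) \<partial>?\<mu>)"
    unfolding d by (rule Bochner_Integration.integral_sum[symmetric]) (simp add: int)
  also have "\<dots> = (\<integral>x. of_nat n * (\<integral>y. f (clip (x + y)) \<partial>?R n) \<partial>?\<mu>)"
    by (simp only: Suc.IH[OF shift] C_def)
  also have "\<dots> = of_nat n * (\<integral>x. f x \<partial>?R (Suc n))"
    by (simp add: integral_clip_law f integral_convolution fc)
  finally have sum_d: "(\<Sum>l=1..n. d l) = of_nat n * (\<integral>x. f x \<partial>?R (Suc n))" .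
  have "(\<Sum>l=1..Suc n. \<integral>x. f x \<partial>(clip_law (C l) \<star> ?R (Suc n - l))) =
      (\<Sum>l=1..n. a l - a (Suc l) + d l) + a (Suc n)"
    using last by (simp add: step)
  also have "\<dots> = a 1 + (\<Sum>l=1..n. d l)"
    unfolding sum.distrib telescope by simp
  also have "\<dots> = of_nat (Suc n) * (\<integral>x. f x \<partial>?R (Suc n))"
    unfolding sum_d a1 by (simp add: algebra_simps)
  finally show ?case by (simp add: C_def)
qed

section \<open>Expansion of the joint law over compositions\<close>

definition compositions :: "nat \<Rightarrow> nat \<Rightarrow> (nat \<Rightarrow> nat) set" where
  "compositions j p = {l \<in> {1..j} \<rightarrow>\<^sub>E {1..}. (\<Sum>i=1..j. l i) = p}"

lemma finite_compositions [simp]: "finite (compositions j p)"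
  unfolding compositions_def by (rule finite_Phi_monom_index)

lemma compositions_empty:
  assumes "p < j"
  shows "compositions j p = {}"
proof -
  have "j \<le> p" if "l \<in> compositions j p" for l
  proof -
    have "(\<Sum>i=1..j. 1) \<le> (\<Sum>i=1..j. l i)"
      using that by (intro sum_mono) (auto simp: compositions_def)
    then show ?thesis using that by (simp add: compositions_def)
  qed
  then show ?thesis using assms by force
qed

lemma compositions_0: "compositions 0 p = (if p = 0 then {\<lambda>_. undefined} else {})"
  by (auto simp: compositions_def)

text \<open>The expectation of \<open>f(\<Sum>Y\<^sub>i, \<Sum>(Y\<^sub>i)\<^sub>+)\<close> for independent block sums \<open>Y\<^sub>i\<close> of lengths \<open>l i\<close>.\<close>

definition block_integral ::
    "real measure \<Rightarrow> nat \<Rightarrow> (nat \<Rightarrow> nat) \<Rightarrow> (real \<times> real \<Rightarrow> complex) \<Rightarrow> complex" where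
  "block_integral N j l f =
     (\<integral>y. f (\<Sum>i=1..j. clip (y i, y i)) \<partial>(\<Pi>\<^sub>M i\<in>{1..j}. sum_law N (l i)))"

definition block_term ::
    "real measure \<Rightarrow> nat \<Rightarrow> (nat \<Rightarrow> nat) \<Rightarrow> (real \<times> real \<Rightarrow> complex) \<Rightarrow> complex" where
  "block_term N j l f = (\<Prod>i=1..j. 1 / of_nat (l i)) * block_integral N j l f"

lemma measurable_clip_sum:
  assumes "\<And>i. i \<in> I \<Longrightarrow> sets (L i) = sets borel"
  shows "(\<lambda>y. \<Sum>i\<in>I. clip (y i, y i)) \<in> borel_measurable (\<Pi>\<^sub>M i\<in>I. L i)"
proof (rule borel_measurable_sum)
  fix i assume i: "i \<in> I"
  then have "(\<lambda>y. y i) \<in> measurable (\<Pi>\<^sub>M i\<in>I. L i) borel"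
    using measurable_component_singleton[OF i, of L] assms by (simp cong: measurable_cong_sets)
  then show "(\<lambda>y. clip (y i, y i)) \<in> borel_measurable (\<Pi>\<^sub>M i\<in>I. L i)"
    by (intro measurable_compose[OF _ measurable_clip] measurable_compose[OF _ measurable_diag])
qed

text \<open>Permuting the coordinates of a product measure does not change the law of a symmetric function.\<close>

lemma block_integral_permute:
  assumes N: "borel_prob N" and f: "bounded_borel f" and \<pi>: "bij_betw \<pi> {1..j} {1..j}"
  shows "block_integral N j (\<lambda>i\<in>{1..j}. l (\<pi> i)) f = block_integral N j l f"
proof -
  let ?L = "\<lambda>i. sum_law N (l i)" and ?I = "{1..j}"
  have sets: "sets (sum_law N n) = sets borel" for n
    using sum_law_prob[OF N] by (rule borel_probD)
  have \<pi>': "inj_on \<pi> ?I" "\<pi> \<in> ?I \<rightarrow> ?I"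
    using \<pi> by (auto simp: bij_betw_def)
  have "block_integral N j (\<lambda>i\<in>?I. l (\<pi> i)) f =
      (\<integral>y. f (\<Sum>i\<in>?I. clip (y i, y i)) \<partial>(\<Pi>\<^sub>M i\<in>?I. ?L (\<pi> i)))"
    unfolding block_integral_def by (intro arg_cong2[where f="integral\<^sup>L"] PiM_cong) auto
  also have "(\<Pi>\<^sub>M i\<in>?I. ?L (\<pi> i)) =
      distr (\<Pi>\<^sub>M i\<in>?I. ?L i) (\<Pi>\<^sub>M i\<in>?I. ?L (\<pi> i)) (\<lambda>\<omega>. \<lambda>n\<in>?I. \<omega> (\<pi> n))"
    by (rule distr_PiM_reindex[symmetric]) (use \<pi>' sum_law_prob[OF N] borel_probD in auto)
  also have "(\<integral>y. f (\<Sum>i\<in>?I. clip (y i, y i)) \<partial>\<dots>) =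
      (\<integral>y. f (\<Sum>i\<in>?I. clip ((\<lambda>n\<in>?I. y (\<pi> n)) i, (\<lambda>n\<in>?I. y (\<pi> n)) i)) \<partial>(\<Pi>\<^sub>M i\<in>?I. ?L i))"
  proof (rule integral_distr)
    show "(\<lambda>\<omega>. \<lambda>n\<in>?I. \<omega> (\<pi> n)) \<in> measurable (\<Pi>\<^sub>M i\<in>?I. ?L i) (\<Pi>\<^sub>M i\<in>?I. ?L (\<pi> i))"
      by (rule measurable_restrict) (use \<pi>' in \<open>auto intro!: measurable_component_singleton\<close>)
    show "(\<lambda>y. f (\<Sum>i\<in>?I. clip (y i, y i))) \<in> borel_measurable (\<Pi>\<^sub>M i\<in>?I. ?L (\<pi> i))"
      by (rule measurable_compose[OF measurable_clip_sum])
        (use f sets in \<open>auto simp: bounded_borel_def\<close>)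
  qed
  also have "\<dots> = block_integral N j l f"
  proof -
    have "(\<Sum>i\<in>?I. clip ((\<lambda>n\<in>?I. y (\<pi> n)) i, (\<lambda>n\<in>?I. y (\<pi> n)) i)) = (\<Sum>i\<in>?I. clip (y i, y i))"
      for y :: "nat \<Rightarrow> real"
      using sum.reindex_bij_betw[OF \<pi>, of "\<lambda>i. clip (y i, y i)"] by simp
    then show ?thesis unfolding block_integral_def by simp
  qed
  finally show ?thesis .
qed

lemma block_term_permute:
  assumes "borel_prob N" "bounded_borel f" "bij_betw \<pi> {1..j} {1..j}"
  shows "block_term N j (\<lambda>i\<in>{1..j}. l (\<pi> i)) f = block_term N j l f"
  using block_integral_permute[OF assms, of l]
    prod.reindex_bij_betw[OF assms(3), of "\<lambda>i. 1 / (of_nat (l i) :: complex)"]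
  by (simp add: block_term_def)

lemma compositions_permute:
  assumes "l \<in> compositions j p" "bij_betw \<pi> {1..j} {1..j}"
  shows "(\<lambda>i\<in>{1..j}. l (\<pi> i)) \<in> compositions j p"
  using assms sum.reindex_bij_betw[OF assms(2), of l] bij_betwE[OF assms(2)]
  by (force simp: compositions_def)

text \<open>Replace the factor \<open>p\<close> by \<open>l\<^sub>1 + \<dots> + l\<^sub>j\<close>. By symmetry every summand contributes as much as the last
  one, and the factor \<open>l\<^sub>j\<close> will cancel the weight \<open>1/l\<^sub>j\<close> of the last block.\<close>

lemma sum_block_term_mult_total:
  assumes N: "borel_prob N" and f: "bounded_borel f" and j: "j \<ge> 1"
  shows "of_nat p * (\<Sum>l\<in>compositions j p. block_term N j l f) =
    of_nat j * (\<Sum>l\<in>compositions j p. of_nat (l j) * block_term N j l f)"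
proof -
  have sym: "(\<Sum>l\<in>compositions j p. of_nat (l i) * block_term N j l f) =
      (\<Sum>l\<in>compositions j p. of_nat (l j) * block_term N j l f)" if i: "i \<in> {1..j}" for i
  proof -
    let ?\<pi> = "Transposition.transpose i j"
    have \<pi>: "bij_betw ?\<pi> {1..j} {1..j}"
      using i j by (intro permutes_imp_bij permutes_swap_id) auto
    define T where "T l = (\<lambda>n\<in>{1..j}. l (?\<pi> n))" for l :: "nat \<Rightarrow> nat"
    have T: "T l \<in> compositions j p" "block_term N j (T l) f = block_term N j l f" if "l \<in> compositions j p" for l
      using compositions_permute[where l=l and \<pi>="?\<pi>", OF that \<pi>]
        block_term_permute[where l=l and \<pi>="?\<pi>", OF N f \<pi>]
      unfolding T_def by blast+
    have Tj: "T l j = l i" for l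
      using j by (simp add: T_def)
    have TT: "T (T l) = l" if "l \<in> compositions j p" for l
    proof
      fix n show "T (T l) n = l n"
      proof (cases "n \<in> {1..j}")
        case True
        then have "?\<pi> n \<in> {1..j}" using bij_betwE[OF \<pi>] by blast
        with True show ?thesis by (simp add: T_def)
      next
        case False
        have "l \<in> {1..j} \<rightarrow>\<^sub>E {1..}" using that by (simp add: compositions_def)
        then have "l n = undefined" using False by (rule PiE_arb)
        with False show ?thesis by (auto simp: T_def)
      qed
    qed
    have "(\<Sum>l\<in>compositions j p. of_nat (T l j) * block_term N j (T l) f) =
        (\<Sum>l\<in>compositions j p. of_nat (l j) * block_term N j l f)"
      by (rule sum.reindex_bij_betw[of T "compositions j p" "compositions j p" "\<lambda>l. of_nat (l j) * block_term N j l f"])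
        (rule bij_betw_byWitness[where f'=T], use T TT in auto)
    then show ?thesis using T by (simp add: Tj cong: sum.cong)
  qed
  have "of_nat p * (\<Sum>l\<in>compositions j p. block_term N j l f) =
      (\<Sum>l\<in>compositions j p. \<Sum>i=1..j. of_nat (l i) * block_term N j l f)"
    unfolding sum_distrib_left
  proof (rule sum.cong[OF refl])
    fix l assume "l \<in> compositions j p"
    then have "p = (\<Sum>i=1..j. l i)" by (simp add: compositions_def)
    then show "of_nat p * block_term N j l f = (\<Sum>i=1..j. of_nat (l i) * block_term N j l f)"
      by (simp add: sum_distrib_right)
  qed
  also have "\<dots> = (\<Sum>i=1..j. \<Sum>l\<in>compositions j p. of_nat (l i) * block_term N j l f)"
    by (rule sum.swap)
  also have "\<dots> = (\<Sum>i=1..j. \<Sum>l\<in>compositions j p. of_nat (l j) * block_term N j l f)"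
    by (rule sum.cong[OF refl sym])
  also have "\<dots> = of_nat j * (\<Sum>l\<in>compositions j p. of_nat (l j) * block_term N j l f)"
    by simp
  finally show ?thesis .
qed

definition block_average ::
    "real measure \<Rightarrow> nat \<Rightarrow> (real \<times> real \<Rightarrow> complex) \<Rightarrow> real \<times> real \<Rightarrow> complex" where
  "block_average N m f = (\<lambda>u. \<integral>v. f (u + v) \<partial>clip_law (diag_law (sum_law N m)))"

lemma block_average_bounded_borel:
  "borel_prob N \<Longrightarrow> bounded_borel f \<Longrightarrow> bounded_borel (block_average N m f)"
  unfolding block_average_def
  by (intro bounded_borel_average clip_law_prob diag_law_prob sum_law_prob)

text \<open>Integrating over the last block first turns the test function into its average over that block.\<close>

lemma block_integral_Suc:
  assumes N: "borel_prob N" and f: "bounded_borel f"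
  shows "block_integral N (Suc j) (l(Suc j := m)) f = block_integral N j l (block_average N m f)"
proof -
  let ?l = "l(Suc j := m)"
  let ?L = "\<lambda>i. sum_law N (?l i)"
  note bp = sum_law_prob[OF N]
  have sets: "sets (sum_law N n) = sets borel" for n using bp by (rule borel_probD)
  interpret product_prob_space ?L
    unfolding product_prob_space_def product_prob_space_axioms_def product_sigma_finite_def
    using borel_probD[OF bp] by auto
  have I: "{1..Suc j} = insert (Suc j) {1..j}" by auto
  have int: "integrable (PiM (insert (Suc j) {1..j}) ?L) (\<lambda>y. f (\<Sum>i=1..Suc j. clip (y i, y i)))"
    unfolding I[symmetric]
    by (intro integrable_bounded_borel[OF _ f] prob_space_PiM measurable_clip_sum)
      (use sets borel_probD[OF bp] in auto)
  have "block_integral N (Suc j) ?l f = (\<integral>y. f (\<Sum>i=1..Suc j. clip (y i, y i)) \<partial>PiM (insert (Suc j) {1..j}) ?L)"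
    unfolding block_integral_def I[symmetric] ..
  also have "\<dots> = (\<integral>y. (\<integral>x. f (\<Sum>i=1..Suc j. clip ((y(Suc j := x)) i, (y(Suc j := x)) i)) \<partial>?L (Suc j)) \<partial>PiM {1..j} ?L)"
    by (rule product_integral_insert[OF _ _ int]) auto
  also have "\<dots> = (\<integral>y. block_average N m f (\<Sum>i=1..j. clip (y i, y i)) \<partial>PiM {1..j} ?L)"
  proof (rule Bochner_Integration.integral_cong[OF refl])
    fix y :: "nat \<Rightarrow> real"
    let ?u = "\<Sum>i=1..j. clip (y i, y i)"
    have s: "bounded_borel (\<lambda>v. f (u + v))" for u
      by (rule bounded_borel_compose[OF f]) measurable
    have avg: "(\<integral>x. f (u + clip (x, x)) \<partial>sum_law N m) = block_average N m f u" for u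
      using bounded_borel_compose[OF s measurable_clip]
      by (simp add: block_average_def integral_clip_law integral_diag_law diag_law_prob bp s)
    have "(\<Sum>i=1..Suc j. clip ((y(Suc j := x)) i, (y(Suc j := x)) i)) = ?u + clip (x, x)" for x
      by simp
    then show "(\<integral>x. f (\<Sum>i=1..Suc j. clip ((y(Suc j := x)) i, (y(Suc j := x)) i)) \<partial>?L (Suc j)) =
        block_average N m f ?u"
      by (simp add: avg)
  qed
  also have "PiM {1..j} ?L = PiM {1..j} (\<lambda>i. sum_law N (l i))"
    by (rule PiM_cong) auto
  finally show ?thesis by (simp add: block_integral_def)
qed

lemma block_term_Suc:
  assumes "borel_prob N" "bounded_borel f" "m \<ge> 1"
  shows "of_nat m * block_term N (Suc j) (l(Suc j := m)) f = block_term N j l (block_average N m f)"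
proof -
  have "(\<Prod>i=1..j. 1 / of_nat ((l(Suc j := m)) i)) = (\<Prod>i=1..j. 1 / (of_nat (l i) :: complex))"
    by (rule prod.cong) auto
  then show ?thesis
    using assms by (simp add: block_term_def block_integral_Suc)
qed

lemma compositions_iff:
  "l \<in> compositions j p \<longleftrightarrow>
    (\<forall>i\<in>{1..j}. 1 \<le> l i) \<and> (\<forall>i. i \<notin> {1..j} \<longrightarrow> l i = undefined) \<and> (\<Sum>i=1..j. l i) = p"
  unfolding compositions_def PiE_iff extensional_def by blast

lemma compositions_Suc_iff:
  "l \<in> compositions (Suc j) p \<longleftrightarrow> l (Suc j) \<in> {1..p} \<and> l(Suc j := undefined) \<in> compositions j (p - l (Suc j))"
proof -
  have s: "(\<Sum>i=1..j. (l(Suc j := undefined)) i) = (\<Sum>i=1..j. l i)"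
    by (rule sum.cong) auto
  have I: "{1..Suc j} = insert (Suc j) {1..j}" by auto
  have "(\<forall>i\<in>{1..Suc j}. 1 \<le> l i) \<longleftrightarrow> 1 \<le> l (Suc j) \<and> (\<forall>i\<in>{1..j}. 1 \<le> (l(Suc j := undefined)) i)"
    unfolding I by simp
  moreover have "(\<forall>i. i \<notin> {1..Suc j} \<longrightarrow> l i = undefined) \<longleftrightarrow>
      (\<forall>i. i \<notin> {1..j} \<longrightarrow> (l(Suc j := undefined)) i = undefined)"
    unfolding I by (metis fun_upd_apply insert_iff atLeastAtMost_iff not_less_eq_eq order_refl)
  moreover have "(\<Sum>i=1..Suc j. l i) = (\<Sum>i=1..j. l i) + l (Suc j)"
    by simp
  ultimately show ?thesis
    unfolding compositions_iff s by (simp only:) auto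
qed

text \<open>A composition of \<open>p\<close> into \<open>j + 1\<close> parts is its last part \<open>m\<close> and a composition of \<open>p - m\<close> into \<open>j\<close>
  parts.\<close>

lemma sum_compositions_Suc:
  fixes F :: "(nat \<Rightarrow> nat) \<Rightarrow> complex"
  shows "(\<Sum>l\<in>compositions (Suc j) p. F l) = (\<Sum>m=1..p. \<Sum>l\<in>compositions j (p - m). F (l(Suc j := m)))"
proof -
  define E where "E = (\<lambda>(m, l::nat \<Rightarrow> nat). l(Suc j := m))"
  define D where "D = (\<lambda>l::nat \<Rightarrow> nat. (l (Suc j), l(Suc j := undefined)))"
  have undef: "l(Suc j := undefined) = l" if "l \<in> compositions j q" for l q
    using that by (intro fun_upd_idem) (simp add: compositions_iff)
  have "bij_betw E (Sigma {1..p} (\<lambda>m. compositions j (p - m))) (compositions (Suc j) p)"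
  proof (rule bij_betw_byWitness[where f'=D])
    show "\<forall>a\<in>Sigma {1..p} (\<lambda>m. compositions j (p - m)). D (E a) = a"
      by (auto simp: D_def E_def undef)
    show "\<forall>l\<in>compositions (Suc j) p. E (D l) = l"
      by (simp add: D_def E_def)
    show "E ` Sigma {1..p} (\<lambda>m. compositions j (p - m)) \<subseteq> compositions (Suc j) p"
      by (auto simp: E_def compositions_Suc_iff undef)
    show "D ` compositions (Suc j) p \<subseteq> Sigma {1..p} (\<lambda>m. compositions j (p - m))"
    proof (rule image_subsetI)
      fix l assume "l \<in> compositions (Suc j) p"
      then show "D l \<in> Sigma {1..p} (\<lambda>m. compositions j (p - m))"
        unfolding compositions_Suc_iff by (simp add: D_def)
    qed
  qed
  then have "(\<Sum>l\<in>compositions (Suc j) p. F l) = (\<Sum>x\<in>Sigma {1..p} (\<lambda>m. compositions j (p - m)). F (E x))"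
    by (rule sum.reindex_bij_betw[symmetric])
  also have "\<dots> = (\<Sum>m=1..p. \<Sum>l\<in>compositions j (p - m). F (l(Suc j := m)))"
    unfolding E_def by (subst sum.Sigma) (auto simp: split_beta)
  finally show ?thesis .
qed

definition expansion :: "real measure \<Rightarrow> nat \<Rightarrow> (real \<times> real \<Rightarrow> complex) \<Rightarrow> complex" where
  "expansion N p f = (\<Sum>j\<le>p. 1 / fact j * (\<Sum>l\<in>compositions j p. block_term N j l f))"

text \<open>The recursion of \<open>walk_law_recursion\<close>. Multiplying by \<open>p\<close> singles out the last of the \<open>j + 1\<close>
  blocks, and the factor \<open>j + 1\<close> lowers \<open>(j + 1)!\<close> to \<open>j!\<close>.\<close>

lemma expansion_recursion:
  assumes N: "borel_prob N" and f: "bounded_borel f" and p: "p \<ge> 1"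
  shows "of_nat p * expansion N p f = (\<Sum>m=1..p. expansion N (p - m) (block_average N m f))"
proof -
  let ?B = "\<lambda>j m. \<Sum>l\<in>compositions j (p - m). block_term N j l (block_average N m f)"
  have Suc: "of_nat p * (1 / fact (Suc j) * (\<Sum>l\<in>compositions (Suc j) p. block_term N (Suc j) l f)) =
      (\<Sum>m=1..p. 1 / fact j * ?B j m)" for j
  proof -
    have "of_nat p * (\<Sum>l\<in>compositions (Suc j) p. block_term N (Suc j) l f) =
        of_nat (Suc j) * (\<Sum>l\<in>compositions (Suc j) p. of_nat (l (Suc j)) * block_term N (Suc j) l f)"
      by (rule sum_block_term_mult_total[OF N f]) simp
    also have "(\<Sum>l\<in>compositions (Suc j) p. of_nat (l (Suc j)) * block_term N (Suc j) l f) = (\<Sum>m=1..p. ?B j m)"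
      unfolding sum_compositions_Suc by (intro sum.cong) (auto simp: block_term_Suc[OF N f])
    finally have "of_nat p * (\<Sum>l\<in>compositions (Suc j) p. block_term N (Suc j) l f) =
        of_nat (Suc j) * (\<Sum>m=1..p. ?B j m)" .
    then have "of_nat p * (1 / fact (Suc j) * (\<Sum>l\<in>compositions (Suc j) p. block_term N (Suc j) l f)) =
        1 / fact (Suc j) * (of_nat (Suc j) * (\<Sum>m=1..p. ?B j m))"
      by (metis mult.left_commute)
    also have "\<dots> = 1 / fact j * (\<Sum>m=1..p. ?B j m)"
      by (simp add: divide_simps del: of_nat_Suc)
    finally show ?thesis by (simp add: sum_distrib_left)
  qed
  have "of_nat p * expansion N p f =
      (\<Sum>j<p. of_nat p * (1 / fact (Suc j) * (\<Sum>l\<in>compositions (Suc j) p. block_term N (Suc j) l f)))"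
    using p sum.lessThan_Suc_shift[of "\<lambda>j. 1 / fact j * (\<Sum>l\<in>compositions j p. block_term N j l f)" p]
    by (simp add: expansion_def compositions_0 sum_distrib_left lessThan_Suc_atMost[symmetric] del: sum.lessThan_Suc)
  also have "\<dots> = (\<Sum>j<p. \<Sum>m=1..p. 1 / fact j * ?B j m)"
    by (simp only: Suc)
  also have "\<dots> = (\<Sum>m=1..p. \<Sum>j<p. 1 / fact j * ?B j m)"
    by (rule sum.swap)
  also have "\<dots> = (\<Sum>m=1..p. \<Sum>j\<le>p-m. 1 / fact j * ?B j m)"
    by (intro sum.cong refl sum.mono_neutral_right) (auto simp: compositions_empty)
  finally show ?thesis by (simp add: expansion_def)
qed

text \<open>Spitzer's identity for the joint law: both sides agree for \<open>p = 0\<close> and satisfy the same recursion,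
  in which the test function is averaged over one block. This is why the statement has to be
  proved for all test functions at once.\<close>

theorem walk_law_expansion:
  assumes N: "borel_prob N" and f: "bounded_borel f"
  shows "(\<integral>x. f x \<partial>walk_law N p) =
    (\<Sum>j\<le>p. 1 / fact j * (\<Sum>l\<in>compositions j p. block_term N j l f))"
proof -
  have "(\<integral>x. f x \<partial>walk_law N p) = expansion N p f"
    using f
  proof (induction p arbitrary: f rule: less_induct)
    case (less p)
    show ?case
    proof (cases "p = 0")
      case True
      have "f \<in> borel_measurable borel" using less.prems by (simp add: bounded_borel_def)
      then show ?thesis using True
        by (simp add: expansion_def compositions_0 block_term_def block_integral_def integral_return
            PiM_empty lebesgue_integral_count_space_finite)
    next
      case False
      have conv: "(\<integral>x. f x \<partial>(clip_law (diag_law (sum_law N m)) \<star> walk_law N (p - m))) =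
          expansion N (p - m) (block_average N m f)" if "m \<in> {1..p}" for m
      proof -
        have bp: "borel_prob (clip_law (diag_law (sum_law N m)))"
          by (intro clip_law_prob diag_law_prob sum_law_prob N)
        show ?thesis
          unfolding convolution_commute[OF bp walk_law_prob[OF N]]
          using less.IH[of "p - m", OF _ block_average_bounded_borel[OF N less.prems]] that
          by (simp add: integral_convolution walk_law_prob N bp less.prems block_average_def)
      qed
      have "of_nat p * (\<integral>x. f x \<partial>walk_law N p) = of_nat p * expansion N p f"
        using False
        by (simp only: walk_law_recursion[OF N less.prems]) (simp add: conv expansion_recursion N less.prems)
      then show ?thesis using False by simp
    qed
  qed
  then show ?thesis by (simp add: expansion_def)
qed

section \<open>Decay of the Fourier transform of a Schwartz function\<close>

lemma schwartz_has_derivative: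
  assumes "schwartz f"
  shows "((deriv ^^ n) f has_field_derivative (deriv ^^ Suc n) f x) (at x)"
  using assms by (simp add: schwartz_def DERIV_deriv_iff_field_differentiable)

lemma schwartz_isCont:
  assumes "schwartz f"
  shows "isCont ((deriv ^^ n) f) x"
  using schwartz_has_derivative[OF assms] by (rule DERIV_isCont)

lemma schwartz_measurable [measurable]:
  assumes "schwartz f"
  shows "(deriv ^^ n) f \<in> borel_measurable borel"
  by (rule borel_measurable_continuous_onI)
    (auto intro!: continuous_at_imp_continuous_on schwartz_isCont assms)

text \<open>The quadratic rate gives both integrability and vanishing at infinity.\<close>

lemma schwartz_decay:
  assumes "schwartz f"
  obtains C where "\<And>x. norm ((deriv ^^ n) f x) \<le> C * inverse (1 + x\<^sup>2)"
proof -
  have "bounded (range (\<lambda>x. x ^ m * (deriv ^^ n) f x))" for m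
    using assms by (simp add: schwartz_def)
  from this[of 0] this[of 2] obtain A B where
    A: "\<And>x. norm ((deriv ^^ n) f x) \<le> A" and B: "\<And>x. norm (x\<^sup>2 * (deriv ^^ n) f x) \<le> B"
    by (auto simp: bounded_iff)
  have "norm ((deriv ^^ n) f x) \<le> (A + B) * inverse (1 + x\<^sup>2)" for x
  proof -
    have "norm ((deriv ^^ n) f x) * (1 + x\<^sup>2) \<le> A + B"
      using A[of x] B[of x] by (simp add: abs_mult algebra_simps)
    moreover have "0 < 1 + x\<^sup>2" by (simp add: add_pos_nonneg)
    ultimately show ?thesis by (simp add: field_simps)
  qed
  then show thesis by (rule that)
qed

lemma integrable_inverse_1_plus_square_lborel:
  "integrable lborel (\<lambda>x::real. inverse (1 + x\<^sup>2))"
  using integrable_inverse_1_plus_square by (simp add: set_integrable_def einterval_eq_UNIV)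

lemma integrable_of_quadratic_decay:
  fixes f :: "real \<Rightarrow> complex"
  assumes "f \<in> borel_measurable borel" "\<And>x. norm (f x) \<le> C * inverse (1 + x\<^sup>2)"
  shows "integrable lborel f"
proof (rule Bochner_Integration.integrable_bound)
  show "integrable lborel (\<lambda>x. C * inverse (1 + x\<^sup>2))"
    by (intro integrable_mult_right integrable_inverse_1_plus_square_lborel)
  have "norm (f x) \<le> norm (C * inverse (1 + x\<^sup>2))" for x
    using assms(2)[of x] by (metis abs_ge_self order_trans real_norm_def)
  then show "AE x in lborel. norm (f x) \<le> norm (C * inverse (1 + x\<^sup>2))" by simp
qed (use assms in simp)

lemma schwartz_integrable:
  assumes "schwartz f"
  shows "integrable lborel (\<lambda>x. complex_of_real ((deriv ^^ n) f x))"
proof -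
  obtain C where C: "\<And>x. norm ((deriv ^^ n) f x) \<le> C * inverse (1 + x\<^sup>2)"
    using schwartz_decay[OF assms] by blast
  show ?thesis
    by (rule integrable_of_quadratic_decay[where C=C])
      (use C schwartz_measurable[OF assms, of n] in auto)
qed

lemma schwartz_vanishes:
  assumes "schwartz f"
  shows "((deriv ^^ n) f \<longlongrightarrow> 0) at_infinity"
proof -
  obtain C where C: "\<And>x. norm ((deriv ^^ n) f x) \<le> C * inverse (1 + x\<^sup>2)"
    using schwartz_decay[OF assms] by blast
  have "filterlim (\<lambda>x::real. 1 + x\<^sup>2) at_infinity at_infinity"
  proof -
    have "filterlim (\<lambda>x::real. (norm x)\<^sup>2) at_top at_infinity"
      by (intro filterlim_pow_at_top filterlim_norm_at_top) simp
    then have "filterlim (\<lambda>x::real. 1 + x\<^sup>2) at_top at_infinity"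
      by (intro filterlim_tendsto_add_at_top[OF tendsto_const]) simp
    then show ?thesis by (rule filterlim_at_top_imp_at_infinity)
  qed
  then have "((\<lambda>x::real. C * inverse (1 + x\<^sup>2)) \<longlongrightarrow> C * 0) at_infinity"
    by (intro tendsto_intros filterlim_compose[OF tendsto_inverse_0])
  then have *: "((\<lambda>x::real. C * inverse (1 + x\<^sup>2)) \<longlongrightarrow> 0) at_infinity" by simp
  show ?thesis
    by (rule Lim_null_comparison[OF always_eventually *]) (rule allI, rule C)
qed

lemma fourier_norm_le:
  assumes "integrable lborel f"
  shows "norm (fourier f \<eta>) \<le> (\<integral>y. norm (f y) \<partial>lborel)"
proof -
  have "norm (fourier f \<eta>) \<le> (\<integral>y. norm (exp (- \<i> * of_real (\<eta> * y)) * f y) \<partial>lborel)"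
    unfolding fourier_def by (rule integral_norm_bound)
  also have "\<dots> = (\<integral>y. norm (f y) \<partial>lborel)"
    by (simp add: norm_mult norm_exp_i_times[of "- x" for x, simplified])
  finally show ?thesis .
qed

lemma integrable_exp_mult:
  fixes f :: "real \<Rightarrow> complex"
  assumes "integrable lborel f"
  shows "integrable lborel (\<lambda>y. exp (- \<i> * of_real (\<eta> * y)) * f y)"
proof (rule Bochner_Integration.integrable_bound[OF assms])
  have [measurable]: "f \<in> borel_measurable lborel" using assms by (rule borel_measurable_integrable)
  show "(\<lambda>y. exp (- \<i> * of_real (\<eta> * y)) * f y) \<in> borel_measurable lborel" by measurable
qed (simp add: norm_mult norm_exp_i_times[of "- x" for x, simplified])

text \<open>Two integrations by parts, done at once: the function \<open>exp(-i\<eta>y) (f'(y) + i\<eta> f(y))\<close> vanishes at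
  both ends, and its derivative is \<open>exp(-i\<eta>y) (f''(y) + \<eta>\<^sup>2 f(y))\<close>.\<close>

lemma fourier_second_derivative:
  assumes f: "schwartz f"
  shows "of_real (\<eta>\<^sup>2) * fourier (\<lambda>x. complex_of_real (f x)) \<eta> =
    - fourier (\<lambda>x. complex_of_real (deriv (deriv f) x)) \<eta>"
proof -
  let ?e = "\<lambda>y. exp (- \<i> * complex_of_real (\<eta> * y))"
  let ?F = "\<lambda>y. ?e y * (of_real (deriv f y) + \<i> * of_real \<eta> * of_real (f y))"
  let ?f = "\<lambda>y. ?e y * of_real (deriv (deriv f) y) + of_real (\<eta>\<^sup>2) * (?e y * of_real (f y))"
  have d: "(f has_field_derivative deriv f y) (at y)"
      "(deriv f has_field_derivative deriv (deriv f) y) (at y)" for y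
    using schwartz_has_derivative[OF f, where n=0 and x=y] schwartz_has_derivative[OF f, where n=1 and x=y] by simp_all
  have c: "isCont f y" "isCont (deriv f) y" "isCont (deriv (deriv f)) y" for y
    using schwartz_isCont[OF f, where n=0 and x=y] schwartz_isCont[OF f, where n=1 and x=y]
      schwartz_isCont[OF f, where n=2 and x=y]
    by (simp_all add: numeral_2_eq_2)
  have i: "integrable lborel (\<lambda>y. ?e y * of_real (f y))"
      "integrable lborel (\<lambda>y. ?e y * of_real (deriv (deriv f) y))"
    using schwartz_integrable[OF f, of 0] schwartz_integrable[OF f, of 2]
    by (intro integrable_exp_mult; simp add: numeral_2_eq_2)+
  have de: "(?e has_vector_derivative (- \<i> * of_real \<eta> * ?e y)) (at y)" for y
  proof -
    have "((\<lambda>z. exp (- \<i> * (of_real \<eta> * z))) has_field_derivative (- \<i> * of_real \<eta> * ?e y)) (at (of_real y))"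
      by (auto intro!: derivative_eq_intros)
    from has_vector_derivative_real_field[OF this, of UNIV] show ?thesis by simp
  qed
  have dG: "((\<lambda>y. of_real (deriv f y) + \<i> * of_real \<eta> * of_real (f y)) has_vector_derivative
      (of_real (deriv (deriv f) y) + \<i> * of_real \<eta> * of_real (deriv f y))) (at y)" for y
    using d[of y]
    by (intro has_vector_derivative_add has_vector_derivative_mult_right has_vector_derivative_of_real)
      (simp_all add: has_real_derivative_iff_has_vector_derivative)
  have dF: "(?F has_vector_derivative ?f y) (at y)" for y
  proof -
    have eq: "?e y * (of_real (deriv (deriv f) y) + \<i> * of_real \<eta> * of_real (deriv f y)) +
        (- \<i> * of_real \<eta> * ?e y) * (of_real (deriv f y) + \<i> * of_real \<eta> * of_real (f y)) = ?f y"
      by (simp add: algebra_simps power2_eq_square)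
    show ?thesis using has_vector_derivative_mult[OF de dG, of y] unfolding eq .
  qed
  have F0: "(?F \<longlongrightarrow> 0) at_infinity"
  proof (rule tendsto_norm_zero_cancel)
    have pw: "(deriv ^^ 0) f = f" "(deriv ^^ 1) f = deriv f" by simp_all
    note v = schwartz_vanishes[OF f, where n=0, unfolded pw] schwartz_vanishes[OF f, where n=1, unfolded pw]
    have "((\<lambda>y. of_real (deriv f y) + \<i> * of_real \<eta> * of_real (f y)) \<longlongrightarrow>
        of_real 0 + \<i> * of_real \<eta> * of_real 0) at_infinity"
      by (rule tendsto_add[OF tendsto_of_real[OF v(2)] tendsto_mult_left[OF tendsto_of_real[OF v(1)]]])
    from tendsto_norm[OF this]
    have "((\<lambda>y. norm (of_real (deriv f y) + \<i> * of_real \<eta> * of_real (f y))) \<longlongrightarrow> 0) at_infinity"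
      by simp
    then show "((\<lambda>y. norm (?F y)) \<longlongrightarrow> 0) at_infinity"
      by (simp add: norm_mult)
  qed
  have "(LBINT y=-\<infinity>..\<infinity>. ?f y) = 0 - 0"
  proof (rule interval_integral_FTC_integrable[where F="?F"])
    show "set_integrable lborel (einterval (-\<infinity>) \<infinity>) ?f"
      using i by (simp add: set_integrable_def einterval_eq_UNIV)
    show "isCont ?f y" for y by (intro continuous_intros c)
    show "((?F \<circ> real_of_ereal) \<longlongrightarrow> 0) (at_right (- \<infinity>))"
      unfolding ereal_tendsto_simps1 by (rule tendsto_mono[OF _ F0], simp add: at_infinity_eq_at_top_bot)
    show "((?F \<circ> real_of_ereal) \<longlongrightarrow> 0) (at_left \<infinity>)"
      unfolding ereal_tendsto_simps1 by (rule tendsto_mono[OF _ F0], simp add: at_infinity_eq_at_top_bot)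
  qed (rule dF | simp)+
  then show ?thesis using i
    by (simp add: fourier_def interval_lebesgue_integral_def set_lebesgue_integral_def einterval_eq_UNIV
     add_eq_0_iff)
qed

text \<open>The transform is bounded, and so is its product with \<open>\<eta>\<^sup>2\<close>, being the transform of \<open>-f''\<close>.\<close>

theorem fourier_schwartz_integrable:
  assumes f: "schwartz f"
  shows "integrable lborel (fourier (\<lambda>x. complex_of_real (f x)))"
proof -
  let ?h = "fourier (\<lambda>x. complex_of_real (f x))"
  define A where "A = (\<integral>y. norm (complex_of_real (f y)) \<partial>lborel)"
  define B where "B = (\<integral>y. norm (complex_of_real (deriv (deriv f) y)) \<partial>lborel)"
  have [measurable]: "f \<in> borel_measurable borel"
    using schwartz_measurable[OF f, of 0] by simp
  have A: "norm (?h \<eta>) \<le> A" for \<eta>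
    unfolding A_def using schwartz_integrable[OF f, of 0] by (intro fourier_norm_le) simp
  have "norm (of_real (\<eta>\<^sup>2) * ?h \<eta>) \<le> B" for \<eta>
    unfolding B_def fourier_second_derivative[OF f] norm_minus_cancel
    using schwartz_integrable[OF f, of 2] by (intro fourier_norm_le) (simp add: numeral_2_eq_2)
  then have B: "\<eta>\<^sup>2 * norm (?h \<eta>) \<le> B" for \<eta>
    by (simp add: norm_mult norm_power)
  have "norm (?h \<eta>) \<le> (A + B) * inverse (1 + \<eta>\<^sup>2)" for \<eta>
  proof -
    have "norm (?h \<eta>) * (1 + \<eta>\<^sup>2) \<le> A + B"
      using A[of \<eta>] B[of \<eta>] by (simp add: algebra_simps)
    moreover have "0 < 1 + \<eta>\<^sup>2" by (simp add: add_pos_nonneg)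
    ultimately show ?thesis by (simp add: field_simps)
  qed
  moreover have "?h \<in> borel_measurable borel" unfolding fourier_def by measurable
  ultimately show ?thesis by (rule integrable_of_quadratic_decay[rotated])
qed

section \<open>Densities from integrable characteristic functions\<close>

text \<open>The candidate density: the inverse Fourier transform of the characteristic function.\<close>

definition char_density :: "real measure \<Rightarrow> real \<Rightarrow> complex" where
  "char_density M x = (\<integral>t. iexp (- (t * x)) * char M t \<partial>lborel) / of_real (2 * pi)"

lemma char_density_isCont:
  assumes int: "integrable lborel (char M)"
  shows "isCont (char_density M) x"
proof -
  have [measurable]: "char M \<in> borel_measurable borel"
    using borel_measurable_integrable[OF int] by simp
  have "isCont (\<lambda>x. \<integral>t. iexp (- (t * x)) * char M t \<partial>lborel) x"
    unfolding continuous_at_sequentially comp_def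
  proof safe
    fix u :: "nat \<Rightarrow> real" assume u: "u \<longlonglongrightarrow> x"
    show "(\<lambda>n. \<integral>t. iexp (- (t * u n)) * char M t \<partial>lborel) \<longlonglongrightarrow> (\<integral>t. iexp (- (t * x)) * char M t \<partial>lborel)"
    proof (rule integral_dominated_convergence[where w="\<lambda>t. norm (char M t)"])
      show "integrable lborel (\<lambda>t. norm (char M t))" using int by (rule integrable_norm)
      show "AE t in lborel. (\<lambda>n. iexp (- (t * u n)) * char M t) \<longlonglongrightarrow> iexp (- (t * x)) * char M t"
        by (intro AE_I2 tendsto_intros u)
    qed (auto simp: norm_mult norm_exp_i_times[of "- y" for y, simplified])
  qed
  then show ?thesis unfolding char_density_def by (intro continuous_intros) simp_all
qed

lemma continuous_nonneg_of_integrals: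
  fixes h :: "real \<Rightarrow> real"
  assumes cont: "\<And>x. isCont h x"
    and nonneg: "\<And>a b. a \<le> b \<Longrightarrow> 0 \<le> (\<integral>x. indicator {a..b} x * h x \<partial>lborel)"
  shows "0 \<le> h x"
proof (rule ccontr)
  assume "\<not> 0 \<le> h x"
  then have neg: "h x < 0" by simp
  have "continuous (at x) h" using cont by simp
  then obtain d where d: "d > 0" "\<And>y. dist y x < d \<Longrightarrow> dist (h y) (h x) < - h x / 2"
    using neg unfolding continuous_at_eps_delta by (metis divide_pos_pos neg_0_less_iff_less zero_less_numeral)
  define e where "e = d / 2"
  have e: "e > 0" using d by (simp add: e_def)
  have le: "h y \<le> h x / 2" if "y \<in> {x - e..x + e}" for y
  proof -
    have "dist y x < d" using that d(1) by (auto simp: dist_real_def e_def)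
    from d(2)[OF this] show ?thesis by (auto simp: dist_real_def)
  qed
  have "integrable lborel (\<lambda>y. indicator {x - e..x + e} y *\<^sub>R h y)"
    by (rule borel_integrable_compact) (auto intro!: continuous_at_imp_continuous_on cont)
  then have i1: "integrable lborel (\<lambda>y. indicator {x - e..x + e} y * h y)"
    by (simp only: real_scaleR_def)
  have i2: "integrable lborel (\<lambda>y. indicator {x - e..x + e} y * (h x / 2))"
    by (intro integrable_mult_left) (simp add: e less_imp_le)
  have "(\<integral>y. indicator {x - e..x + e} y * h y \<partial>lborel) \<le>
      (\<integral>y. indicator {x - e..x + e} y * (h x / 2) \<partial>lborel)"
    by (rule integral_mono[OF i1 i2]) (use le in \<open>simp add: indicator_def\<close>)
  also have "\<dots> = h x / 2 * (2 * e)"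
    using e by simp
  also have "\<dots> < 0" using neg e by (simp add: mult_neg_pos)
  finally show False using nonneg[of "x - e" "x + e"] e by simp
qed

lemma integral_iexp_interval:
  assumes "a \<le> b" "t \<noteq> 0"
  shows "(\<integral>x. indicator {a..b} x *\<^sub>R iexp (- (t * x)) \<partial>lborel) =
    (iexp (- (t * a)) - iexp (- (t * b))) / (\<i> * t)"
proof -
  let ?F = "\<lambda>x. iexp (- (t * x)) / (- \<i> * t)"
  have "(\<integral>x. indicator {a..b} x *\<^sub>R iexp (- (t * x)) \<partial>lborel) = ?F b - ?F a"
  proof (rule integral_FTC_Icc)
    fix x
    have "((\<lambda>z. exp (\<i> * (- (of_real t * z))) / (- \<i> * t)) has_field_derivative iexp (- (t * x))) (at (of_real x))"
      using assms(2) by (auto intro!: derivative_eq_intros simp: mult.left_commute[of \<i> _ \<i>])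
    from has_vector_derivative_real_field[OF this, of "{a..b}"]
    show "(?F has_vector_derivative iexp (- (t * x))) (at x within {a..b})" by simp
  qed (use assms in \<open>auto intro!: continuous_intros\<close>)
  then show ?thesis using assms(2) by (simp add: field_simps)
qed

context real_distribution begin

text \<open>Since the characteristic function is integrable, the truncated integrals in Levy's inversion
  formula converge to an absolutely convergent one. Its kernel is the integral of \<open>exp(-itx)\<close> over
  \<open>[a, b]\<close>, and Fubini's theorem turns the formula into an integral over \<open>[a, b]\<close>.\<close>

lemma integral_char_density:
  assumes int: "integrable lborel (char M)" and atoms: "\<And>x. measure M {x} = 0" and ab: "a \<le> b"
  shows "(\<integral>x. indicator {a..b} x *\<^sub>R char_density M x \<partial>lborel) = of_real (measure M {a<..b})"
proof -
  have cm [measurable]: "char M \<in> borel_measurable borel"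
    using borel_measurable_integrable[OF int] by simp
  define K where "K t = (iexp (- (t * a)) - iexp (- (t * b))) / (\<i> * complex_of_real t)" for t :: real
  have [measurable]: "K \<in> borel_measurable borel" unfolding K_def by measurable
  have K_le: "norm (K t) \<le> b - a" for t
  proof (cases "t = 0")
    case False
    then show ?thesis using Levy_Inversion_aux2[of "-b" "-a" t] ab by (simp add: K_def)
  qed (use ab in \<open>simp add: K_def\<close>)
  have dom: "integrable lborel (\<lambda>t. (b - a) * norm (char M t))"
    using int by (intro integrable_mult_right integrable_norm)
  have "(\<lambda>n. \<integral>t. indicator {- real n<..<real n} t *\<^sub>R (K t * char M t) \<partial>lborel) \<longlonglongrightarrow> (\<integral>t. K t * char M t \<partial>lborel)"
  proof (rule integral_dominated_convergence[OF _ _ dom])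
    show "AE t in lborel. (\<lambda>n. indicator {- real n<..<real n} t *\<^sub>R (K t * char M t)) \<longlonglongrightarrow> K t * char M t"
    proof (rule AE_I2)
      fix t :: real
      obtain n0 :: nat where n0: "\<bar>t\<bar> < real n0" using reals_Archimedean2 by blast
      have "eventually (\<lambda>n. indicator {- real n<..<real n} t *\<^sub>R (K t * char M t) = K t * char M t) sequentially"
        using eventually_ge_at_top[of n0]
      proof eventually_elim
        case (elim n)
        then have "t \<in> {- real n<..<real n}" using n0 of_nat_mono[OF elim, where 'a=real] by auto
        then show ?case by simp
      qed
      then show "(\<lambda>n. indicator {- real n<..<real n} t *\<^sub>R (K t * char M t)) \<longlonglongrightarrow> K t * char M t"
        by (rule tendsto_eventually)
    qed
    show "AE t in lborel. norm (indicator {- real n<..<real n} t *\<^sub>R (K t * char M t)) \<le> (b - a) * norm (char M t)" for n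
      using K_le ab by (auto simp: indicator_def norm_mult intro!: mult_right_mono)
  qed measurable
  moreover have "(CLBINT t=-real n..real n. (iexp (- (t * a)) - iexp (- (t * b))) / (\<i> * t) * char M t) =
      (\<integral>t. indicator {- real n<..<real n} t *\<^sub>R (K t * char M t) \<partial>lborel)" for n
    unfolding K_def by (simp add: interval_lebesgue_integral_def set_lebesgue_integral_def)
  ultimately have "(\<lambda>n. 1 / (2 * pi) * (CLBINT t=-real n..real n. (iexp (- (t * a)) - iexp (- (t * b))) / (\<i> * t) * char M t))
      \<longlonglongrightarrow> 1 / (2 * pi) * (\<integral>t. K t * char M t \<partial>lborel)"
    by (intro tendsto_mult tendsto_const) simp
  moreover have "(\<lambda>n. 1 / (2 * pi) * (CLBINT t=-real n..real n. (iexp (- (t * a)) - iexp (- (t * b))) / (\<i> * t) * char M t))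
      \<longlonglongrightarrow> measure M {a<..b}"
    using Levy_Inversion[OF ab atoms atoms] by simp
  ultimately have "1 / (2 * pi) * (\<integral>t. K t * char M t \<partial>lborel) = of_real (measure M {a<..b})"
    by (rule LIMSEQ_unique)
  then  have lim: "(\<integral>t. K t * char M t \<partial>lborel) / of_real (2 * pi) = of_real (measure M {a<..b})"
    by simp
  have [measurable]: "(\<lambda>p. char M (snd p)) \<in> borel_measurable (lborel \<Otimes>\<^sub>M lborel)" by measurable
  have fub: "(\<integral>x. (\<integral>t. indicator {a..b} x *\<^sub>R (iexp (- (t * x)) * char M t) \<partial>lborel) \<partial>lborel) =
      (\<integral>t. (\<integral>x. indicator {a..b} x *\<^sub>R (iexp (- (t * x)) * char M t) \<partial>lborel) \<partial>lborel)"
  proof (rule lborel_pair.Fubini_integral[symmetric])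
    have "integrable (lborel \<Otimes>\<^sub>M lborel) (\<lambda>p. indicator {a..b} (fst p) * norm (char M (snd p)))"
    proof (rule lborel_pair.Fubini_integrable)
      show "integrable lborel (\<lambda>x. \<integral>y. norm (indicator {a..b} (fst (x, y)) * norm (char M (snd (x, y)))) \<partial>lborel)"
        using ab by (auto simp: abs_mult intro!: integrable_mult_left integrable_real_indicator)
      show "AE x in lborel. integrable lborel (\<lambda>y. indicator {a..b} (fst (x, y)) * norm (char M (snd (x, y))))"
        using int by simp
    qed measurable
    then show "integrable (lborel \<Otimes>\<^sub>M lborel) (\<lambda>(x, t). indicator {a..b} x *\<^sub>R (iexp (- (t * x)) * char M t))"
      by (rule Bochner_Integration.integrable_bound)
        (auto simp: split_beta' norm_mult norm_exp_i_times[of "- y" for y, simplified] indicator_def)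
  qed
  have "(\<integral>x. indicator {a..b} x *\<^sub>R char_density M x \<partial>lborel) =
      (\<integral>x. (\<integral>t. indicator {a..b} x *\<^sub>R (iexp (- (t * x)) * char M t) \<partial>lborel) \<partial>lborel) / of_real (2 * pi)"
    by (simp add: char_density_def scaleR_conv_of_real)
  also note fub
  also have "(\<integral>t. (\<integral>x. indicator {a..b} x *\<^sub>R (iexp (- (t * x)) * char M t) \<partial>lborel) \<partial>lborel) =
      (\<integral>t. K t * char M t \<partial>lborel)"
  proof (rule integral_cong_AE)
    have "AE t in lborel. t \<noteq> (0::real)" by (rule AE_lborel_singleton)
    then show "AE t in lborel. (\<integral>x. indicator {a..b} x *\<^sub>R (iexp (- (t * x)) * char M t) \<partial>lborel) = K t * char M t"
    proof eventually_elim
      case (elim t)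
      have "(\<integral>x. indicator {a..b} x *\<^sub>R (iexp (- (t * x)) * char M t) \<partial>lborel) =
          (\<integral>x. (indicator {a..b} x *\<^sub>R iexp (- (t * x))) * char M t \<partial>lborel)"
        by simp
      also have "\<dots> = K t * char M t"
        unfolding K_def integral_iexp_interval[OF ab elim, symmetric] by (rule integral_mult_left_zero)
      finally show ?case .
    qed
  qed measurable
  finally show ?thesis using lim by simp
qed

text \<open>The candidate is continuous and has the right integral over every interval. Continuity upgrades
  this from almost every point to every point: the candidate is real and nonnegative everywhere.\<close>

theorem density_of_integrable_char:
  assumes int: "integrable lborel (char M)" and atoms: "\<And>x. measure M {x} = 0"
  shows "char_density M x = of_real (Re (char_density M x))" "0 \<le> Re (char_density M x)"
    and "M = density lborel (\<lambda>x. ennreal (Re (char_density M x)))"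
proof -
  let ?p = "char_density M"
  have cont: "isCont ?p x" for x by (rule char_density_isCont[OF int])
  have pm [measurable]: "?p \<in> borel_measurable borel"
    by (rule borel_measurable_continuous_onI) (auto intro: continuous_at_imp_continuous_on cont)
  have i: "integrable lborel (\<lambda>x. indicator {a..b} x *\<^sub>R ?p x)" for a b
    by (rule borel_integrable_compact) (auto intro!: continuous_at_imp_continuous_on cont)
  have Re: "(\<integral>x. indicator {a..b} x * Re (?p x) \<partial>lborel) = measure M {a<..b}"
    and Im: "(\<integral>x. indicator {a..b} x * Im (?p x) \<partial>lborel) = 0" if "a \<le> b" for a b
    using integral_Re[OF i[of a b]] integral_Im[OF i[of a b]] integral_char_density[OF int atoms that] by simp_all
  show nn: "0 \<le> Re (?p x)" for x
    by (rule continuous_nonneg_of_integrals[where h="\<lambda>x. Re (?p x)"]) (simp_all add: Re isCont_Re cont)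
  have Im1: "0 \<le> Im (?p x)" for x
    by (rule continuous_nonneg_of_integrals[where h="\<lambda>x. Im (?p x)"]) (simp_all add: Im isCont_Im cont)
  have Im2: "0 \<le> - Im (?p x)" for x
    by (rule continuous_nonneg_of_integrals[where h="\<lambda>x. - Im (?p x)"]) (simp_all add: Im isCont_Im cont)
  have "Im (?p x) = 0" for x using Im1[of x] Im2[of x] by simp
  then show "?p x = of_real (Re (?p x))" for x by (simp add: complex_eq_iff)
  let ?D = "density lborel (\<lambda>x. ennreal (Re (?p x)))"
  have Ioc: "emeasure ?D {a<..b} = emeasure M {a<..b}" if "a \<le> b" for a b
  proof -
    have "emeasure ?D {a<..b} = (\<integral>\<^sup>+x. ennreal (indicator {a..b} x * Re (?p x)) \<partial>lborel)"
    proof -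
      have "AE x in lborel. x \<noteq> a" by (rule AE_lborel_singleton)
      then show ?thesis
        by (subst emeasure_density) (auto intro!: nn_integral_cong_AE simp: indicator_def elim!: eventually_mono)
    qed
    also have "\<dots> = ennreal (measure M {a<..b})"
      using integrable_Re[OF i[of a b]] nn unfolding Re[OF that, symmetric]
      by (intro nn_integral_eq_integral) simp_all
    finally show ?thesis by (simp add: emeasure_eq_measure)
  qed
  show "M = ?D"
  proof (rule measure_eqI_lessThan)
    fix x :: real
    have U: "{x<..} = (\<Union>n::nat. {x<..x + real n})"
      by (auto simp: not_le) (metis add.commute diff_le_eq real_arch_simple)
    have inc: "incseq (\<lambda>n::nat. {x<..x + real n})" by (auto simp: incseq_def)
    have "emeasure M {x<..} = (SUP n. emeasure M {x<..x + real n})"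
      unfolding U by (rule SUP_emeasure_incseq[symmetric]) (use inc in auto)
    also have "\<dots> = (SUP n. emeasure ?D {x<..x + real n})"
      by (simp add: Ioc)
    also have "\<dots> = emeasure ?D {x<..}"
      unfolding U by (rule SUP_emeasure_incseq) (use inc in auto)
    finally show "emeasure M {x<..} = emeasure ?D {x<..}" .
    show "emeasure M {x<..} < \<infinity>" by (simp add: emeasure_eq_measure)
  qed simp_all
qed

end

section \<open>Infinite sums: products and exchange with integrals\<close>

lemma abs_summable_on_nat:
  fixes f :: "nat \<Rightarrow> 'b::banach"
  assumes "(\<lambda>n. norm (f n)) summable_on UNIV"
  shows "summable (\<lambda>n. norm (f n))" "infsum f UNIV = suminf f"
proof -
  show s: "summable (\<lambda>n. norm (f n))"
    using assms by (simp add: summable_on_UNIV_nonneg_real_iff)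
  show "infsum f UNIV = suminf f"
    using has_sum_imp_sums[OF has_sum_infsum[OF abs_summable_summable[OF assms]]]
    by (simp add: sums_unique)
qed

text \<open>Dominated convergence over an arbitrary countable index set, reduced to series by an enumeration.
  The terms outside the range of the enumeration are filled with 0, so that finite index sets need
  no separate treatment.\<close>

lemma
  fixes f :: "'i \<Rightarrow> 'a \<Rightarrow> 'b::{banach, second_countable_topology}"
  assumes I: "countable I"
    and int: "\<And>i. i \<in> I \<Longrightarrow> integrable M (f i)"
    and pointwise: "\<And>x. x \<in> space M \<Longrightarrow> (\<lambda>i. norm (f i x)) summable_on I"
    and norms: "(\<lambda>i. \<integral>x. norm (f i x) \<partial>M) summable_on I"
  shows integrable_infsum: "integrable M (\<lambda>x. \<Sum>\<^sub>\<infinity>i\<in>I. f i x)"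
    and has_sum_integral: "((\<lambda>i. \<integral>x. f i x \<partial>M) has_sum (\<integral>x. (\<Sum>\<^sub>\<infinity>i\<in>I. f i x) \<partial>M)) I"
proof -
  define J where "J = to_nat_on I ` I"
  define e where "e = from_nat_into I"
  have bij: "bij_betw e J I"
    unfolding J_def e_def using I
    by (intro bij_betw_byWitness[where f'="to_nat_on I"]) auto
  then have eI: "e n \<in> I" if "n \<in> J" for n using that by (auto simp: bij_betw_def)
  define F where "F n = (if n \<in> J then f (e n) else (\<lambda>_. 0))" for n
  have intF: "integrable M (F n)" for n by (simp add: F_def int eI)
  have pF: "(\<lambda>n. norm (F n x)) summable_on UNIV" if "x \<in> space M" for x
  proof -
    have "(\<lambda>n. norm (f (e n) x)) summable_on J"
      using summable_on_reindex_bij_betw[OF bij, of "\<lambda>i. norm (f i x)"] pointwise[OF that] by simp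
    then show ?thesis
      by (rule summable_on_cong_neutral[THEN iffD1, rotated -1]) (auto simp: F_def)
  qed
  have infF: "(\<Sum>\<^sub>\<infinity>i\<in>I. f i x) = (\<Sum>n. F n x)" if "x \<in> space M" for x
  proof -
    have "(\<Sum>\<^sub>\<infinity>i\<in>I. f i x) = (\<Sum>\<^sub>\<infinity>n\<in>J. f (e n) x)"
      by (rule infsum_reindex_bij_betw[OF bij, symmetric])
    also have "\<dots> = (\<Sum>\<^sub>\<infinity>n. F n x)"
      by (rule infsum_cong_neutral) (auto simp: F_def)
    finally show ?thesis using abs_summable_on_nat(2)[OF pF[OF that]] by simp
  qed
  have "(\<lambda>n. \<integral>x. norm (f (e n) x) \<partial>M) summable_on J"
    using summable_on_reindex_bij_betw[OF bij, of "\<lambda>i. \<integral>x. norm (f i x) \<partial>M"] norms by simp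
  then have "(\<lambda>n. \<integral>x. norm (F n x) \<partial>M) summable_on UNIV"
    by (rule summable_on_cong_neutral[THEN iffD1, rotated -1]) (auto simp: F_def)
  then have normsF: "summable (\<lambda>n. \<integral>x. norm (F n x) \<partial>M)"
    by (subst (asm) summable_on_UNIV_nonneg_real_iff) auto
  have ae: "AE x in M. summable (\<lambda>n. norm (F n x))"
    using abs_summable_on_nat(1)[OF pF] by (intro AE_I2)
  have cong: "integrable M (\<lambda>x. \<Sum>\<^sub>\<infinity>i\<in>I. f i x) = integrable M (\<lambda>x. \<Sum>n. F n x)"
    by (rule Bochner_Integration.integrable_cong) (simp_all add: infF)
  show "integrable M (\<lambda>x. \<Sum>\<^sub>\<infinity>i\<in>I. f i x)"
    unfolding cong by (rule integrable_suminf[OF intF ae normsF])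
  have "(\<lambda>n. norm (\<integral>x. F n x \<partial>M)) summable_on UNIV"
  proof -
    have "summable (\<lambda>n. norm (\<integral>x. F n x \<partial>M))"
      by (rule summable_comparison_test[OF _ normsF]) (auto intro: integral_norm_bound)
    then show ?thesis by (simp add: summable_on_UNIV_nonneg_real_iff)
  qed
  then have "((\<lambda>n. \<integral>x. F n x \<partial>M) has_sum (\<Sum>n. \<integral>x. F n x \<partial>M)) UNIV"
    using abs_summable_on_nat(2) has_sum_infsum[OF abs_summable_summable] by metis
  also have "(\<Sum>n. \<integral>x. F n x \<partial>M) = (\<integral>x. (\<Sum>n. F n x) \<partial>M)"
    by (rule integral_suminf[OF intF ae normsF, symmetric])
  also have "\<dots> = (\<integral>x. (\<Sum>\<^sub>\<infinity>i\<in>I. f i x) \<partial>M)"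
    by (rule Bochner_Integration.integral_cong) (simp_all add: infF)
  finally have "((\<lambda>n. \<integral>x. f (e n) x \<partial>M) has_sum (\<integral>x. (\<Sum>\<^sub>\<infinity>i\<in>I. f i x) \<partial>M)) J"
    by (rule has_sum_cong_neutral[THEN iffD1, rotated -1]) (auto simp: F_def)
  then show "((\<lambda>i. \<integral>x. f i x \<partial>M) has_sum (\<integral>x. (\<Sum>\<^sub>\<infinity>i\<in>I. f i x) \<partial>M)) I"
    using has_sum_reindex_bij_betw[OF bij, of "\<lambda>i. \<integral>x. f i x \<partial>M"] by simp
qed

lemma
  fixes f :: "'i \<Rightarrow> complex" and g :: "'k \<Rightarrow> complex"
  assumes f: "(\<lambda>x. norm (f x)) summable_on A" and g: "(\<lambda>y. norm (g y)) summable_on B"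
  shows abs_summable_times: "(\<lambda>(x, y). norm (f x * g y)) summable_on A \<times> B"
    and infsum_times: "(\<Sum>\<^sub>\<infinity>(x, y)\<in>A \<times> B. f x * g y) = infsum f A * infsum g B"
proof -
  show *: "(\<lambda>(x, y). norm (f x * g y)) summable_on A \<times> B"
  proof (rule summable_on_SigmaI)
    show "((\<lambda>y. case (x, y) of (x, y) \<Rightarrow> norm (f x * g y)) has_sum norm (f x) * infsum (\<lambda>y. norm (g y)) B) B" for x
      using has_sum_cmult_right[OF has_sum_infsum[OF g], of "norm (f x)"] by (simp add: norm_mult)
    show "(\<lambda>x. norm (f x) * infsum (\<lambda>y. norm (g y)) B) summable_on A"
      by (rule summable_on_cmult_left[OF f])
  qed auto
  have "(\<lambda>p. norm ((\<lambda>(x, y). f x * g y) p)) summable_on A \<times> B"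
    using * by (simp add: split_beta')
  then have "(\<lambda>(x, y). f x * g y) summable_on A \<times> B"
    by (rule abs_summable_summable)
  then have "(\<Sum>\<^sub>\<infinity>x\<in>A. \<Sum>\<^sub>\<infinity>y\<in>B. f x * g y) = (\<Sum>\<^sub>\<infinity>(x, y)\<in>A \<times> B. f x * g y)"
    by (rule infsum_Sigma'_banach)
  then show "(\<Sum>\<^sub>\<infinity>(x, y)\<in>A \<times> B. f x * g y) = infsum f A * infsum g B"
    by (simp add: infsum_cmult_right' infsum_cmult_left')
qed

text \<open>The block lengths of \<open>j\<close> blocks, without restriction on their total.\<close>

definition tuples :: "nat \<Rightarrow> (nat \<Rightarrow> nat) set" where
  "tuples j = {1..j} \<rightarrow>\<^sub>E {1..}"

lemma countable_tuples [simp]: "countable (tuples j)"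
  unfolding tuples_def by (intro countable_PiE) auto

lemma compositions_eq_tuples: "compositions j m = {l \<in> tuples j. (\<Sum>i=1..j. l i) = m}"
  by (simp add: compositions_def tuples_def)

lemma
  fixes c :: "nat \<Rightarrow> nat \<Rightarrow> complex"
  assumes "\<And>i. i \<in> {1..j} \<Longrightarrow> (\<lambda>l. norm (c i l)) summable_on {1..}"
  shows abs_summable_prod_tuples: "(\<lambda>l. norm (\<Prod>i=1..j. c i (l i))) summable_on tuples j"
    and has_sum_prod_tuples: "((\<lambda>l. \<Prod>i=1..j. c i (l i)) has_sum (\<Prod>i=1..j. \<Sum>\<^sub>\<infinity>l\<in>{1..}. c i l)) (tuples j)"
proof -
  show *: "(\<lambda>l. norm (\<Prod>i=1..j. c i (l i))) summable_on tuples j"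
    unfolding tuples_def abs_summable_equivalent
    by (rule abs_summable_on_prod_PiE) (use assms in \<open>auto simp: abs_summable_equivalent\<close>)
  have "(\<Sum>\<^sub>\<infinity>l\<in>tuples j. \<Prod>i=1..j. c i (l i)) = (\<Prod>i=1..j. \<Sum>\<^sub>\<infinity>l\<in>{1..}. c i l)"
    unfolding tuples_def by (rule infsum_prod_PiE_abs) (use assms in auto)
  then show "((\<lambda>l. \<Prod>i=1..j. c i (l i)) has_sum (\<Prod>i=1..j. \<Sum>\<^sub>\<infinity>l\<in>{1..}. c i l)) (tuples j)"
    using has_sum_infsum[OF abs_summable_summable[OF *]] by simp
qed

lemma has_sum_tuples_by_total:
  fixes F :: "(nat \<Rightarrow> nat) \<Rightarrow> complex"
  assumes "(F has_sum S) (tuples j)"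
  shows "((\<lambda>m. \<Sum>l\<in>compositions j m. F l) has_sum S) UNIV"
proof -
  have bij: "bij_betw (\<lambda>l. (\<Sum>i=1..j. l i, l)) (tuples j) (Sigma UNIV (compositions j))"
    by (intro bij_betw_byWitness[where f'=snd]) (auto simp: compositions_eq_tuples)
  have "((\<lambda>(m, l). F l) has_sum S) (Sigma UNIV (compositions j))"
    using has_sum_reindex_bij_betw[OF bij, of "\<lambda>(m, l). F l" S] assms by simp
  from has_sum_SigmaD[OF this, of "\<lambda>m. \<Sum>l\<in>compositions j m. F l"]
  show ?thesis by (simp add: has_sum_finite)
qed

section \<open>The operator Phi on geometric series\<close>

definition log_series :: "complex \<Rightarrow> complex" where
  "log_series u = (\<Sum>\<^sub>\<infinity>l\<in>{1..}. u ^ l / of_nat l)"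

lemma log_series_abs_summable:
  fixes u :: complex
  assumes "norm u < 1"
  shows "(\<lambda>l. norm (u ^ l / of_nat l)) summable_on {1..}"
proof -
  have "(\<lambda>l. norm u ^ l) summable_on {1..}"
    using assms by (intro summable_on_subset_banach[where A=UNIV and B="{1..}"])
      (simp_all add: summable_on_UNIV_nonneg_real_iff summable_geometric)
  then show ?thesis
  proof (rule summable_on_comparison_test)
    fix l :: nat assume "l \<in> {1..}"
    then have "norm u ^ l / real l \<le> norm u ^ l / 1"
      by (intro divide_left_mono) auto
    then show "norm (u ^ l / of_nat l) \<le> norm u ^ l" by (simp add: norm_divide norm_power)
  qed simp
qed

text \<open>The series is identified by multiplying it with \<open>1 - aX\<close>.\<close>

lemma geometric_fps_expansion:
  fixes a :: complex
  shows
  "fps_nth (fps_expansion (\<lambda>s. a * s / (1 - a * s)) 0) (Suc m) = a ^ Suc m"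
proof -
  define G where "G = Abs_fps (\<lambda>n. if n = 0 then 0 else a ^ n)"
  let ?D = "1 - fps_const a * fps_X"
  have "G * ?D = fps_const a * fps_X"
  proof (rule fps_ext)
    fix n
    have "G * ?D = G - fps_const a * (fps_X * G)"
      by (simp only: right_diff_distrib mult_1_right mult.assoc mult.commute[of G])
    then show "fps_nth (G * ?D) n = fps_nth (fps_const a * fps_X) n"
      by (cases n) (simp_all add: G_def)
  qed
  moreover have "?D \<noteq> 0"
  proof
    assume "?D = 0"
    then have "fps_nth ?D 0 = 0" by simp
    then show False by simp
  qed
  ultimately have G: "fps_const a * fps_X / ?D = G"
    by (metis nonzero_mult_div_cancel_right)
  have "(\<lambda>s. a * s / (1 - a * s)) has_fps_expansion (fps_const a * fps_X / ?D)"
    by (intro fps_expansion_intros) auto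
  then have "fps_expansion (\<lambda>s. a * s / (1 - a * s)) 0 = G"
    unfolding G by (rule fps_expansion_eqI)
  then show ?thesis by (simp add: G_def)
qed

text \<open>Expanding the product of the logarithmic series and collecting the terms with
  \<open>l\<^sub>1 + \<dots> + l\<^sub>j = m\<close> gives \<open>a\<^sup>m \<Phi>\<^sub>j[z\<^sup>m]\<close>.\<close>

theorem Phi_geometric:
  assumes j: "j \<ge> 1" and a: "norm a < 1" and x: "\<And>i. i \<in> {1..j} \<Longrightarrow> norm (x i) \<le> 1"
  shows "Phi j (\<lambda>s. a * s / (1 - a * s)) x = (\<Prod>i=1..j. log_series (a * x i))"
proof -
  let ?F = "\<lambda>l. \<Prod>i=1..j. (a * x i) ^ l i / of_nat (l i)"
  have abs: "(\<lambda>l. norm ((a * x i) ^ l / of_nat l)) summable_on {1..}" if "i \<in> {1..j}" for i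
  proof (rule log_series_abs_summable)
    have "norm (a * x i) \<le> norm a * 1"
      unfolding norm_mult using x[OF that] by (intro mult_left_mono) auto
    then show "norm (a * x i) < 1" using a by simp
  qed
  have "(?F has_sum (\<Prod>i=1..j. log_series (a * x i))) (tuples j)"
    unfolding log_series_def by (rule has_sum_prod_tuples[OF abs])
  from has_sum_imp_sums[OF has_sum_tuples_by_total[OF this]]
  have "(\<lambda>m. \<Sum>l\<in>compositions j m. ?F l) sums (\<Prod>i=1..j. log_series (a * x i))" .
  moreover have "(\<Sum>l\<in>compositions j m. ?F l) = a ^ m * Phi_monom j m x" for m
  proof -
    have "?F l = a ^ m * (\<Prod>i=1..j. x i ^ l i / of_nat (l i))" if "l \<in> compositions j m" for l
    proof -
      have "a ^ m = (\<Prod>i=1..j. a ^ l i)"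
        using that by (simp add: compositions_def power_sum[symmetric])
      then show ?thesis by (simp add: power_mult_distrib prod.distrib[symmetric])
    qed
    then show ?thesis
      unfolding Phi_monom_def compositions_def[symmetric] sum_distrib_left by (intro sum.cong refl)
  qed
  ultimately have "(\<lambda>m. a ^ m * Phi_monom j m x) sums (\<Prod>i=1..j. log_series (a * x i))"
    by simp
  then have "(\<lambda>m. a ^ Suc m * Phi_monom j (Suc m) x) sums (\<Prod>i=1..j. log_series (a * x i))"
    \<comment> \<open>The term of index 0 vanishes because there is at least one block.\<close>
    using j by (subst sums_Suc_iff) (simp add: Phi_monom_eq_0)
  then show ?thesis
    unfolding Phi_def geometric_fps_expansion by (rule sums_unique[symmetric])
qed

section \<open>Inverse transforms of products\<close>

lemma inv_fourier_mult: "inv_fourier (\<lambda>\<eta>. C * h \<eta> * D) y = C * inv_fourier h y * D"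
proof -
  have "exp (\<i> * of_real (y * \<eta>)) * (C * h \<eta> * D) = C * (exp (\<i> * of_real (y * \<eta>)) * h \<eta>) * D" for \<eta>
    by (simp only: ac_simps)
  then show ?thesis by (simp only: inv_fourier_def integral_mult_left_zero integral_mult_right_zero) simp
qed

text \<open>After the first \<open>m\<close> variables have been transformed, the product has the transformed factor in
  these variables and the original factor in the others. Each step only pulls constant factors out
  of a Bochner integral, which is legitimate even where the integral defaults to 0.\<close>

lemma fold_inv_fourier_at_prod:
  assumes "m \<le> n"
  shows "fold inv_fourier_at [1..<Suc m] (\<lambda>\<eta>. C * (\<Prod>i=1..n. h (\<eta> i))) =
    (\<lambda>y. C * (\<Prod>i=1..m. inv_fourier h (y i)) * (\<Prod>i=Suc m..n. h (y i)))"
  using assms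
proof (induction m)
  case 0
  then show ?case by simp
next
  case (Suc m)
  have split: "(\<Prod>i=Suc m..n. h (y i)) = h (y (Suc m)) * (\<Prod>i=Suc (Suc m)..n. h (y i))" for y
    using Suc.prems by (simp add: prod.atLeast_Suc_atMost)
  have upd: "(\<Prod>i=1..m. inv_fourier h ((y(Suc m := \<eta>)) i)) = (\<Prod>i=1..m. inv_fourier h (y i))"
      "(\<Prod>i=Suc (Suc m)..n. h ((y(Suc m := \<eta>)) i)) = (\<Prod>i=Suc (Suc m)..n. h (y i))" for y \<eta>
    by (auto intro!: prod.cong)
  have "fold inv_fourier_at [1..<Suc (Suc m)] (\<lambda>\<eta>. C * (\<Prod>i=1..n. h (\<eta> i))) =
      inv_fourier_at (Suc m) (\<lambda>y. C * (\<Prod>i=1..m. inv_fourier h (y i)) * (\<Prod>i=Suc m..n. h (y i)))"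
    using Suc by (simp del: upt_Suc add: upt_Suc_append)
  also have "\<dots> = (\<lambda>y. C * (\<Prod>i=1..Suc m. inv_fourier h (y i)) * (\<Prod>i=Suc (Suc m)..n. h (y i)))"
  proof
    fix y
    have "inv_fourier_at (Suc m) (\<lambda>y. C * (\<Prod>i=1..m. inv_fourier h (y i)) * (\<Prod>i=Suc m..n. h (y i))) y =
        inv_fourier (\<lambda>\<eta>. (C * (\<Prod>i=1..m. inv_fourier h (y i))) * h \<eta> * (\<Prod>i=Suc (Suc m)..n. h (y i))) (y (Suc m))"
      unfolding inv_fourier_at_def split upd by (simp add: mult.assoc)
    then show "inv_fourier_at (Suc m) (\<lambda>y. C * (\<Prod>i=1..m. inv_fourier h (y i)) * (\<Prod>i=Suc m..n. h (y i))) y =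
        C * (\<Prod>i=1..Suc m. inv_fourier h (y i)) * (\<Prod>i=Suc (Suc m)..n. h (y i))"
      unfolding inv_fourier_mult by simp
  qed
  finally show ?case .
qed

lemma inv_fourier_vars_prod:
  "inv_fourier_vars n (\<lambda>\<eta>. C * (\<Prod>i=1..n. h (\<eta> i))) = (\<lambda>y. C * (\<Prod>i=1..n. inv_fourier h (y i)))"
  using fold_inv_fourier_at_prod[of n n C h] by (simp add: inv_fourier_vars_def del: upt_Suc)

section \<open>The density of a sum of independent steps\<close>

abbreviation density_transform :: "(real \<Rightarrow> real) \<Rightarrow> real \<Rightarrow> complex" where
  "density_transform \<phi> \<equiv> fourier (\<lambda>x. complex_of_real (\<phi> x))"

abbreviation law_of :: "(real \<Rightarrow> real) \<Rightarrow> real measure" where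
  "law_of \<phi> \<equiv> density lborel (\<lambda>x. ennreal (\<phi> x))"

text \<open>Defined through the transform, so that it is the function that occurs in the inverse transform;
  for \<open>l \<ge> 1\<close> it turns out to be the density of a sum of \<open>l\<close> independent steps.\<close>

definition block_density :: "(real \<Rightarrow> real) \<Rightarrow> nat \<Rightarrow> real \<Rightarrow> complex" where
  "block_density \<phi> l = inv_fourier (\<lambda>\<eta>. density_transform \<phi> \<eta> ^ l)"

locale schwartz_density =
  fixes \<phi> :: "real \<Rightarrow> real"
  assumes schwartz: "schwartz \<phi>"
    and nonneg: "\<And>x. \<phi> x \<ge> 0"
    and prob: "prob_space (law_of \<phi>)"
begin

lemma law_prob: "borel_prob (law_of \<phi>)"
  using prob by (simp add: borel_prob_def)

lemma phi_measurable [measurable]: "\<phi> \<in> borel_measurable borel"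
  using schwartz_measurable[OF schwartz, of 0] by simp

lemma phi_integrable: "integrable lborel (\<lambda>x. complex_of_real (\<phi> x))"
  using schwartz_integrable[OF schwartz, of 0] by simp

lemma integral_phi: "(\<integral>x. \<phi> x \<partial>lborel) = 1"
proof -
  have "ennreal (\<integral>x. \<phi> x \<partial>lborel) = (\<integral>\<^sup>+x. ennreal (\<phi> x) \<partial>lborel)"
    using phi_integrable nonneg by (intro nn_integral_eq_integral[symmetric]) (simp_all add: complex_of_real_integrable_eq)
  also have "\<dots> = 1"
    using prob_space.emeasure_space_1[OF prob] by (simp add: emeasure_density)
  finally show ?thesis by (metis ennreal_eq_1)
qed

lemma transform_measurable [measurable]: "density_transform \<phi> \<in> borel_measurable borel"
  unfolding fourier_def by measurable

lemma transform_norm_le_1: "norm (density_transform \<phi> \<eta>) \<le> 1"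
proof -
  have "norm (density_transform \<phi> \<eta>) \<le> (\<integral>y. norm (complex_of_real (\<phi> y)) \<partial>lborel)"
    by (rule fourier_norm_le[OF phi_integrable])
  also have "\<dots> = 1" using integral_phi nonneg by simp
  finally show ?thesis .
qed

lemma transform_integrable: "integrable lborel (density_transform \<phi>)"
  by (rule fourier_schwartz_integrable[OF schwartz])

lemma transform_power_norm_le: "l \<ge> 1 \<Longrightarrow> norm (density_transform \<phi> \<eta> ^ l) \<le> norm (density_transform \<phi> \<eta>)"
  using power_decreasing[of 1 l "norm (density_transform \<phi> \<eta>)"] transform_norm_le_1
  by (simp add: norm_power)

lemma transform_power_integrable: "l \<ge> 1 \<Longrightarrow> integrable lborel (\<lambda>\<eta>. density_transform \<phi> \<eta> ^ l)"
  by (rule Bochner_Integration.integrable_bound[OF transform_integrable])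
    (simp_all add: transform_power_norm_le)

lemma char_sum_law: "char (sum_law (law_of \<phi>) l) t = density_transform \<phi> (- t) ^ l"
proof (induction l)
  case 0
  show ?case by (simp add: char_def integral_return)
next
  case (Suc l)
  have bb: "bounded_borel (\<lambda>x. iexp (t * x))"
    by (auto simp: bounded_borel_def bounded_iff intro!: exI[of _ 1])
  have one: "(\<integral>x. iexp (t * x) \<partial>law_of \<phi>) = density_transform \<phi> (- t)"
    by (subst integral_density) (auto simp: nonneg fourier_def scaleR_conv_of_real mult.commute)
  have "char (sum_law (law_of \<phi>) (Suc l)) t =
      (\<integral>x. \<integral>y. iexp (t * x) * iexp (t * y) \<partial>sum_law (law_of \<phi>) l \<partial>law_of \<phi>)"
    unfolding char_def sum_law.simps
    by (simp only: integral_convolution[OF law_prob sum_law_prob[OF law_prob] bb] distrib_left of_real_add exp_add)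
  also have "\<dots> = (\<integral>x. iexp (t * x) \<partial>law_of \<phi>) * char (sum_law (law_of \<phi>) l) t"
    by (simp only: integral_mult_right_zero integral_mult_left_zero char_def)
  finally show ?case unfolding one Suc by simp
qed

text \<open>The last of the steps has a density, and convolution with a law without atoms creates none.\<close>

lemma sum_law_no_atoms:
  assumes "l \<ge> 1"
  shows "measure (sum_law (law_of \<phi>) l) {x} = 0"
proof -
  from assms obtain k where l: "l = Suc k" by (cases l) auto
  have zero: "emeasure (law_of \<phi>) {z} = 0" for z
  proof -
    have "AE x in lborel. x \<noteq> z" by (rule AE_lborel_singleton)
    then have "AE x in lborel. ennreal (\<phi> x) * indicator {z} x = 0"
      by eventually_elim simp
    then show ?thesis
      by (subst emeasure_density) (simp_all cong: nn_integral_cong_AE)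
  qed
  have "sum_law (law_of \<phi>) l = (sum_law (law_of \<phi>) k \<star> law_of \<phi>)"
    unfolding l sum_law.simps by (rule convolution_commute[OF law_prob sum_law_prob[OF law_prob]])
  then have "emeasure (sum_law (law_of \<phi>) l) {x} = (\<integral>\<^sup>+u. (\<integral>\<^sup>+y. indicator {x} (u + y) \<partial>law_of \<phi>) \<partial>sum_law (law_of \<phi>) k)"
    using borel_probD[OF law_prob] borel_probD[OF sum_law_prob[OF law_prob], of k]
    by (simp only:) (subst convolution_emeasure', auto)
  also have "\<dots> = (\<integral>\<^sup>+u. (\<integral>\<^sup>+y. indicator {x - u} y \<partial>law_of \<phi>) \<partial>sum_law (law_of \<phi>) k)"
    by (intro nn_integral_cong) (auto simp: indicator_def)
  also have "\<dots> = 0" by (simp add: zero)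
  finally show ?thesis by (simp add: measure_def)
qed

lemma
  assumes l: "l \<ge> 1"
  shows block_density_real: "block_density \<phi> l y = of_real (Re (block_density \<phi> l y))"
    and block_density_nonneg: "0 \<le> Re (block_density \<phi> l y)"
    and sum_law_density: "sum_law (law_of \<phi>) l = density lborel (\<lambda>y. ennreal (Re (block_density \<phi> l y)))"
proof -
  interpret S: real_distribution "sum_law (law_of \<phi>) l"
    using borel_probD[OF sum_law_prob[OF law_prob], of l]
    by (simp add: real_distribution_def real_distribution_axioms_def)
  have "integrable lborel (\<lambda>t. (\<lambda>\<eta>. density_transform \<phi> \<eta> ^ l) (0 + - 1 * t))"
    by (rule lborel_integrable_real_affine[OF transform_power_integrable[OF l]]) simp
  then have int: "integrable lborel (char (sum_law (law_of \<phi>) l))"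
    unfolding char_sum_law[abs_def] by simp
  have eq: "char_density (sum_law (law_of \<phi>) l) x = block_density \<phi> l x" for x
  proof -
    have "(\<integral>t. iexp (- (t * x)) * char (sum_law (law_of \<phi>) l) t \<partial>lborel) =
        (\<integral>t. iexp (x * t) * density_transform \<phi> t ^ l \<partial>lborel)"
      using lborel_integral_real_affine[of "-1" "\<lambda>t. iexp (x * t) * density_transform \<phi> t ^ l" 0]
      by (simp add: char_sum_law mult.commute)
    then show ?thesis by (simp add: char_density_def block_density_def inv_fourier_def)
  qed
  from S.density_of_integrable_char[OF int sum_law_no_atoms[OF l]]
  show "block_density \<phi> l y = of_real (Re (block_density \<phi> l y))" "0 \<le> Re (block_density \<phi> l y)"
    "sum_law (law_of \<phi>) l = density lborel (\<lambda>y. ennreal (Re (block_density \<phi> l y)))"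
    unfolding eq by blast+
qed

lemma block_density_measurable: "l \<ge> 1 \<Longrightarrow> block_density \<phi> l \<in> borel_measurable borel"
  unfolding block_density_def inv_fourier_def by measurable

lemma block_density_norm_le:
  assumes "l \<ge> 1"
  shows "norm (block_density \<phi> l y) \<le> (\<integral>\<eta>. norm (density_transform \<phi> \<eta>) \<partial>lborel) / (2 * pi)"
proof -
  have "norm (\<integral>\<eta>. exp (\<i> * of_real (y * \<eta>)) * density_transform \<phi> \<eta> ^ l \<partial>lborel) \<le>
      (\<integral>\<eta>. norm (exp (\<i> * of_real (y * \<eta>)) * density_transform \<phi> \<eta> ^ l) \<partial>lborel)"
    by (rule integral_norm_bound)
  also have "\<dots> = (\<integral>\<eta>. norm (density_transform \<phi> \<eta> ^ l) \<partial>lborel)"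
    by (simp add: norm_mult)
  also have "\<dots> \<le> (\<integral>\<eta>. norm (density_transform \<phi> \<eta>) \<partial>lborel)"
    using assms transform_power_norm_le
    by (intro integral_mono integrable_norm transform_integrable transform_power_integrable) auto
  finally show ?thesis
    by (simp add: block_density_def inv_fourier_def norm_divide divide_right_mono)
qed

end

text \<open>It suffices to compare both measures on boxes, where the integral of the product factorises.\<close>

lemma PiM_density:
  fixes f :: "'i \<Rightarrow> real \<Rightarrow> ennreal"
  assumes I: "finite I" and f [measurable]: "\<And>i. i \<in> I \<Longrightarrow> f i \<in> borel_measurable borel"
    and sf: "\<And>i. i \<in> I \<Longrightarrow> sigma_finite_measure (density lborel (f i))"
  shows "(\<Pi>\<^sub>M i\<in>I. density lborel (f i)) = density (\<Pi>\<^sub>M i\<in>I. lborel) (\<lambda>x. \<Prod>i\<in>I. f i (x i))"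
proof -
  let ?D = "\<lambda>i. if i \<in> I then density lborel (f i) else lborel"
  interpret D: product_sigma_finite ?D
    using sf by (simp add: product_sigma_finite_def lborel.sigma_finite_measure_axioms)
  interpret L: product_sigma_finite "\<lambda>i. lborel :: real measure"
    by unfold_locales
  have m: "(\<lambda>x. \<Prod>i\<in>I. f i (x i)) \<in> borel_measurable (\<Pi>\<^sub>M i\<in>I. lborel)"
    by measurable
  have "density (\<Pi>\<^sub>M i\<in>I. lborel) (\<lambda>x. \<Prod>i\<in>I. f i (x i)) = PiM I ?D"
  proof (rule D.PiM_eqI[OF I])
    show "sets (density (\<Pi>\<^sub>M i\<in>I. lborel) (\<lambda>x. \<Prod>i\<in>I. f i (x i))) = sets (PiM I ?D)"
      unfolding sets_density by (rule sets_PiM_cong) auto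
    fix A :: "'i \<Rightarrow> real set"
    assume "\<And>i. i \<in> I \<Longrightarrow> A i \<in> sets (?D i)"
    then have A: "\<And>i. i \<in> I \<Longrightarrow> A i \<in> sets borel" by simp
    then have PA: "Pi\<^sub>E I A \<in> sets (\<Pi>\<^sub>M i\<in>I. (lborel :: real measure))"
      using I by (intro sets_PiM_I_finite) auto
    have "emeasure (density (\<Pi>\<^sub>M i\<in>I. lborel) (\<lambda>x. \<Prod>i\<in>I. f i (x i))) (Pi\<^sub>E I A) =
        (\<integral>\<^sup>+x. (\<Prod>i\<in>I. f i (x i)) * indicator (Pi\<^sub>E I A) x \<partial>(\<Pi>\<^sub>M i\<in>I. lborel))"
      by (rule emeasure_density[OF m PA])
    also have "\<dots> = (\<integral>\<^sup>+x. (\<Prod>i\<in>I. f i (x i) * indicator (A i) (x i)) \<partial>(\<Pi>\<^sub>M i\<in>I. lborel))"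
    proof (rule nn_integral_cong)
      fix x assume "x \<in> space (\<Pi>\<^sub>M i\<in>I. (lborel :: real measure))"
      then have ext: "x \<in> extensional I" by (simp add: space_PiM PiE_def)
      have "indicator (Pi\<^sub>E I A) x = (\<Prod>i\<in>I. indicator (A i) (x i) :: ennreal)"
      proof (cases "x \<in> Pi\<^sub>E I A")
        case True
        then have "indicator (A i) (x i) = (1 :: ennreal)" if "i \<in> I" for i
          using that by (auto simp: PiE_iff)
        then show ?thesis using True by simp
      next
        case False
        then obtain i where "i \<in> I" "x i \<notin> A i" using ext by (auto simp: PiE_iff)
        then have "(\<Prod>i\<in>I. indicator (A i) (x i) :: ennreal) = 0"
          using I by (intro prod_zero) (auto intro!: bexI[of _ i])
        then show ?thesis using False by simp
      qed
      then show "(\<Prod>i\<in>I. f i (x i)) * indicator (Pi\<^sub>E I A) x = (\<Prod>i\<in>I. f i (x i) * indicator (A i) (x i))"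
        by (simp add: prod.distrib)
    qed
    also have "\<dots> = (\<Prod>i\<in>I. \<integral>\<^sup>+y. f i y * indicator (A i) y \<partial>lborel)"
      using A by (intro L.product_nn_integral_prod I) simp
    also have "\<dots> = (\<Prod>i\<in>I. emeasure (?D i) (A i))"
      using A by (intro prod.cong refl) (simp add: emeasure_density)
    finally show "emeasure (density (\<Pi>\<^sub>M i\<in>I. lborel) (\<lambda>x. \<Prod>i\<in>I. f i (x i))) (Pi\<^sub>E I A) =
        (\<Prod>i\<in>I. emeasure (?D i) (A i))" .
  qed
  also have "PiM I ?D = (\<Pi>\<^sub>M i\<in>I. density lborel (f i))"
    by (rule PiM_cong) auto
  finally show ?thesis ..
qed

definition log_density :: "(real \<Rightarrow> real) \<Rightarrow> complex \<Rightarrow> real \<Rightarrow> complex" where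
  "log_density \<phi> a y = (\<Sum>\<^sub>\<infinity>l\<in>{1..}. a ^ l / of_nat l * block_density \<phi> l y)"

context schwartz_density begin

lemma log_density_abs_summable:
  assumes "norm a < 1"
  shows "(\<lambda>l. norm (a ^ l / of_nat l * block_density \<phi> l y)) summable_on {1..}"
proof -
  let ?C = "(\<integral>\<eta>. norm (density_transform \<phi> \<eta>) \<partial>lborel) / (2 * pi)"
  have "(\<lambda>l. norm (a ^ l / of_nat l) * ?C) summable_on {1..}"
    by (intro summable_on_cmult_left log_series_abs_summable assms)
  then show ?thesis
  proof (rule summable_on_comparison_test)
    fix l :: nat assume "l \<in> {1..}"
    then show "norm (a ^ l / of_nat l * block_density \<phi> l y) \<le> norm (a ^ l / of_nat l) * ?C"
      unfolding norm_mult by (intro mult_left_mono block_density_norm_le) auto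
  qed simp
qed

text \<open>The powers of the transform have bounded integrals because it is integrable and bounded by 1, so
  the series may be transformed term by term.\<close>

theorem inv_fourier_log_series:
  assumes a: "norm a < 1"
  shows "inv_fourier (\<lambda>\<eta>. log_series (a * density_transform \<phi> \<eta>)) y = log_density \<phi> a y"
proof -
  let ?h = "density_transform \<phi>"
  let ?f = "\<lambda>l \<eta>. exp (\<i> * of_real (y * \<eta>)) * (a ^ l / of_nat l * ?h \<eta> ^ l)"
  have nf: "norm (?f l \<eta>) = norm (a ^ l / of_nat l) * norm (?h \<eta> ^ l)" for l \<eta>
    by (simp add: norm_mult norm_divide)
  have ah: "norm (a * ?h \<eta>) < 1" for \<eta>
  proof -
    have "norm (a * ?h \<eta>) \<le> norm a * 1"
      unfolding norm_mult by (intro mult_left_mono transform_norm_le_1) auto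
    then show ?thesis using a by simp
  qed
  have int: "integrable lborel (?f l)" if "l \<in> {1..}" for l
  proof (rule Bochner_Integration.integrable_bound)
    show "integrable lborel (\<lambda>\<eta>. a ^ l / of_nat l * ?h \<eta> ^ l)"
      using that by (intro integrable_mult_right transform_power_integrable) simp
  qed (simp_all add: norm_mult norm_divide)
  have pointwise: "(\<lambda>l. norm (?f l \<eta>)) summable_on {1..}" for \<eta>
    using log_series_abs_summable[OF ah[of \<eta>]]
    by (simp add: nf norm_mult norm_divide power_mult_distrib)
  have norms: "(\<lambda>l. \<integral>\<eta>. norm (?f l \<eta>) \<partial>lborel) summable_on {1..}"
  proof (rule summable_on_comparison_test)
    show "(\<lambda>l. norm (a ^ l / of_nat l) * (\<integral>\<eta>. norm (?h \<eta>) \<partial>lborel)) summable_on {1..}"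
      by (intro summable_on_cmult_left log_series_abs_summable a)
    fix l :: nat assume l: "l \<in> {1..}"
    have "(\<integral>\<eta>. norm (?h \<eta> ^ l) \<partial>lborel) \<le> (\<integral>\<eta>. norm (?h \<eta>) \<partial>lborel)"
      using l transform_power_norm_le
      by (intro integral_mono integrable_norm transform_integrable transform_power_integrable) auto
    then show "(\<integral>\<eta>. norm (?f l \<eta>) \<partial>lborel) \<le> norm (a ^ l / of_nat l) * (\<integral>\<eta>. norm (?h \<eta>) \<partial>lborel)"
      unfolding nf by (simp add: mult_left_mono del: norm_divide)
  qed simp
  have "(\<integral>\<eta>. exp (\<i> * of_real (y * \<eta>)) * log_series (a * ?h \<eta>) \<partial>lborel) =
      (\<integral>\<eta>. (\<Sum>\<^sub>\<infinity>l\<in>{1..}. ?f l \<eta>) \<partial>lborel)"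
    unfolding log_series_def
    by (simp only: infsum_cmult_right' power_mult_distrib times_divide_eq_left)
  also have "\<dots> = (\<Sum>\<^sub>\<infinity>l\<in>{1..}. \<integral>\<eta>. ?f l \<eta> \<partial>lborel)"
    by (rule infsumI[symmetric], rule has_sum_integral[OF _ int pointwise norms]) auto
  also have "\<dots> = (\<Sum>\<^sub>\<infinity>l\<in>{1..}. a ^ l / of_nat l * block_density \<phi> l y * of_real (2 * pi))"
  proof (rule infsum_cong)
    fix l
    have "(\<integral>\<eta>. ?f l \<eta> \<partial>lborel) = (\<integral>\<eta>. a ^ l / of_nat l * (exp (\<i> * of_real (y * \<eta>)) * ?h \<eta> ^ l) \<partial>lborel)"
      by (simp only: ac_simps)
    then show "(\<integral>\<eta>. ?f l \<eta> \<partial>lborel) = a ^ l / of_nat l * block_density \<phi> l y * of_real (2 * pi)"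
      by (simp only: integral_mult_right_zero block_density_def inv_fourier_def) simp
  qed
  also have "\<dots> = log_density \<phi> a y * of_real (2 * pi)"
    unfolding log_density_def by (rule infsum_cmult_left')
  finally show ?thesis by (simp add: inv_fourier_def)
qed

end

section \<open>Consecutive segments of a random walk\<close>

text \<open>Displacement and running maximum of the walk made of the \<open>n\<close> steps that follow step \<open>m\<close>.\<close>

definition segment_walk :: "(nat \<Rightarrow> real) \<Rightarrow> nat \<Rightarrow> nat \<Rightarrow> real \<times> real" where
  "segment_walk x m n = (\<Sum>i=m+1..m+n. x i, Max (insert 0 ((\<lambda>k. \<Sum>i=m+1..m+k. x i) ` {1..n})))"

lemma Max_image_add:
  fixes f :: "nat \<Rightarrow> real"
  assumes "finite A" "A \<noteq> {}"
  shows "Max ((\<lambda>k. c + f k) ` A) = c + Max (f ` A)"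
  using assms Max_add_commute[of A f c] by (simp add: add.commute)

lemma insert_0_image:
  fixes m n :: nat
  shows "insert 0 ((\<lambda>k. \<Sum>i=m+1..m+k. x i) ` {1..n}) = (\<lambda>k. \<Sum>i=m+1..m+k. (x i :: real)) ` {0..n}"
proof -
  have "{0..n} = insert 0 {1..n}" by auto
  then show ?thesis by simp
qed

text \<open>The maximum is attained either before time \<open>p\<close> or after it, and from then on the walk starts at its
  position at time \<open>p\<close>.\<close>

lemma segment_walk_append:
  "snd (segment_walk x m (p + q)) =
    max (snd (segment_walk x m p)) (fst (segment_walk x m p) + snd (segment_walk x (m + p) q))"
proof -
  let ?s = "\<lambda>k. \<Sum>i=m+1..m+k. x i"
  have split: "?s (p + k) = ?s p + (\<Sum>i=m+p+1..m+p+k. x i)" for k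
    using sum.ub_add_nat[of "m+1" "m+p" x k] by (simp add: add.assoc)
  have "{0..p+q} = {0..p} \<union> (\<lambda>k. p + k) ` {0..q}"
    by (auto simp: image_iff; presburger)
  then have "?s ` {0..p+q} = ?s ` {0..p} \<union> (\<lambda>k. ?s (p + k)) ` {0..q}"
    by (simp only: image_Un image_image)
  then have "Max (?s ` {0..p+q}) = max (Max (?s ` {0..p})) (Max ((\<lambda>k. ?s (p + k)) ` {0..q}))"
    by (simp only:) (rule Max_Un; simp)
  also have "Max ((\<lambda>k. ?s (p + k)) ` {0..q}) = ?s p + Max ((\<lambda>k. \<Sum>i=m+p+1..m+p+k. x i) ` {0..q})"
    unfolding split by (rule Max_image_add) auto
  finally show ?thesis
    unfolding segment_walk_def insert_0_image snd_conv fst_conv .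
qed

lemma segment_walk_fst_append:
  "fst (segment_walk x m (p + q)) = fst (segment_walk x m p) + fst (segment_walk x (m + p) q)"
  using sum.ub_add_nat[of "m+1" "m+p" x q] by (simp add: segment_walk_def add.assoc)

lemma segment_walk_Suc:
  "segment_walk x m (Suc n) = clip ((x (Suc m), x (Suc m)) + segment_walk x (Suc m) n)"
proof -
  have one: "segment_walk x m 1 = (x (Suc m), max 0 (x (Suc m)))"
    by (simp add: segment_walk_def max.commute)
  have ge: "snd (segment_walk x (Suc m) n) \<ge> 0"
    by (simp add: segment_walk_def)
  show ?thesis
    using segment_walk_append[of x m 1 n] segment_walk_fst_append[of x m 1 n] ge
    by (auto simp: one[unfolded One_nat_def] clip_def prod_eq_iff split_beta max_def)
qed

lemma segment_walk_0: "segment_walk x m 0 = 0"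
  by (simp add: segment_walk_def zero_prod_def)

lemma segment_walk_restrict:
  assumes "{m+1..m+n} \<subseteq> A"
  shows "segment_walk (restrict x A) m n = segment_walk x m n"
proof -
  have "(\<Sum>i=m+1..m+k. restrict x A i) = (\<Sum>i=m+1..m+k. x i)" if "k \<le> n" for k
  proof (rule sum.cong[OF refl])
    fix i assume "i \<in> {m+1..m+k}"
    then have "i \<in> {m+1..m+n}" using that by simp
    then show "restrict x A i = x i" using assms by (simp add: subsetD)
  qed
  then show ?thesis unfolding segment_walk_def
    by (intro arg_cong2[where f=Pair] arg_cong[where f=Max] arg_cong[where f="insert 0"] image_cong) auto
qed

lemma measurable_segment_walk:
  assumes "\<And>i. i \<in> {m+1..m+n} \<Longrightarrow> (\<lambda>w. x w i) \<in> borel_measurable M"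
  shows "(\<lambda>w. segment_walk (x w) m n) \<in> borel_measurable M"
  using assms
proof (induction n arbitrary: m)
  case 0
  then show ?case by (simp add: segment_walk_0)
next
  case (Suc n)
  have 1: "(\<lambda>w. x w (Suc m)) \<in> borel_measurable M" by (rule Suc.prems) simp
  have 2: "(\<lambda>w. segment_walk (x w) (Suc m) n) \<in> borel_measurable M"
    by (rule Suc.IH) (rule Suc.prems, simp)
  show ?case
    unfolding segment_walk_Suc
    by (intro measurable_compose[OF _ measurable_clip] borel_measurable_add 2
        measurable_compose[OF 1 measurable_diag])
qed

context prob_space begin

text \<open>Functionals of disjoint sets of steps have a product law.\<close>

lemma indep_segments:
  fixes f g :: "(nat \<Rightarrow> real) \<Rightarrow> real \<times> real"
  assumes X: "indep_vars (\<lambda>_. borel) X I" and A: "A \<inter> B = {}" "A \<subseteq> I" "B \<subseteq> I"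
    and f: "f \<in> borel_measurable (\<Pi>\<^sub>M i\<in>A. borel)" and g: "g \<in> borel_measurable (\<Pi>\<^sub>M i\<in>B. borel)"
  shows "distr M (borel \<Otimes>\<^sub>M borel) (\<lambda>\<omega>. (f (restrict (\<lambda>i. X i \<omega>) A), g (restrict (\<lambda>i. X i \<omega>) B))) =
    distr M borel (\<lambda>\<omega>. f (restrict (\<lambda>i. X i \<omega>) A)) \<Otimes>\<^sub>M distr M borel (\<lambda>\<omega>. g (restrict (\<lambda>i. X i \<omega>) B))"
proof -
  have "indep_var borel (f \<circ> (\<lambda>\<omega>. restrict (\<lambda>i. X i \<omega>) A)) borel (g \<circ> (\<lambda>\<omega>. restrict (\<lambda>i. X i \<omega>) B))"
    by (rule indep_var_compose[OF indep_var_restrict[OF X A] f g])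
  then show ?thesis
    by (simp add: indep_var_distribution_eq comp_def)
qed

lemma indep_segment_walks:
  assumes X: "indep_vars (\<lambda>_. borel) X {1..}"
  shows "distr M (borel \<Otimes>\<^sub>M borel) (\<lambda>\<omega>. (segment_walk (\<lambda>i. X i \<omega>) m p, segment_walk (\<lambda>i. X i \<omega>) (m + p) q)) =
    distr M borel (\<lambda>\<omega>. segment_walk (\<lambda>i. X i \<omega>) m p) \<Otimes>\<^sub>M
    distr M borel (\<lambda>\<omega>. segment_walk (\<lambda>i. X i \<omega>) (m + p) q)"
proof -
  have f: "(\<lambda>x. segment_walk x k n) \<in> borel_measurable (\<Pi>\<^sub>M i\<in>{k+1..k+n}. borel)" for k n
    by (rule measurable_segment_walk) (rule measurable_component_singleton)
  show ?thesis
    using indep_segments[OF X _ _ _ f[of m p] f[of "m + p" q]]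
    by (simp add: segment_walk_restrict)
qed

text \<open>The first step is independent of the remaining segment, whose law is given by induction; the
  starting index has to vary for this.\<close>

theorem distr_segment_walk:
  assumes X: "indep_vars (\<lambda>_. borel) X {1..}"
    and N: "\<And>i. i \<ge> 1 \<Longrightarrow> distr M borel (X i) = N" and bp: "borel_prob N"
  shows "distr M borel (\<lambda>\<omega>. segment_walk (\<lambda>i. X i \<omega>) m n) = walk_law N n"
proof (induction n arbitrary: m)
  case 0
  show ?case by (simp add: segment_walk_0 distr_const)
next
  case (Suc n)
  have X_meas: "X i \<in> borel_measurable M" if "i \<ge> 1" for i
    using X that by (auto simp: indep_vars_def)
  have walk_meas: "(\<lambda>\<omega>. segment_walk (\<lambda>i. X i \<omega>) k n) \<in> borel_measurable M" for k n
    by (rule measurable_segment_walk) (simp add: X_meas)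
  have X_diag: "(\<lambda>\<omega>. (X (Suc m) \<omega>, X (Suc m) \<omega>)) \<in> borel_measurable M"
    by (intro measurable_compose[OF X_meas measurable_diag]) simp
  have "distr M (borel \<Otimes>\<^sub>M borel) (\<lambda>\<omega>. ((X (Suc m) \<omega>, X (Suc m) \<omega>), segment_walk (\<lambda>i. X i \<omega>) (Suc m) n)) =
    distr M borel (\<lambda>\<omega>. (X (Suc m) \<omega>, X (Suc m) \<omega>)) \<Otimes>\<^sub>M distr M borel (\<lambda>\<omega>. segment_walk (\<lambda>i. X i \<omega>) (Suc m) n)"
  proof -
    have f: "(\<lambda>x. (x (Suc m), x (Suc m))) \<in> borel_measurable (\<Pi>\<^sub>M i\<in>{Suc m}. (borel :: real measure))"
      by (rule measurable_compose[OF _ measurable_diag]) (rule measurable_component_singleton, simp)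
    have g: "(\<lambda>x. segment_walk x (Suc m) n) \<in> borel_measurable (\<Pi>\<^sub>M i\<in>{Suc m+1..Suc m+n}. borel)"
      by (rule measurable_segment_walk) (rule measurable_component_singleton)
    show ?thesis
      using indep_segments[OF X _ _ _ f g] by (simp add: segment_walk_restrict)
  qed
  also have "distr M borel (\<lambda>\<omega>. (X (Suc m) \<omega>, X (Suc m) \<omega>)) = diag_law N"
    unfolding diag_law_def N[of "Suc m", simplified, symmetric]
    by (subst distr_distr) (simp_all add: X_meas measurable_diag comp_def)
  also note Suc.IH
  finally have joint: "distr M (borel \<Otimes>\<^sub>M borel) (\<lambda>\<omega>. ((X (Suc m) \<omega>, X (Suc m) \<omega>), segment_walk (\<lambda>i. X i \<omega>) (Suc m) n)) =
    diag_law N \<Otimes>\<^sub>M walk_law N n" .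
  have plus: "(\<lambda>(u, v). u + v) \<in> borel_measurable (borel \<Otimes>\<^sub>M borel :: ((real \<times> real) \<times> (real \<times> real)) measure)"
    by measurable
  have "walk_law N (Suc n) = distr (distr (diag_law N \<Otimes>\<^sub>M walk_law N n) borel (\<lambda>(u, v). u + v)) borel clip"
    by (simp add: convolution_def)
  also have "\<dots> = distr M borel (\<lambda>\<omega>. clip ((X (Suc m) \<omega>, X (Suc m) \<omega>) + segment_walk (\<lambda>i. X i \<omega>) (Suc m) n))"
    unfolding joint[symmetric]
    using borel_measurable_add[OF X_diag walk_meas]
    by (simp add: distr_distr plus measurable_clip X_diag walk_meas measurable_Pair comp_def)
  finally show ?case by (simp add: segment_walk_Suc)
qed

end

section \<open>The coupling of the two segments\<close>

text \<open>The integrand \<open>exp(i\<alpha> S\<^sub>p + i\<beta> T\<^sub>p\<^sub>+\<^sub>q)\<close>, written in terms of the pairs (position, maximum)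
  \<open>u\<close> and \<open>v\<close> of its two segments.\<close>

definition phase :: "real \<Rightarrow> real \<Rightarrow> real \<times> real \<Rightarrow> real \<times> real \<Rightarrow> complex" where
  "phase \<alpha> \<beta> u v =
     exp (\<i> * of_real (\<alpha> * fst u) + \<i> * of_real (\<beta> * (snd u + max 0 (fst u - snd u + snd v))))"

lemma phase_measurable [measurable]:
  "(\<lambda>(u, v). phase \<alpha> \<beta> u v) \<in> borel_measurable (borel \<Otimes>\<^sub>M borel)"
proof -
  have [measurable]: "fst \<in> borel_measurable (borel :: (real \<times> real) measure)"
    "snd \<in> borel_measurable (borel :: (real \<times> real) measure)"
    by (simp_all add: borel_prod[symmetric])
  show ?thesis unfolding phase_def by measurable
qed

lemma phase_norm [simp]: "norm (phase \<alpha> \<beta> u v) = 1"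
  by (simp add: phase_def norm_exp_i_times flip: distrib_left of_real_add)

lemma phase_section_bounded_borel: "bounded_borel (phase \<alpha> \<beta> u)"
  using measurable_Pair2[OF phase_measurable[of \<alpha> \<beta>], of u]
  by (auto simp: bounded_borel_def bounded_iff intro!: exI[of _ 1])

lemma phase_integral_bounded_borel:
  assumes \<nu>: "prob_space \<nu>" and h [measurable]: "h \<in> borel_measurable \<nu>"
  shows "bounded_borel (\<lambda>u. \<integral>y. phase \<alpha> \<beta> u (h y) \<partial>\<nu>)"
proof -
  interpret prob_space \<nu> by fact
  have m: "(\<lambda>(u, y). phase \<alpha> \<beta> u (h y)) \<in> borel_measurable (borel \<Otimes>\<^sub>M \<nu>)"
    using measurable_compose[OF _ phase_measurable[of \<alpha> \<beta>], of "\<lambda>(u, y). (u, h y)" "borel \<Otimes>\<^sub>M \<nu>"]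
    by (simp add: split_beta')
  have "norm (\<integral>y. phase \<alpha> \<beta> u (h y) \<partial>\<nu>) \<le> 1" for u
    using integral_norm_bound[of \<nu> "\<lambda>y. phase \<alpha> \<beta> u (h y)"] by (simp add: prob_space)
  then show ?thesis
    using borel_measurable_lebesgue_integral[OF m]
    by (auto simp: bounded_borel_def bounded_iff)
qed

text \<open>The two segments are independent, and the maximum of the whole path is
  \<open>max(t, s + t') = t + (s - t + t')\<^sub>+\<close> when \<open>(s, t)\<close> and \<open>(s', t')\<close> belong to the segments.\<close>

lemma expectation_phase:
  assumes M: "prob_space M" and X: "prob_space.indep_vars M (\<lambda>_. borel) X {1..}"
    and N: "\<And>i. i \<ge> 1 \<Longrightarrow> distr M borel (X i) = N" and bp: "borel_prob N"
  shows "prob_space.expectation M (\<lambda>\<omega>. exp (\<i> * of_real (\<alpha> * partial_sum X p \<omega>) + \<i> * of_real (\<beta> * running_max X (p + q) \<omega>))) =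
    (\<integral>u. \<integral>v. phase \<alpha> \<beta> u v \<partial>walk_law N q \<partial>walk_law N p)"
proof -
  interpret prob_space M by fact
  let ?W = "\<lambda>m n \<omega>. segment_walk (\<lambda>i. X i \<omega>) m n"
  let ?R = "walk_law N"
  note R = walk_law_prob[OF bp]
  note [measurable_cong] = borel_probD(4)[OF R, of p] borel_probD(4)[OF R, of q]
  interpret P: pair_prob_space "?R p" "?R q"
    unfolding pair_prob_space_def pair_sigma_finite_def
    using R by (simp add: borel_probD)
  have S: "partial_sum X p \<omega> = fst (?W 0 p \<omega>)" for \<omega>
    by (simp add: partial_sum_def segment_walk_def)
  have "running_max X (p + q) \<omega> = snd (?W 0 (p + q) \<omega>)" for \<omega>
    by (simp add: running_max_def partial_sum_def segment_walk_def)
  then have T: "running_max X (p + q) \<omega> =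
      snd (?W 0 p \<omega>) + max 0 (fst (?W 0 p \<omega>) - snd (?W 0 p \<omega>) + snd (?W p q \<omega>))" for \<omega>
    by (simp add: segment_walk_append)
  have meas: "?W m n \<in> borel_measurable M" for m n
    using X by (intro measurable_segment_walk) (auto simp: indep_vars_def)
  have "expectation (\<lambda>\<omega>. exp (\<i> * of_real (\<alpha> * partial_sum X p \<omega>) + \<i> * of_real (\<beta> * running_max X (p + q) \<omega>))) =
      expectation (\<lambda>\<omega>. (\<lambda>(u, v). phase \<alpha> \<beta> u v) (?W 0 p \<omega>, ?W p q \<omega>))"
    unfolding S T by (simp add: phase_def)
  also have "\<dots> = (\<integral>(u, v). phase \<alpha> \<beta> u v \<partial>distr M (borel \<Otimes>\<^sub>M borel) (\<lambda>\<omega>. (?W 0 p \<omega>, ?W p q \<omega>)))"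
    by (rule integral_distr[symmetric]) (auto intro!: measurable_Pair meas phase_measurable)
  also have "distr M (borel \<Otimes>\<^sub>M borel) (\<lambda>\<omega>. (?W 0 p \<omega>, ?W p q \<omega>)) = ?R p \<Otimes>\<^sub>M ?R q"
    using indep_segment_walks[OF X, of 0 p q] by (simp add: distr_segment_walk[OF X N bp])
  also have "(\<integral>(u, v). phase \<alpha> \<beta> u v \<partial>(?R p \<Otimes>\<^sub>M ?R q)) = (\<integral>u. \<integral>v. phase \<alpha> \<beta> u v \<partial>?R q \<partial>?R p)"
  proof -
    have "integrable (?R p \<Otimes>\<^sub>M ?R q) (\<lambda>(u, v). phase \<alpha> \<beta> u v)"
      by (rule P.integrable_const_bound[where B=1]) (auto simp: split_beta')
    then show ?thesis
      using P.integral_fst'[of "\<lambda>(u, v). phase \<alpha> \<beta> u v"] by simp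
  qed
  finally show ?thesis .
qed

lemma sum_clip: "(\<Sum>i\<in>I. clip (y i, y i)) = (\<Sum>i\<in>I. y i, \<Sum>i\<in>I. max 0 (y i))"
  by (simp add: clip_def sum_prod)

text \<open>By \<open>-(y)\<^sub>- = y - (y)\<^sub>+\<close>, the inner sum in \<open>\<Omega>\<close> is the difference of position and maximum.\<close>

lemma phase_Omega:
  "exp (\<i> * of_real (\<alpha> * (\<Sum>i=1..j. y i)) + \<i> * of_real (\<beta> * Omega j k y z)) =
    phase \<alpha> \<beta> (\<Sum>i=1..j. clip (y i, y i)) (\<Sum>i=1..k. clip (z i, z i))"
proof -
  have "- (\<Sum>i=1..j. neg_part (y i)) = (\<Sum>i=1..j. y i) - (\<Sum>i=1..j. pos_part (y i))"
    unfolding sum_negf[symmetric] sum_subtractf[symmetric]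
    by (rule sum.cong) (auto simp: neg_part_def pos_part_def)
  then show ?thesis
    by (simp add: phase_def sum_clip Omega_def pos_part_def)
qed

context schwartz_density begin

abbreviation vol :: "nat \<Rightarrow> nat \<Rightarrow> ((nat \<Rightarrow> real) \<times> (nat \<Rightarrow> real)) measure" where
  "vol j k \<equiv> (\<Pi>\<^sub>M i\<in>{1..j}. lborel) \<Otimes>\<^sub>M (\<Pi>\<^sub>M i\<in>{1..k}. lborel)"

definition pair_integral :: "real \<Rightarrow> real \<Rightarrow> nat \<Rightarrow> (nat \<Rightarrow> nat) \<Rightarrow> nat \<Rightarrow> (nat \<Rightarrow> nat) \<Rightarrow> complex" where
  "pair_integral \<alpha> \<beta> j l k n =
     block_integral (law_of \<phi>) j l (\<lambda>u. block_integral (law_of \<phi>) k n (phase \<alpha> \<beta> u))"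

lemma PiM_sum_law:
  assumes l: "l \<in> tuples j"
  shows "(\<Pi>\<^sub>M i\<in>{1..j}. sum_law (law_of \<phi>) (l i)) =
    density (\<Pi>\<^sub>M i\<in>{1..j}. lborel) (\<lambda>y. ennreal (\<Prod>i=1..j. Re (block_density \<phi> (l i) (y i))))"
proof -
  have l1: "l i \<ge> 1" if "i \<in> {1..j}" for i
    using l that by (auto simp: tuples_def PiE_iff)
  have "(\<Pi>\<^sub>M i\<in>{1..j}. sum_law (law_of \<phi>) (l i)) =
      (\<Pi>\<^sub>M i\<in>{1..j}. density lborel (\<lambda>y. ennreal (Re (block_density \<phi> (l i) y))))"
    by (rule PiM_cong[OF refl]) (rule sum_law_density[OF l1])
  also have "\<dots> = density (\<Pi>\<^sub>M i\<in>{1..j}. lborel) (\<lambda>y. \<Prod>i=1..j. ennreal (Re (block_density \<phi> (l i) (y i))))"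
  proof (rule PiM_density)
    fix i assume i: "i \<in> {1..j}"
    show "(\<lambda>y. ennreal (Re (block_density \<phi> (l i) y))) \<in> borel_measurable borel"
      using block_density_measurable[OF l1[OF i]] by measurable
    show "sigma_finite_measure (density lborel (\<lambda>y. ennreal (Re (block_density \<phi> (l i) y))))"
      unfolding sum_law_density[OF l1[OF i], symmetric]
      by (rule borel_probD[OF sum_law_prob[OF law_prob]])
  qed simp
  also have "\<dots> = density (\<Pi>\<^sub>M i\<in>{1..j}. lborel) (\<lambda>y. ennreal (\<Prod>i=1..j. Re (block_density \<phi> (l i) (y i))))"
    using l1 block_density_nonneg by (subst prod_ennreal) auto
  finally show ?thesis .
qed

lemma prod_block_density_measurable:
  assumes l: "l \<in> tuples j"
  shows "(\<lambda>y. \<Prod>i=1..j. block_density \<phi> (l i) (y i)) \<in> borel_measurable (\<Pi>\<^sub>M i\<in>{1..j}. lborel)"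
proof (rule borel_measurable_prod)
  fix i assume i: "i \<in> {1..j}"
  then have "l i \<ge> 1" using l by (auto simp: tuples_def PiE_iff)
  moreover have "(\<lambda>y. y i) \<in> borel_measurable (\<Pi>\<^sub>M i\<in>{1..j}. lborel)"
    using measurable_component_singleton[OF i, of "\<lambda>_. lborel"] by simp
  ultimately show "(\<lambda>y. block_density \<phi> (l i) (y i)) \<in> borel_measurable (\<Pi>\<^sub>M i\<in>{1..j}. lborel)"
    using measurable_compose[OF _ block_density_measurable] by blast
qed

definition pair_integrand :: "real \<Rightarrow> real \<Rightarrow> nat \<Rightarrow> (nat \<Rightarrow> nat) \<Rightarrow> nat \<Rightarrow> (nat \<Rightarrow> nat) \<Rightarrow> (nat \<Rightarrow> real) \<times> (nat \<Rightarrow> real) \<Rightarrow> complex" where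
  "pair_integrand \<alpha> \<beta> j l k n = (\<lambda>(y, z).
     exp (\<i> * of_real (\<alpha> * (\<Sum>i=1..j. y i)) + \<i> * of_real (\<beta> * Omega j k y z)) *
     ((\<Prod>i=1..j. block_density \<phi> (l i) (y i)) * (\<Prod>i=1..k. block_density \<phi> (n i) (z i))))"

text \<open>The block densities are nonnegative, so their product is the density of the joint law of all
  block sums, under which the phase has modulus 1.\<close>

lemma
  assumes l: "l \<in> tuples j" and n: "n \<in> tuples k"
  shows integrable_pair_integrand: "integrable (vol j k) (pair_integrand \<alpha> \<beta> j l k n)"
    and integral_pair_integrand: "(\<integral>yz. pair_integrand \<alpha> \<beta> j l k n yz \<partial>vol j k) = pair_integral \<alpha> \<beta> j l k n"
    and norm_pair_integrand: "(\<integral>yz. norm (pair_integrand \<alpha> \<beta> j l k n yz) \<partial>vol j k) = 1"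
    and norm_pair_integral: "norm (pair_integral \<alpha> \<beta> j l k n) \<le> 1"
proof -
  let ?N = "law_of \<phi>"
  let ?r = "\<lambda>j l y. \<Prod>i=1..j. Re (block_density \<phi> (l i) (y i))"
  let ?\<mu> = "\<lambda>j l. \<Pi>\<^sub>M i\<in>{1..j}. sum_law ?N (l i)"
  let ?s = "\<lambda>j y. \<Sum>i=1..j. clip (y i, y i)"
  let ?K = "\<lambda>(y, z). phase \<alpha> \<beta> (?s j y) (?s k z)"
  have sets: "sets (sum_law ?N m) = sets borel" for m
    by (rule borel_probD[OF sum_law_prob[OF law_prob]])
  have prob: "prob_space (?\<mu> j l)" for j l
    by (intro prob_space_PiM borel_probD[OF sum_law_prob[OF law_prob]])
  interpret P: pair_prob_space "?\<mu> j l" "?\<mu> k n"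
    unfolding pair_prob_space_def pair_sigma_finite_def by (intro conjI prob prob_space_imp_sigma_finite)
  have r_nonneg: "?r j l y \<ge> 0" if "l \<in> tuples j" for j l y
    using that by (intro prod_nonneg ballI block_density_nonneg) (auto simp: tuples_def PiE_iff)
  have g_real: "(\<Prod>i=1..j. block_density \<phi> (l i) (y i)) = of_real (?r j l y)" if "l \<in> tuples j" for j l y
    unfolding of_real_prod
    using that by (intro prod.cong refl block_density_real) (auto simp: tuples_def PiE_iff)
  have r_meas: "?r j l \<in> borel_measurable (\<Pi>\<^sub>M i\<in>{1..j}. lborel)" if "l \<in> tuples j" for j l
  proof -
    have "(\<lambda>y. Re (\<Prod>i=1..j. block_density \<phi> (l i) (y i))) \<in> borel_measurable (\<Pi>\<^sub>M i\<in>{1..j}. lborel)"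
      using prod_block_density_measurable[OF that] by measurable
    then show ?thesis by (simp only: g_real[OF that] Re_complex_of_real)
  qed
  note [measurable] = r_meas[OF l] r_meas[OF n]
  interpret L: product_sigma_finite "\<lambda>i::nat. lborel :: real measure" by unfold_locales
  have sf: "sigma_finite_measure (\<Pi>\<^sub>M i\<in>{1..j}. (lborel :: real measure))" for j :: nat
    by (rule L.sigma_finite) simp
  have dens: "?\<mu> j l \<Otimes>\<^sub>M ?\<mu> k n = density (vol j k) (\<lambda>(y, z). ennreal (?r j l y * ?r k n z))"
  proof -
    have "?\<mu> j l \<Otimes>\<^sub>M ?\<mu> k n = density (vol j k) (\<lambda>(y, z). ennreal (?r j l y) * ennreal (?r k n z))"
      unfolding PiM_sum_law[OF l] PiM_sum_law[OF n]
    proof (rule pair_measure_density)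
      show "sigma_finite_measure (density (\<Pi>\<^sub>M i\<in>{1..k}. lborel) (\<lambda>y. ennreal (?r k n y)))"
        unfolding PiM_sum_law[OF n, symmetric] by (rule prob_space_imp_sigma_finite[OF prob])
    qed (rule sf measurable_compose[OF r_meas[OF l] measurable_ennreal]
        measurable_compose[OF r_meas[OF n] measurable_ennreal])+
    also have "(\<lambda>(y, z). ennreal (?r j l y) * ennreal (?r k n z)) = (\<lambda>(y, z). ennreal (?r j l y * ?r k n z))"
      using r_nonneg[OF l] r_nonneg[OF n] by (simp add: fun_eq_iff ennreal_mult)
    finally show ?thesis .
  qed
  have K_borel: "?K \<in> borel_measurable (?\<mu> j l \<Otimes>\<^sub>M ?\<mu> k n)"
  proof -
    have "(\<lambda>(y, z). (?s j y, ?s k z)) \<in> measurable (?\<mu> j l \<Otimes>\<^sub>M ?\<mu> k n) (borel \<Otimes>\<^sub>M borel)"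
      unfolding split_beta'
      by (intro measurable_Pair measurable_compose[OF measurable_fst measurable_clip_sum]
          measurable_compose[OF measurable_snd measurable_clip_sum] sets)
    from measurable_compose[OF this phase_measurable[of \<alpha> \<beta>]] show ?thesis
      by (simp add: split_beta')
  qed
  have K_vol: "?K \<in> borel_measurable (vol j k)"
    using K_borel unfolding dens by simp
  have K_int: "integrable (?\<mu> j l \<Otimes>\<^sub>M ?\<mu> k n) ?K"
    by (rule P.integrable_const_bound[where B=1]) (use K_borel in \<open>auto simp: split_beta'\<close>)
  have pi: "pair_integrand \<alpha> \<beta> j l k n yz = (\<lambda>(y, z). ?r j l y * ?r k n z) yz *\<^sub>R ?K yz" for yz
    unfolding pair_integrand_def split_beta' g_real[OF l] g_real[OF n] phase_Omega scaleR_conv_of_real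
    by (simp only: of_real_mult mult.commute)
  have r_vol: "(\<lambda>(y, z). ?r j l y * ?r k n z) \<in> borel_measurable (vol j k)"
    by measurable
  have ae: "AE yz in vol j k. 0 \<le> (\<lambda>(y, z). ?r j l y * ?r k n z) yz"
    using r_nonneg[OF l] r_nonneg[OF n] by (auto simp: split_beta')
  have d': "?\<mu> j l \<Otimes>\<^sub>M ?\<mu> k n = density (vol j k) (\<lambda>yz. ennreal ((\<lambda>(y, z). ?r j l y * ?r k n z) yz))"
    unfolding dens by (simp add: split_beta')
  show int: "integrable (vol j k) (pair_integrand \<alpha> \<beta> j l k n)"
    using K_int unfolding d' integrable_density[OF K_vol r_vol ae] pi .
  have "(\<integral>yz. pair_integrand \<alpha> \<beta> j l k n yz \<partial>vol j k) = (\<integral>yz. ?K yz \<partial>(?\<mu> j l \<Otimes>\<^sub>M ?\<mu> k n))"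
    unfolding pi d' by (rule integral_density[OF K_vol r_vol ae, symmetric])
  also have "\<dots> = pair_integral \<alpha> \<beta> j l k n"
    using P.integral_fst'[OF K_int] by (simp add: pair_integral_def block_integral_def)
  finally show eq: "(\<integral>yz. pair_integrand \<alpha> \<beta> j l k n yz \<partial>vol j k) = pair_integral \<alpha> \<beta> j l k n" .
  have one: "(\<lambda>_. 1 :: real) \<in> borel_measurable (vol j k)" by simp
  have "norm (pair_integrand \<alpha> \<beta> j l k n yz) = (\<lambda>(y, z). ?r j l y * ?r k n z) yz *\<^sub>R 1" for yz
    unfolding pi using r_nonneg[OF l] r_nonneg[OF n] by (simp add: split_beta')
  then have "(\<integral>yz. norm (pair_integrand \<alpha> \<beta> j l k n yz) \<partial>vol j k) = (\<integral>yz. 1 \<partial>(?\<mu> j l \<Otimes>\<^sub>M ?\<mu> k n))"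
    unfolding d' integral_density[OF one r_vol ae] by simp
  also have "\<dots> = 1" using P.prob_space by simp
  finally show norm1: "(\<integral>yz. norm (pair_integrand \<alpha> \<beta> j l k n yz) \<partial>vol j k) = 1" .
  show "norm (pair_integral \<alpha> \<beta> j l k n) \<le> 1"
    unfolding eq[symmetric] norm1[symmetric] by (rule integral_norm_bound)
qed

end

section \<open>Summation over all blocks\<close>

text \<open>A number \<open>j \<ge> 1\<close> of blocks together with their lengths: the index set of one of the two expansions.\<close>

definition blocks :: "(nat \<times> (nat \<Rightarrow> nat)) set" where
  "blocks = Sigma {1..} tuples"

definition block_total :: "nat \<times> (nat \<Rightarrow> nat) \<Rightarrow> nat" where
  "block_total = (\<lambda>(j, l). \<Sum>i=1..j. l i)"

definition blocks_of :: "nat \<Rightarrow> (nat \<times> (nat \<Rightarrow> nat)) set" where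
  "blocks_of p = Sigma {1..p} (\<lambda>j. compositions j p)"

definition block_weight :: "nat \<times> (nat \<Rightarrow> nat) \<Rightarrow> complex" where
  "block_weight = (\<lambda>(j, l). 1 / fact j * (\<Prod>i=1..j. 1 / of_nat (l i)))"

lemma finite_blocks_of [simp]: "finite (blocks_of p)"
  by (simp add: blocks_of_def)

lemma blocks_of_eq: "p \<ge> 1 \<Longrightarrow> blocks_of p = {x \<in> blocks. block_total x = p}"
proof -
  assume "p \<ge> 1"
  have "j \<le> p" if "l \<in> compositions j p" for j l
    using compositions_empty[of p j] that by (cases "p < j") auto
  then show ?thesis
    by (auto simp: blocks_of_def blocks_def block_total_def compositions_eq_tuples)
qed

lemma block_total_ge_1: "x \<in> blocks \<Longrightarrow> block_total x \<ge> 1"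
proof -
  assume x: "x \<in> blocks"
  obtain j l where jl: "x = (j, l)" "j \<ge> 1" "l \<in> tuples j" using x by (auto simp: blocks_def)
  then have "l 1 \<ge> 1" by (auto simp: tuples_def PiE_iff)
  also have "l 1 \<le> (\<Sum>i=1..j. l i)" using jl by (intro member_le_sum) auto
  finally show ?thesis by (simp add: block_total_def jl)
qed

lemma blocks_of_total: "x \<in> blocks \<Longrightarrow> x \<in> blocks_of (block_total x)"
  using block_total_ge_1 by (simp add: blocks_of_eq)

lemma blocks_ofD: "x \<in> blocks_of p \<Longrightarrow> p \<ge> 1 \<Longrightarrow> x \<in> blocks \<and> block_total x = p"
  by (simp add: blocks_of_eq)

lemma block_weight_nonneg: "block_weight x = of_real (norm (block_weight x))"
proof -
  have "block_weight x = of_real (1 / fact (fst x) * (\<Prod>i=1..fst x. 1 / real (snd x i)))"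
    by (simp add: block_weight_def split_beta')
  moreover have "0 \<le> 1 / fact (fst x) * (\<Prod>i=1..fst x. 1 / real (snd x i))"
    by (intro mult_nonneg_nonneg prod_nonneg) auto
  ultimately show ?thesis by (metis norm_of_real abs_of_nonneg)
qed

lemma walk_law_expansion_blocks:
  assumes "borel_prob N" "bounded_borel f" "p \<ge> 1"
  shows "(\<integral>x. f x \<partial>walk_law N p) =
    (\<Sum>x\<in>blocks_of p. block_weight x * block_integral N (fst x) (snd x) f)"
proof -
  have "(\<integral>x. f x \<partial>walk_law N p) =
      (\<Sum>j\<in>{1..p}. 1 / fact j * (\<Sum>l\<in>compositions j p. block_term N j l f))"
    unfolding walk_law_expansion[OF assms(1,2)]
  proof (rule sum.mono_neutral_right)
    show "\<forall>j\<in>{..p} - {1..p}. 1 / fact j * (\<Sum>l\<in>compositions j p. block_term N j l f) = 0"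
    proof
      fix j assume "j \<in> {..p} - {1..p}"
      then have "j = 0" by auto
      then show "1 / fact j * (\<Sum>l\<in>compositions j p. block_term N j l f) = 0"
        using assms(3) by (simp add: compositions_0)
    qed
  qed auto
  also have "\<dots> = (\<Sum>j\<in>{1..p}. \<Sum>l\<in>compositions j p. block_weight (j, l) * block_integral N j l f)"
    by (simp add: block_weight_def block_term_def sum_distrib_left mult.assoc)
  also have "\<dots> = (\<Sum>x\<in>blocks_of p. block_weight x * block_integral N (fst x) (snd x) f)"
    unfolding blocks_of_def by (subst sum.Sigma) (auto simp: split_beta')
  finally show ?thesis .
qed

lemma block_integral_const:
  assumes "borel_prob N"
  shows "block_integral N j l (\<lambda>_. c) = c"
proof -
  interpret prob_space "\<Pi>\<^sub>M i\<in>{1..j}. sum_law N (l i)"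
    by (intro prob_space_PiM borel_probD[OF sum_law_prob[OF assms]])
  show ?thesis using prob_space by (simp add: block_integral_def)
qed

text \<open>Apply the expansion to the constant 1; any step law will do, and that of the constant 0 is at hand.\<close>

lemma sum_norm_block_weight:
  assumes "p \<ge> 1"
  shows "(\<Sum>x\<in>blocks_of p. norm (block_weight x)) = 1"
proof -
  let ?N = "return borel 0 :: real measure"
  have bp: "borel_prob ?N" by (rule borel_prob_return)
  interpret prob_space "walk_law ?N p" by (rule borel_probD[OF walk_law_prob[OF bp]])
  have "bounded_borel (\<lambda>_::real \<times> real. 1)" by (auto simp: bounded_borel_def)
  from walk_law_expansion_blocks[OF bp this assms]
  have "(\<Sum>x\<in>blocks_of p. block_weight x) = 1"
    using prob_space by (simp add: block_integral_const[OF bp])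
  also have "(\<Sum>x\<in>blocks_of p. block_weight x) = of_real (\<Sum>x\<in>blocks_of p. norm (block_weight x))"
    unfolding of_real_sum by (rule sum.cong[OF refl block_weight_nonneg])
  finally show ?thesis by (metis of_real_eq_1_iff)
qed

lemma bij_betw_blocks:
  "bij_betw (\<lambda>x. (block_total x, x)) blocks (Sigma {1..} blocks_of)"
proof (rule bij_betw_byWitness[where f'=snd])
  show "(\<lambda>x. (block_total x, x)) ` blocks \<subseteq> Sigma {1..} blocks_of"
    using block_total_ge_1 blocks_of_total by force
qed (auto dest: blocks_ofD)

lemma block_weight_summable:
  assumes "norm a < 1"
  shows "(\<lambda>x. norm (block_weight x * a ^ block_total x)) summable_on blocks"
proof -
  have geo: "(\<lambda>p. norm a ^ p) summable_on {1..}"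
    using assms by (intro summable_on_subset_banach[where A=UNIV and B="{1..}"])
      (simp_all add: summable_on_UNIV_nonneg_real_iff summable_geometric)
  have "(\<lambda>(p, x). norm (block_weight x) * norm a ^ p) summable_on (Sigma {1..} blocks_of)"
  proof (rule summable_on_SigmaI[OF _ geo])
    fix p :: nat assume "p \<in> {1..}"
    then have "(\<Sum>x\<in>blocks_of p. norm (block_weight x) * norm a ^ p) = norm a ^ p"
      unfolding sum_distrib_right[symmetric] by (simp add: sum_norm_block_weight)
    then show "((\<lambda>x. case (p, x) of (p, x) \<Rightarrow> norm (block_weight x) * norm a ^ p) has_sum norm a ^ p) (blocks_of p)"
      by (simp add: has_sum_finite_iff)
  qed auto
  then show ?thesis
    using summable_on_reindex_bij_betw[OF bij_betw_blocks, of "\<lambda>(p, x). norm (block_weight x) * norm a ^ p"]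
    by (simp add: norm_mult norm_power)
qed

context schwartz_density begin

definition double_term :: "complex \<Rightarrow> complex \<Rightarrow> real \<Rightarrow> real \<Rightarrow>
    (nat \<times> (nat \<Rightarrow> nat)) \<times> (nat \<times> (nat \<Rightarrow> nat)) \<Rightarrow> complex" where
  "double_term a b \<alpha> \<beta> = (\<lambda>(x, x').
     (block_weight x * a ^ block_total x) * (block_weight x' * b ^ block_total x') *
     pair_integral \<alpha> \<beta> (fst x) (snd x) (fst x') (snd x'))"

lemma double_term_summable:
  assumes "norm a < 1" "norm b < 1"
  shows "(\<lambda>x. norm (double_term a b \<alpha> \<beta> x)) summable_on blocks \<times> blocks"
proof (rule summable_on_comparison_test)
  show "(\<lambda>(x, x'). norm ((block_weight x * a ^ block_total x) * (block_weight x' * b ^ block_total x'))) summable_on blocks \<times> blocks"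
    by (intro abs_summable_times block_weight_summable assms)
  fix X assume "X \<in> blocks \<times> blocks"
  then obtain j l k n where X: "X = ((j, l), (k, n))" "l \<in> tuples j" "n \<in> tuples k"
    by (auto simp: blocks_def)
  have "norm (double_term a b \<alpha> \<beta> X) \<le>
      norm ((block_weight (j, l) * a ^ block_total (j, l)) * (block_weight (k, n) * b ^ block_total (k, n))) * 1"
    unfolding double_term_def X split fst_conv snd_conv norm_mult[of _ "pair_integral \<alpha> \<beta> j l k n"]
    by (intro mult_left_mono norm_pair_integral X) simp
  then show "norm (double_term a b \<alpha> \<beta> X) \<le>
      (\<lambda>(x, x'). norm ((block_weight x * a ^ block_total x) * (block_weight x' * b ^ block_total x'))) X"
    by (simp add: X)
qed simp

text \<open>The inner law is expanded first, for a fixed value of the outer variable; the resulting functions of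
  the outer variable are again bounded and Borel.\<close>

lemma walk_integral_expansion:
  assumes p: "p \<ge> 1" and q: "q \<ge> 1"
  shows "(\<integral>u. \<integral>v. phase \<alpha> \<beta> u v \<partial>walk_law (law_of \<phi>) q \<partial>walk_law (law_of \<phi>) p) =
    (\<Sum>x\<in>blocks_of p. \<Sum>x'\<in>blocks_of q.
       block_weight x * block_weight x' * pair_integral \<alpha> \<beta> (fst x) (snd x) (fst x') (snd x'))"
proof -
  let ?N = "law_of \<phi>"
  let ?h = "\<lambda>x' u. block_integral ?N (fst x') (snd x') (phase \<alpha> \<beta> u)"
  have bb: "bounded_borel (?h x')" for x'
    unfolding block_integral_def
  proof (rule phase_integral_bounded_borel)
    show "prob_space (\<Pi>\<^sub>M i\<in>{1..fst x'}. sum_law ?N (snd x' i))"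
      by (intro prob_space_PiM borel_probD[OF sum_law_prob[OF law_prob]])
    show "(\<lambda>y. \<Sum>i=1..fst x'. clip (y i, y i)) \<in> borel_measurable (\<Pi>\<^sub>M i\<in>{1..fst x'}. sum_law ?N (snd x' i))"
      by (rule measurable_clip_sum) (rule borel_probD[OF sum_law_prob[OF law_prob]])
  qed
  have int: "integrable (walk_law ?N p) (?h x')" for x'
    using integrable_bounded_borel[OF _ bb[of x'], of "walk_law ?N p" "\<lambda>u. u"]
      borel_probD[OF walk_law_prob[OF law_prob], of p]
    by (simp cong: measurable_cong_sets)
  have "(\<integral>u. \<integral>v. phase \<alpha> \<beta> u v \<partial>walk_law ?N q \<partial>walk_law ?N p) =
      (\<integral>u. (\<Sum>x'\<in>blocks_of q. block_weight x' * ?h x' u) \<partial>walk_law ?N p)"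
    by (simp only: walk_law_expansion_blocks[OF law_prob phase_section_bounded_borel q])
  also have "\<dots> = (\<Sum>x'\<in>blocks_of q. block_weight x' * (\<integral>u. ?h x' u \<partial>walk_law ?N p))"
    by (subst Bochner_Integration.integral_sum) (simp_all add: int)
  also have "\<dots> = (\<Sum>x'\<in>blocks_of q. block_weight x' * (\<Sum>x\<in>blocks_of p. block_weight x *
      pair_integral \<alpha> \<beta> (fst x) (snd x) (fst x') (snd x')))"
    by (simp only: walk_law_expansion_blocks[OF law_prob bb p] pair_integral_def)
  also have "\<dots> = (\<Sum>x'\<in>blocks_of q. \<Sum>x\<in>blocks_of p.
       block_weight x * block_weight x' * pair_integral \<alpha> \<beta> (fst x) (snd x) (fst x') (snd x'))"
    by (simp add: sum_distrib_left ac_simps)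
  also have "\<dots> = (\<Sum>x\<in>blocks_of p. \<Sum>x'\<in>blocks_of q.
       block_weight x * block_weight x' * pair_integral \<alpha> \<beta> (fst x) (snd x) (fst x') (snd x'))"
    by (rule sum.swap)
  finally show ?thesis .
qed

text \<open>There are finitely many blocks of each given pair of total lengths.\<close>

lemma has_sum_by_lengths:
  assumes "(double_term a b \<alpha> \<beta> has_sum S) (blocks \<times> blocks)"
  shows "((\<lambda>(p, q). a ^ p * b ^ q *
      (\<integral>u. \<integral>v. phase \<alpha> \<beta> u v \<partial>walk_law (law_of \<phi>) q \<partial>walk_law (law_of \<phi>) p)) has_sum S) ({1..} \<times> {1..})"
proof -
  let ?B = "\<lambda>(p, q). blocks_of p \<times> blocks_of q"
  have bij: "bij_betw (\<lambda>(x, x'). ((block_total x, block_total x'), (x, x'))) (blocks \<times> blocks) (Sigma ({1..} \<times> {1..}) ?B)"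
  proof (rule bij_betw_byWitness[where f'=snd])
    show "(\<lambda>(x, x'). ((block_total x, block_total x'), (x, x'))) ` (blocks \<times> blocks) \<subseteq> Sigma ({1..} \<times> {1..}) ?B"
      using block_total_ge_1 blocks_of_total by force
  qed (auto dest: blocks_ofD)
  have "((\<lambda>X. double_term a b \<alpha> \<beta> (snd X)) has_sum S) (Sigma ({1..} \<times> {1..}) ?B)"
    using has_sum_reindex_bij_betw[OF bij, of "\<lambda>X. double_term a b \<alpha> \<beta> (snd X)" S] assms
    by (simp add: split_beta')
  then show ?thesis
  proof (rule has_sum_SigmaD)
    fix P :: "nat \<times> nat" assume "P \<in> {1..} \<times> {1..}"
    then obtain p q where P: "P = (p, q)" "p \<ge> 1" "q \<ge> 1" by auto
    have "(\<Sum>X\<in>?B P. double_term a b \<alpha> \<beta> X) =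
        (\<Sum>x\<in>blocks_of p. \<Sum>x'\<in>blocks_of q. double_term a b \<alpha> \<beta> (x, x'))"
      by (simp add: P sum.cartesian_product)
    also have "\<dots> = (\<Sum>x\<in>blocks_of p. \<Sum>x'\<in>blocks_of q. a ^ p * b ^ q *
       (block_weight x * block_weight x' * pair_integral \<alpha> \<beta> (fst x) (snd x) (fst x') (snd x')))"
      using P by (intro sum.cong refl) (simp add: double_term_def blocks_of_eq ac_simps)
    also have "\<dots> = a ^ p * b ^ q *
      (\<integral>u. \<integral>v. phase \<alpha> \<beta> u v \<partial>walk_law (law_of \<phi>) q \<partial>walk_law (law_of \<phi>) p)"
      unfolding walk_integral_expansion[OF P(2,3)] sum_distrib_left ..
    finally have "(\<Sum>X\<in>?B P. double_term a b \<alpha> \<beta> X) = (case P of (p, q) \<Rightarrow> a ^ p * b ^ q *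
      (\<integral>u. \<integral>v. phase \<alpha> \<beta> u v \<partial>walk_law (law_of \<phi>) q \<partial>walk_law (law_of \<phi>) p))"
      by (simp add: P)
    then show "((\<lambda>X. double_term a b \<alpha> \<beta> (snd (P, X))) has_sum (case P of (p, q) \<Rightarrow> a ^ p * b ^ q *
      (\<integral>u. \<integral>v. phase \<alpha> \<beta> u v \<partial>walk_law (law_of \<phi>) q \<partial>walk_law (law_of \<phi>) p))) (?B P)"
      by (simp add: has_sum_finite_iff P)
  qed
qed

definition log_integrand :: "complex \<Rightarrow> complex \<Rightarrow> real \<Rightarrow> real \<Rightarrow> nat \<Rightarrow> nat \<Rightarrow>
    (nat \<Rightarrow> real) \<times> (nat \<Rightarrow> real) \<Rightarrow> complex" where
  "log_integrand a b \<alpha> \<beta> j k = (\<lambda>(y, z).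
     exp (\<i> * of_real (\<alpha> * (\<Sum>i=1..j. y i)) + \<i> * of_real (\<beta> * Omega j k y z)) *
     ((\<Prod>i=1..j. log_density \<phi> a (y i)) * (\<Prod>i=1..k. log_density \<phi> b (z i))))"

text \<open>Multiplying out the products of series gives an absolutely convergent sum of multiples of
  \<open>pair_integrand\<close>, whose norms have integral 1, so that the sum of the coefficients dominates.\<close>

lemma
  assumes a: "norm a < 1" and b: "norm b < 1"
  shows integrable_log_integrand: "integrable (vol j k) (log_integrand a b \<alpha> \<beta> j k)"
    and has_sum_log_integrand:
      "((\<lambda>(l, n). ((\<Prod>i=1..j. a ^ l i / of_nat (l i)) * (\<Prod>i=1..k. b ^ n i / of_nat (n i))) * pair_integral \<alpha> \<beta> j l k n)
        has_sum (\<integral>yz. log_integrand a b \<alpha> \<beta> j k yz \<partial>vol j k)) (tuples j \<times> tuples k)"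
proof -
  let ?c = "\<lambda>(l, n). (\<Prod>i=1..j. a ^ l i / of_nat (l i)) * (\<Prod>i=1..k. b ^ n i / of_nat (n i))"
  let ?f = "\<lambda>(l, n) yz. ?c (l, n) * pair_integrand \<alpha> \<beta> j l k n yz"
  let ?I = "tuples j \<times> tuples k"
  have c: "(\<lambda>x. norm (?c x)) summable_on ?I"
    using abs_summable_times[OF abs_summable_prod_tuples abs_summable_prod_tuples,
        of j "\<lambda>i l. a ^ l / of_nat l" k "\<lambda>i l. b ^ l / of_nat l"]
      log_series_abs_summable[OF a] log_series_abs_summable[OF b]
    by (simp add: split_beta')
  have int: "integrable (vol j k) (?f x)" if "x \<in> ?I" for x
    using that integrable_pair_integrand by auto
  have norms: "(\<lambda>x. \<integral>yz. norm (?f x yz) \<partial>vol j k) summable_on ?I"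
    using c
  proof (rule summable_on_cong[THEN iffD1, rotated])
    fix x assume "x \<in> ?I"
    then obtain l n where x: "x = (l, n)" "l \<in> tuples j" "n \<in> tuples k" by auto
    show "norm (?c x) = (\<integral>yz. norm (?f x yz) \<partial>vol j k)"
      unfolding x split
      by (simp only: norm_mult integral_mult_right_zero norm_pair_integrand[OF x(2,3)] mult_1_right)
  qed
  have pw: "(\<lambda>x. norm (?f x yz)) summable_on ?I"
    and inf: "(\<Sum>\<^sub>\<infinity>x\<in>?I. ?f x yz) = log_integrand a b \<alpha> \<beta> j k yz" for yz
  proof -
    obtain y z where yz: "yz = (y, z)" by (cases yz)
    define e where "e = exp (\<i> * of_real (\<alpha> * (\<Sum>i=1..j. y i)) + \<i> * of_real (\<beta> * Omega j k y z))"
    let ?F = "\<lambda>l. \<Prod>i=1..j. a ^ l i / of_nat (l i) * block_density \<phi> (l i) (y i)"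
    let ?G = "\<lambda>n. \<Prod>i=1..k. b ^ n i / of_nat (n i) * block_density \<phi> (n i) (z i)"
    have f: "?f x yz = e * (\<lambda>(l, n). ?F l * ?G n) x" for x
      unfolding yz pair_integrand_def e_def split_beta' fst_conv snd_conv prod.distrib
      by (simp only: ac_simps)
    note sF = abs_summable_prod_tuples[where j=j and c="\<lambda>i l. a ^ l / of_nat l * block_density \<phi> l (y i)",
        OF log_density_abs_summable[OF a]]
      and sG = abs_summable_prod_tuples[where j=k and c="\<lambda>i l. b ^ l / of_nat l * block_density \<phi> l (z i)",
        OF log_density_abs_summable[OF b]]
      and hF = has_sum_prod_tuples[where j=j and c="\<lambda>i l. a ^ l / of_nat l * block_density \<phi> l (y i)",
        OF log_density_abs_summable[OF a]]
      and hG = has_sum_prod_tuples[where j=k and c="\<lambda>i l. b ^ l / of_nat l * block_density \<phi> l (z i)",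
        OF log_density_abs_summable[OF b]]
    have "(\<lambda>x. norm e * norm ((\<lambda>(l, n). ?F l * ?G n) x)) summable_on ?I"
      using abs_summable_times[OF sF sG] by (intro summable_on_cmult_right) (simp add: split_beta')
    then show "(\<lambda>x. norm (?f x yz)) summable_on ?I"
      unfolding f norm_mult[of e] .
    have "(\<Sum>\<^sub>\<infinity>x\<in>?I. ?f x yz) = e * (\<Sum>\<^sub>\<infinity>(l, n)\<in>?I. ?F l * ?G n)"
      unfolding f by (rule infsum_cmult_right')
    also have "(\<Sum>\<^sub>\<infinity>(l, n)\<in>?I. ?F l * ?G n) = infsum ?F (tuples j) * infsum ?G (tuples k)"
      by (rule infsum_times[OF sF sG])
    also have "\<dots> = (\<Prod>i=1..j. log_density \<phi> a (y i)) * (\<Prod>i=1..k. log_density \<phi> b (z i))"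
      unfolding infsumI[OF hF] infsumI[OF hG] log_density_def ..
    finally show "(\<Sum>\<^sub>\<infinity>x\<in>?I. ?f x yz) = log_integrand a b \<alpha> \<beta> j k yz"
      by (simp add: log_integrand_def yz e_def)
  qed
  have cI: "countable ?I" by simp
  have "integrable (vol j k) (\<lambda>yz. \<Sum>\<^sub>\<infinity>x\<in>?I. ?f x yz)"
    by (rule integrable_infsum[OF cI int pw norms])
  then show "integrable (vol j k) (log_integrand a b \<alpha> \<beta> j k)"
    unfolding inf by simp
  have "((\<lambda>x. \<integral>yz. ?f x yz \<partial>vol j k) has_sum (\<integral>yz. (\<Sum>\<^sub>\<infinity>x\<in>?I. ?f x yz) \<partial>vol j k)) ?I"
    by (rule has_sum_integral[OF cI int pw norms])
  then have "((\<lambda>x. \<integral>yz. ?f x yz \<partial>vol j k) has_sum (\<integral>yz. log_integrand a b \<alpha> \<beta> j k yz \<partial>vol j k)) ?I"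
    unfolding inf .
  then show "((\<lambda>(l, n). ((\<Prod>i=1..j. a ^ l i / of_nat (l i)) * (\<Prod>i=1..k. b ^ n i / of_nat (n i))) * pair_integral \<alpha> \<beta> j l k n)
        has_sum (\<integral>yz. log_integrand a b \<alpha> \<beta> j k yz \<partial>vol j k)) ?I"
  proof (rule has_sum_cong[THEN iffD1, rotated])
    fix x assume "x \<in> ?I"
    then obtain l n where x: "x = (l, n)" "l \<in> tuples j" "n \<in> tuples k" by auto
    show "(\<integral>yz. ?f x yz \<partial>vol j k) = (\<lambda>(l, n). ((\<Prod>i=1..j. a ^ l i / of_nat (l i)) *
        (\<Prod>i=1..k. b ^ n i / of_nat (n i))) * pair_integral \<alpha> \<beta> j l k n) x"
      unfolding x split by (simp only: integral_mult_right_zero integral_pair_integrand[OF x(2,3)])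
  qed
qed

lemma has_sum_by_counts:
  assumes a: "norm a < 1" and b: "norm b < 1"
    and S: "(double_term a b \<alpha> \<beta> has_sum S) (blocks \<times> blocks)"
  shows "((\<lambda>(j, k). 1 / fact j * (1 / fact k) * (\<integral>yz. log_integrand a b \<alpha> \<beta> j k yz \<partial>vol j k)) has_sum S) ({1..} \<times> {1..})"
proof -
  let ?B = "\<lambda>(j, k). tuples j \<times> tuples k"
  let ?g = "\<lambda>((j, k), (l, n)). double_term a b \<alpha> \<beta> ((j, l), (k, n))"
  have bij: "bij_betw (\<lambda>((j, l), (k, n)). ((j, k), (l, n))) (blocks \<times> blocks) (Sigma ({1..} \<times> {1..}) ?B)"
    by (rule bij_betw_byWitness[where f'="\<lambda>((j, k), (l, n)). ((j, l), (k, n))"]) (auto simp: blocks_def)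
  have "(?g has_sum S) (Sigma ({1..} \<times> {1..}) ?B)"
    using has_sum_reindex_bij_betw[OF bij, of ?g S] S
    by (simp add: split_beta')
  then show ?thesis
  proof (rule has_sum_SigmaD)
    fix P :: "nat \<times> nat"
    obtain j k where P: "P = (j, k)" by (cases P)
    have eq: "?g ((j, k), x) = 1 / fact j * (1 / fact k) *
        (\<lambda>(l, n). ((\<Prod>i=1..j. a ^ l i / of_nat (l i)) * (\<Prod>i=1..k. b ^ n i / of_nat (n i))) * pair_integral \<alpha> \<beta> j l k n) x" for x
    proof -
      obtain l n where x: "x = (l, n)" by (cases x)
      have "c ^ (\<Sum>i=1..m. s i) * (\<Prod>i=1..m. 1 / of_nat (s i)) = (\<Prod>i=1..m. c ^ s i / of_nat (s i))"
        for c :: complex and m and s :: "nat \<Rightarrow> nat"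
        by (simp add: power_sum prod.distrib[symmetric])
      note w = this[symmetric]
      show ?thesis
        unfolding x split w by (simp add: double_term_def block_weight_def block_total_def ac_simps)
    qed
    show "((\<lambda>x. ?g (P, x)) has_sum (case P of (j, k) \<Rightarrow>
        1 / fact j * (1 / fact k) * (\<integral>yz. log_integrand a b \<alpha> \<beta> j k yz \<partial>vol j k))) (?B P)"
      unfolding P eq prod.case(1)[of _ j k] by (rule has_sum_cmult_right[OF has_sum_log_integrand[OF a b]])
  qed
qed

text \<open>For fixed \<open>\<eta>\<close> the first factor is a constant in the inner transform, and the result of the inner
  transform is a constant in the outer one.\<close>

lemma inv_fourier_vars_Phi:
  assumes a: "norm a < 1" and b: "norm b < 1" and j: "j \<ge> 1" and k: "k \<ge> 1"
  shows "inv_fourier_vars j (\<lambda>\<eta>. inv_fourier_vars k (\<lambda>\<zeta>.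
      Phi j (\<lambda>s. a * s / (1 - a * s)) (\<lambda>i. density_transform \<phi> (\<eta> i)) *
      Phi k (\<lambda>t. b * t / (1 - b * t)) (\<lambda>i. density_transform \<phi> (\<zeta> i))) z) y =
    (\<Prod>i=1..j. log_density \<phi> a (y i)) * (\<Prod>i=1..k. log_density \<phi> b (z i))"
proof -
  let ?h = "\<lambda>c \<eta>. log_series (c * density_transform \<phi> \<eta>)"
  have A: "Phi j (\<lambda>s. a * s / (1 - a * s)) (\<lambda>i. density_transform \<phi> (\<eta> i)) = (\<Prod>i=1..j. ?h a (\<eta> i))" for \<eta>
    by (rule Phi_geometric[OF j a transform_norm_le_1])
  have B: "Phi k (\<lambda>t. b * t / (1 - b * t)) (\<lambda>i. density_transform \<phi> (\<zeta> i)) = (\<Prod>i=1..k. ?h b (\<zeta> i))" for \<zeta>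
    by (rule Phi_geometric[OF k b transform_norm_le_1])
  have ia: "inv_fourier (?h a) = log_density \<phi> a" and ib: "inv_fourier (?h b) = log_density \<phi> b"
    using inv_fourier_log_series a b by blast+
  let ?D = "\<Prod>i=1..k. log_density \<phi> b (z i)"
  have "inv_fourier_vars k (\<lambda>\<zeta>. (\<Prod>i=1..j. ?h a (\<eta> i)) * (\<Prod>i=1..k. ?h b (\<zeta> i))) z =
      ?D * (\<Prod>i=1..j. ?h a (\<eta> i))" for \<eta>
    unfolding inv_fourier_vars_prod[of k _ "?h b"] ib by (rule mult.commute)
  then show ?thesis
    unfolding A B using inv_fourier_vars_prod[of j ?D "?h a"] by (simp add: ia mult.commute)
qed

end

section \<open>The generating function identity\<close>

theorem theorem1p7:
  fixes M :: "'a measure" and X :: "nat \<Rightarrow> 'a \<Rightarrow> real" and \<phi> :: "real \<Rightarrow> real"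
    and a b :: complex and \<alpha> \<beta> :: real
  assumes "prob_space M"
    and "prob_space.indep_vars M (\<lambda>_. borel) X {1..}"
    and "\<And>i. i \<ge> 1 \<Longrightarrow> distributed M lborel (X i) (\<lambda>x. ennreal (\<phi> x))"
    and "\<And>x. \<phi> x \<ge> 0"
    and "schwartz \<phi>"
    and "norm a < 1" and "norm b < 1"
  shows
    "let S = partial_sum X;
         T = running_max X;
         \<phi>_hat = fourier (\<lambda>x. complex_of_real (\<phi> x));
         lhs_term = (\<lambda>(p, q). a ^ p * b ^ q *
           prob_space.expectation M
             (\<lambda>\<omega>. exp (\<i> * of_real (\<alpha> * S p \<omega>) + \<i> * of_real (\<beta> * T (p + q) \<omega>))));
         integrand = (\<lambda>j k (y, z).
           exp (\<i> * of_real (\<alpha> * (\<Sum>i=1..j. y i)) + \<i> * of_real (\<beta> * Omega j k y z)) *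
           inv_fourier_vars j (\<lambda>\<eta>. inv_fourier_vars k (\<lambda>\<zeta>.
               Phi j (\<lambda>s. a * s / (1 - a * s)) (\<lambda>i. \<phi>_hat (\<eta> i)) *
               Phi k (\<lambda>t. b * t / (1 - b * t)) (\<lambda>i. \<phi>_hat (\<zeta> i))) z) y);
         vol = (\<lambda>j k. (\<Pi>\<^sub>M i\<in>{1..j}. (lborel :: real measure)) \<Otimes>\<^sub>M
                      (\<Pi>\<^sub>M i\<in>{1..k}. (lborel :: real measure)));
         rhs_term = (\<lambda>(j, k). 1 / fact j * (1 / fact k) * (LINT yz|vol j k. integrand j k yz))
     in lhs_term summable_on {1..} \<times> {1..} \<and>
        (\<forall>j\<ge>1. \<forall>k\<ge>1. integrable (vol j k) (integrand j k)) \<and>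
        rhs_term summable_on {1..} \<times> {1..} \<and>
        infsum lhs_term ({1..} \<times> {1..}) =
        infsum rhs_term ({1..} \<times> {1..})"
proof -
  interpret prob_space M by fact
  have X1: "distributed M lborel (X 1) (\<lambda>x. ennreal (\<phi> x))" by (rule assms) simp
  have law: "distr M borel (X i) = law_of \<phi>" if "i \<ge> 1" for i
  proof -
    have "distr M borel (X i) = distr M lborel (X i)" by (rule distr_cong) auto
    then show ?thesis using distributed_distr_eq_density[OF assms(3)[OF that]] by simp
  qed
  have "random_variable borel (X 1)" using distributed_measurable[OF X1] by simp
  then have "prob_space (law_of \<phi>)"
    unfolding law[of 1, simplified, symmetric] by (simp add: prob_space_distr)
  then interpret schwartz_density \<phi>
    using assms by (simp add: schwartz_density_def)
  let ?lhs = "\<lambda>(p, q). a ^ p * b ^ q *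
      expectation (\<lambda>\<omega>. exp (\<i> * of_real (\<alpha> * partial_sum X p \<omega>) + \<i> * of_real (\<beta> * running_max X (p + q) \<omega>)))"
  let ?integrand = "\<lambda>j k (y, z).
      exp (\<i> * of_real (\<alpha> * (\<Sum>i=1..j. y i)) + \<i> * of_real (\<beta> * Omega j k y z)) *
      inv_fourier_vars j (\<lambda>\<eta>. inv_fourier_vars k (\<lambda>\<zeta>.
          Phi j (\<lambda>s. a * s / (1 - a * s)) (\<lambda>i. density_transform \<phi> (\<eta> i)) *
          Phi k (\<lambda>t. b * t / (1 - b * t)) (\<lambda>i. density_transform \<phi> (\<zeta> i))) z) y"
  let ?rhs = "\<lambda>(j, k). 1 / fact j * (1 / fact k) * (LINT yz|vol j k. ?integrand j k yz)"
  have integrand: "?integrand j k = log_integrand a b \<alpha> \<beta> j k" if "j \<ge> 1" "k \<ge> 1" for j k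
    unfolding log_integrand_def inv_fourier_vars_Phi[OF assms(6,7) that] ..
  obtain S where S: "(double_term a b \<alpha> \<beta> has_sum S) (blocks \<times> blocks)"
    using abs_summable_summable[OF double_term_summable[OF assms(6,7)]] by (auto simp: summable_on_def)
  have lhs: "(?lhs has_sum S) ({1..} \<times> {1..})"
  proof -
    have "expectation (\<lambda>\<omega>. exp (\<i> * of_real (\<alpha> * partial_sum X p \<omega>) + \<i> * of_real (\<beta> * running_max X (p + q) \<omega>))) =
        (\<integral>u. \<integral>v. phase \<alpha> \<beta> u v \<partial>walk_law (law_of \<phi>) q \<partial>walk_law (law_of \<phi>) p)" for p q
      by (rule expectation_phase[OF assms(1,2) _ law_prob]) (rule law)
    then show ?thesis using has_sum_by_lengths[OF S] by simp
  qed
  have rhs: "(?rhs has_sum S) ({1..} \<times> {1..})"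
  proof (rule has_sum_cong[THEN iffD1, OF _ has_sum_by_counts[OF assms(6,7) S]])
    fix x :: "nat \<times> nat" assume "x \<in> {1..} \<times> {1..}"
    then obtain j k where x: "x = (j, k)" "j \<ge> 1" "k \<ge> 1" by auto
    show "(\<lambda>(j, k). 1 / fact j * (1 / fact k) * (LINT yz|vol j k. log_integrand a b \<alpha> \<beta> j k yz)) x = ?rhs x"
      unfolding x(1) prod.case(1)[of _ j k] integrand[OF x(2,3)] ..
  qed
  have int: "\<forall>j\<ge>1. \<forall>k\<ge>1. integrable (vol j k) (?integrand j k)"
  proof (intro allI impI)
    fix j k :: nat assume "j \<ge> 1" "k \<ge> 1"
    show "integrable (vol j k) (?integrand j k)"
      unfolding integrand[OF \<open>j \<ge> 1\<close> \<open>k \<ge> 1\<close>] by (rule integrable_log_integrand[OF assms(6,7)])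
  qed
  show ?thesis
    unfolding Let_def
    by (intro conjI has_sum_imp_summable[OF lhs] int has_sum_imp_summable[OF rhs]
        trans[OF infsumI[OF lhs] infsumI[OF rhs, symmetric]])
qed

end
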